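(* Let $n\ge p$, and let $X$ ($m\times p$) and $S$ ($p\times p$) be independent with $X\sim \mathcal N_{m\times p}(\Theta, I_m\otimes\Sigma)$ and $S\sim\mathcal W_p(n,\Sigma)$. Assume $p>m$. For constants $\alpha>0$, $\beta>0$ let $\widehat\Sigma_0=n^{-1}S$ and $$\widehat\Sigma^{G1}=\widehat\Sigma_0+n^{-1}\alpha X^\top\{I_m+\beta XS^{-1}X^\top\}^{-1}X.$$ Then $\widehat\Sigma^{G1}$ dominates $\widehat\Sigma_0$ relative to the Stein loss $L_S(\widehat\Sigma,\Sigma)=\mathrm{tr}(\widehat\Sigma\Sigma^{-1})-\log|\widehat\Sigma\Sigma^{-1}|-p$ if $$\frac{\alpha}{\beta}\le\frac{2(p-m)}{n-p+m}.$$
   Context: $\mathcal N_{m\times p}(\Theta,I_m\otimes\Sigma)$ is the distribution of an $m\times p$ matrix with mean $\Theta$ and independent normal rows with covariance $\Sigma$ ($p\times p$ positive definite); $\mathcal W_p(n,\Sigma)$ is the Wishart distribution with $n$ degrees of freedom and scale $\Sigma$. Both $\Theta$ and $\Sigma$ are unknown. $\delta_1$ dominates $\delta_2$ relative to a loss if the expected loss of $\delta_1$ is at most that of $\delta_2$ for all $(\Theta,\Sigma)$ with strict inequality for some $(\Theta,\Sigma)$. *)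

theory Defs
  imports "HOL-Probability.Probability"
begin

definition pos_def_matrix :: "real^'p^'p \<Rightarrow> bool" where
  "pos_def_matrix A \<longleftrightarrow> transpose A = A \<and> (\<forall>x. x \<noteq> 0 \<longrightarrow> x \<bullet> (A *v x) > 0)"

text \<open>All distributions below are meant for a positive definite \<open>\<Sigma>\<close> only.\<close>

definition multivariate_normal :: "real^'p \<Rightarrow> real^'p^'p \<Rightarrow> (real^'p) measure" where
  "multivariate_normal \<mu> \<Sigma> = density lborel
     (\<lambda>x. ennreal (exp (- ((x - \<mu>) \<bullet> (matrix_inv \<Sigma> *v (x - \<mu>))) / 2)
                     / sqrt ((2 * pi) ^ CARD('p) * det \<Sigma>)))"

text \<open>In the type \<open>real^'p^'m\<close> of \<open>m \<times> p\<close> matrices, \<open>\<Theta> $ i\<close> is the \<open>i\<close>-th row of \<open>\<Theta>\<close>.\<close>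

definition matrix_normal :: "real^'p^'m \<Rightarrow> real^'p^'p \<Rightarrow> (real^'p^'m) measure" where
  "matrix_normal \<Theta> \<Sigma> =
     distr (PiM UNIV (\<lambda>i. multivariate_normal (\<Theta> $ i) \<Sigma>)) borel (\<lambda>x. \<chi> i. x i)"

text \<open>The Wishart distribution is the law of \<open>\<Sum>k<n. z\<^sub>k z\<^sub>k\<^sup>T\<close> for
  independent \<open>z\<^sub>k\<close> with the normal distribution of mean \<open>0\<close> and covariance \<open>\<Sigma>\<close>.\<close>

definition wishart :: "nat \<Rightarrow> real^'p^'p \<Rightarrow> (real^'p^'p) measure" where
  "wishart n \<Sigma> =
     distr (PiM {..<n} (\<lambda>_. multivariate_normal 0 \<Sigma>)) borel
       (\<lambda>z. \<Sum>k<n. \<chi> i j. z k $ i * z k $ j)"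

definition stein_loss :: "real^'p^'p \<Rightarrow> real^'p^'p \<Rightarrow> real" where
  "stein_loss A \<Sigma> =
     trace (A ** matrix_inv \<Sigma>) - ln (det (A ** matrix_inv \<Sigma>)) - real CARD('p)"

text \<open>An estimator of \<open>\<Sigma>\<close> is a function of the observations \<open>X\<close> and \<open>S\<close>, which are independent.
  The expected loss is an extended nonnegative integral, so a divergent one is \<open>\<infinity>\<close>.
  This is meant for nonnegative losses: \<open>ennreal\<close> sends negative values to \<open>0\<close>.
  The Stein loss is nonnegative at positive definite estimates. For \<open>n \<ge> p\<close> the matrix \<open>S\<close> is
  positive definite almost surely, so the values at singular \<open>S\<close> do not matter.\<close>

definition risk :: "(real^'p^'p \<Rightarrow> real^'p^'p \<Rightarrow> real) \<Rightarrow> nat \<Rightarrow>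
    (real^'p^'m \<Rightarrow> real^'p^'p \<Rightarrow> real^'p^'p) \<Rightarrow> real^'p^'m \<Rightarrow> real^'p^'p \<Rightarrow> ennreal" where
  "risk L n \<delta> \<Theta> \<Sigma> =
     (\<integral>\<^sup>+ (X, S). ennreal (L (\<delta> X S) \<Sigma>) \<partial>(matrix_normal \<Theta> \<Sigma> \<Otimes>\<^sub>M wishart n \<Sigma>))"

definition dominates :: "(real^'p^'p \<Rightarrow> real^'p^'p \<Rightarrow> real) \<Rightarrow> nat \<Rightarrow>
    (real^'p^'m \<Rightarrow> real^'p^'p \<Rightarrow> real^'p^'p) \<Rightarrow>
    (real^'p^'m \<Rightarrow> real^'p^'p \<Rightarrow> real^'p^'p) \<Rightarrow> bool" where
  "dominates L n \<delta>\<^sub>1 \<delta>\<^sub>2 \<longleftrightarrow>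
     (\<forall>\<Theta> \<Sigma>. pos_def_matrix \<Sigma> \<longrightarrow> risk L n \<delta>\<^sub>1 \<Theta> \<Sigma> \<le> risk L n \<delta>\<^sub>2 \<Theta> \<Sigma>) \<and>
     (\<exists>\<Theta> \<Sigma>. pos_def_matrix \<Sigma> \<and> risk L n \<delta>\<^sub>1 \<Theta> \<Sigma> < risk L n \<delta>\<^sub>2 \<Theta> \<Sigma>)"

definition Sigma_hat_0 :: "nat \<Rightarrow> real^'p^'m \<Rightarrow> real^'p^'p \<Rightarrow> real^'p^'p" where
  "Sigma_hat_0 n X S = (1 / real n) *\<^sub>R S"

definition Sigma_hat_G1 ::
    "nat \<Rightarrow> real \<Rightarrow> real \<Rightarrow> real^'p^'m \<Rightarrow> real^'p^'p \<Rightarrow> real^'p^'p" where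
  "Sigma_hat_G1 n \<alpha> \<beta> X S = Sigma_hat_0 n X S +
     (\<alpha> / real n) *\<^sub>R
       (transpose X ** matrix_inv (mat 1 + \<beta> *\<^sub>R (X ** matrix_inv S ** transpose X)) ** X)"

end

theory Submission
  imports Defs
begin

text \<open>
  Fix \<open>X\<close> and write \<open>Q = X\<^sup>T X\<close>, \<open>P = \<Sigma>\<^sup>-\<^sup>1\<close>, \<open>H = X\<^sup>T (I + \<beta> X S\<^sup>-\<^sup>1 X\<^sup>T)\<^sup>-\<^sup>1 X\<close> and
  \<open>T = tr (Q (S + \<beta> Q)\<^sup>-\<^sup>1)\<close>. The estimator is \<open>(S + \<alpha> H) / n\<close>, so the difference of the two losses
  is \<open>(\<alpha>/n) tr (P H) - (ln det (S + \<alpha> H) - ln det S)\<close>. Both parts are compared with \<open>T\<close>.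

  The logarithmic part is a deterministic inequality. Since \<open>H = Q (S + \<beta> Q)\<^sup>-\<^sup>1 S\<close>, it equals
  \<open>ln det (S + (\<beta> + \<alpha>) Q) - ln det (S + \<beta> Q)\<close>, which is the integral of
  \<open>tr (Q (S + \<gamma> Q)\<^sup>-\<^sup>1) \<ge> (\<beta>/\<gamma>) T\<close> over \<open>\<gamma>\<close> between \<open>\<beta>\<close> and \<open>\<beta> + \<alpha>\<close>, hence at least
  \<open>\<beta> ln (1 + \<alpha>/\<beta>) T\<close> (\<open>ln_det_correction_ge\<close>).

  For the trace part, Stein's identity for a single Gaussian vector, summed over the \<open>n\<close> vectors that
  make up \<open>S\<close>, gives \<open>E tr (P H) = E ((n - p - 1) T + \<beta> T\<^sup>2 + \<beta> tr ((Q (S + \<beta> Q)\<^sup>-\<^sup>1)\<^sup>2))\<close>. Now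
  \<open>Q\<close> is a sum of \<open>m\<close> rank one matrices, so \<open>\<beta> T \<le> m\<close> and the last term is at most \<open>T\<close>; therefore
  \<open>E tr (P H) \<le> (n - p + m) E T\<close> (\<open>expectation_trace_correction_le\<close>).

  Together, the expected loss difference given \<open>X\<close> is at most
  \<open>((\<alpha>/n) (n - p + m) - \<beta> ln (1 + \<alpha>/\<beta>)) E T\<close>. By \<open>2 x / (2 + x) < ln (1 + x)\<close> the bound on
  \<open>\<alpha>/\<beta>\<close> makes the factor negative, and \<open>E T > 0\<close> unless \<open>X = 0\<close>
  (\<open>conditional_risk\<close>). Integrating over \<open>X\<close> finishes the proof.

  Two analytic points need care. The inverse of \<open>S + \<beta> Q\<close> is unbounded as \<open>S\<close> varies, so
  in Stein's identity \<open>S + \<beta> Q\<close> is replaced by \<open>\<epsilon> I + S + \<beta> Q\<close> and \<open>\<epsilon>\<close> tends to \<open>0\<close> at the end. And strict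
  dominance requires the risk of \<open>S / n\<close> to be finite, that is \<open>E (- ln det S) < \<infinity>\<close>
  (\<open>nn_integral_neg_ln_det_scatter\<close>); the same estimate shows that \<open>S\<close> is almost surely positive definite.
\<close>

section \<open>Positive definite matrices and rank one updates\<close>

definition outer :: "real^'p \<Rightarrow> real^'p^'p" where
  "outer z = (\<chi> i j. z $ i * z $ j)"

lemma outer_mult_vec: "outer z *v x = (z \<bullet> x) *\<^sub>R z"
  by (simp add: outer_def vec_eq_iff matrix_vector_mult_def inner_vec_def sum_distrib_left
      mult_ac)

lemma sum_matrix_vec: "(\<Sum>k\<in>I. A k) *v x = (\<Sum>k\<in>I. A k *v (x::real^'p))"
  for A :: "'i \<Rightarrow> real^'p^'q"
  by (induction I rule: infinite_finite_induct) (simp_all add: matrix_vector_mult_add_rdistrib)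

lemma trace_sum: "trace (\<Sum>k\<in>I. A k) = (\<Sum>k\<in>I. trace (A k :: real^'p^'p))"
  unfolding trace_def by (subst sum.swap) simp

lemma trace_scaleR: "trace (c *\<^sub>R A) = c * trace (A :: real^'p^'p)"
  by (simp add: trace_def sum_distrib_left)

lemma matrix_mult_sum_right: "A ** (\<Sum>k\<in>I. B k) = (\<Sum>k\<in>I. A ** (B k :: real^'p^'p))"
  for A :: "real^'p^'q"
  by (induction I rule: infinite_finite_induct) (simp_all add: matrix_add_ldistrib)

lemma matrix_add_rdistrib: "(A + B) ** C = A ** C + B ** C" for A B :: "real^'p^'q"
  by (simp add: vec_eq_iff matrix_matrix_mult_def distrib_right sum.distrib)

lemma trace_mult_outer: "trace (A ** outer z) = z \<bullet> (A *v z)"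
  by (simp add: trace_def outer_def matrix_matrix_mult_def matrix_vector_mult_def inner_vec_def
      sum_distrib_left mult_ac)

text \<open>All matrices that are traced below have a factor that is a sum of rank one matrices, either
  \<open>Q = X\<^sup>T X\<close> or \<open>S\<close>. This turns their traces into sums of quadratic forms, to which the order
  properties of inverses apply one summand at a time.\<close>

lemma trace_mult_sum_outer: "trace (A ** (\<Sum>k\<in>I. outer (z k))) = (\<Sum>k\<in>I. z k \<bullet> (A *v z k))"
  by (simp add: matrix_mult_sum_right trace_sum trace_mult_outer)

lemma gram_eq_sum_outer: "transpose X ** X = (\<Sum>i\<in>UNIV. outer (X $ i))"
  for X :: "real^'p^'m"
  by (simp add: vec_eq_iff matrix_matrix_mult_def transpose_def outer_def)

lemma gram_quad: "x \<bullet> ((transpose X ** X) *v x) = (\<Sum>i\<in>UNIV. (X $ i \<bullet> x)\<^sup>2)" for X :: "real^'p^'m"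
  by (simp add: gram_eq_sum_outer sum_matrix_vec outer_mult_vec inner_sum_right power2_eq_square inner_commute)

lemma transpose_sum: "transpose (\<Sum>k\<in>I. A k) = (\<Sum>k\<in>I. transpose (A k :: real^'p^'p))"
  by (simp add: vec_eq_iff transpose_def)

lemma transpose_add: "transpose (A + B) = transpose A + transpose (B :: real^'p^'q)"
  by (simp add: vec_eq_iff transpose_def)

lemma transpose_scaleR: "transpose (c *\<^sub>R A) = c *\<^sub>R transpose (A :: real^'p^'q)"
  by (simp add: vec_eq_iff transpose_def)

lemma transpose_outer [simp]: "transpose (outer z) = outer z"
  by (simp add: vec_eq_iff transpose_def outer_def mult.commute)

lemma inner_transpose_vec: "x \<bullet> (transpose A *v y) = (A *v x) \<bullet> (y::real^'m)"
  for A :: "real^'p^'m"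
  by (metis dot_lmul_matrix transpose_matrix_vector transpose_transpose)

lemma symmetric_inner: "transpose A = A \<Longrightarrow> x \<bullet> (A *v y) = (A *v x) \<bullet> (y::real^'p)"
  by (metis inner_transpose_vec)

definition psd :: "real^'p^'p \<Rightarrow> bool" where
  "psd A \<longleftrightarrow> transpose A = A \<and> (\<forall>x. 0 \<le> x \<bullet> (A *v x))"

lemma psdD: "psd A \<Longrightarrow> 0 \<le> x \<bullet> (A *v x)" "psd A \<Longrightarrow> transpose A = A"
  by (auto simp: psd_def)

lemma pdD: "pos_def_matrix A \<Longrightarrow> x \<noteq> 0 \<Longrightarrow> 0 < x \<bullet> (A *v x)" "pos_def_matrix A \<Longrightarrow> transpose A = A"
  by (auto simp: pos_def_matrix_def)

lemma pd_imp_psd: "pos_def_matrix A \<Longrightarrow> psd A"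
  unfolding psd_def pos_def_matrix_def
  by (metis inner_zero_left order_le_less)

lemma psd_outer: "psd (outer z)"
  by (simp add: psd_def outer_mult_vec inner_commute)

lemma psd_sum: "(\<And>k. k \<in> I \<Longrightarrow> psd (A k)) \<Longrightarrow> psd (\<Sum>k\<in>I. A k)"
  by (auto simp: psd_def transpose_sum sum_matrix_vec inner_sum_right intro!: sum_nonneg)

lemma psd_scaleR: "psd A \<Longrightarrow> 0 \<le> c \<Longrightarrow> psd (c *\<^sub>R A)"
  by (auto simp: psd_def transpose_scaleR scaleR_matrix_vector_assoc[symmetric])

lemma psd_gram: "psd (transpose X ** X)" for X :: "real^'p^'m"
  by (simp add: gram_eq_sum_outer psd_sum psd_outer)

lemma pd_add_psd: "pos_def_matrix A \<Longrightarrow> psd B \<Longrightarrow> pos_def_matrix (A + B)"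
  by (auto simp: psd_def pos_def_matrix_def transpose_add matrix_vector_mult_add_rdistrib
      inner_add_right intro!: add_pos_nonneg)

lemma pd_scaleR: "pos_def_matrix A \<Longrightarrow> 0 < c \<Longrightarrow> pos_def_matrix (c *\<^sub>R A)"
  by (auto simp: pos_def_matrix_def transpose_scaleR scaleR_matrix_vector_assoc[symmetric])

lemma pd_mat_1: "pos_def_matrix (mat 1)"
  by (auto simp: pos_def_matrix_def transpose_mat)

lemma pd_invertible: assumes "pos_def_matrix A" shows "invertible A"
proof -
  have "x = 0" if "A *v x = 0" for x
    using pdD(1)[OF assms, of x] that by (cases "x = 0") auto
  then show ?thesis
    by (metis invertible_def invertible_left_inverse matrix_left_invertible_ker)
qed

lemma matrix_inv_right: "invertible A \<Longrightarrow> A ** matrix_inv A = mat 1" for A :: "real^'p^'p"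
  unfolding invertible_def matrix_inv_def by (rule someI2_ex) auto

lemma matrix_inv_left: "invertible A \<Longrightarrow> matrix_inv A ** A = mat 1" for A :: "real^'p^'p"
  unfolding invertible_def matrix_inv_def by (rule someI2_ex) auto

lemma matrix_inv_eqI: "A ** B = mat 1 \<Longrightarrow> matrix_inv A = B" for A B :: "real^'p^'p"
  by (metis invertible_left_inverse matrix_inv_left matrix_left_right_inverse matrix_mul_assoc matrix_mul_lid matrix_mul_rid)

lemma matrix_inv_vec:
  assumes "pos_def_matrix A"
  shows "A *v (matrix_inv A *v x) = x" "matrix_inv A *v (A *v x) = x"
  using pd_invertible[OF assms] 
  by (simp_all add: matrix_vector_mul_assoc matrix_inv_right matrix_inv_left)

lemma matrix_inv_vec_eqI:
  assumes "pos_def_matrix A" "A *v y = x" shows "matrix_inv A *v x = y"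
  using matrix_inv_vec(2)[OF assms(1), of y] assms(2) by simp

lemma pd_matrix_inv: assumes "pos_def_matrix A" shows "pos_def_matrix (matrix_inv A)"
proof -
  note inv = pd_invertible[OF assms]
  have "A ** transpose (matrix_inv A) = transpose (matrix_inv A ** A)"
    by (simp add: matrix_transpose_mul pdD(2)[OF assms])
  then have "A ** transpose (matrix_inv A) = mat 1" by (simp add: matrix_inv_left[OF inv] transpose_mat)
  then have 1: "transpose (matrix_inv A) = matrix_inv A" by (metis matrix_inv_eqI)
  have "0 < x \<bullet> (matrix_inv A *v x)" if "x \<noteq> 0" for x
  proof -
    define y where "y = matrix_inv A *v x"
    have x: "x = A *v y" by (simp add: y_def matrix_inv_vec[OF assms])
    then have "y \<noteq> 0" using that by auto
    from pdD(1)[OF assms this] show ?thesis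
      by (simp add: x matrix_inv_vec[OF assms] inner_commute)
  qed
  with 1 show ?thesis by (auto simp: pos_def_matrix_def)
qed

lemma matrix_inv_inv: "pos_def_matrix A \<Longrightarrow> matrix_inv (matrix_inv A) = A"
  by (rule matrix_inv_eqI) (rule matrix_inv_left[OF pd_invertible])

lemma pd_inv_sym: "pos_def_matrix A \<Longrightarrow> x \<bullet> (matrix_inv A *v y) = (matrix_inv A *v x) \<bullet> y"
  by (intro symmetric_inner pdD pd_matrix_inv)

lemma quad_inv_nonneg: "pos_def_matrix A \<Longrightarrow> 0 \<le> x \<bullet> (matrix_inv A *v x)"
  by (intro psdD pd_imp_psd pd_matrix_inv)

text \<open>Completing the square: the right-hand side is the maximum over \<open>y\<close> of the left-hand side. This
  variational description yields, without a spectral theorem, that inversion reverses the order and the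
  other comparisons of inverses below.\<close>

lemma quad_inv_ge:
  assumes "pos_def_matrix A"
  shows "2 * (x \<bullet> y) - y \<bullet> (A *v y) \<le> x \<bullet> (matrix_inv A *v x)"
proof -
  let ?w = "matrix_inv A *v x"
  have "0 \<le> (y - ?w) \<bullet> (A *v (y - ?w))" by (intro psdD pd_imp_psd assms)
  also have "\<dots> = y \<bullet> (A *v y) - 2 * (x \<bullet> y) + ?w \<bullet> x"
    by (simp add: matrix_vector_mult_diff_distrib matrix_inv_vec[OF assms] inner_diff_left inner_diff_right
        symmetric_inner[OF pdD(2)[OF assms], of ?w] inner_commute[of y x])
  finally show ?thesis by (simp add: inner_commute)
qed

lemma quad_inv_antimono:
  assumes "pos_def_matrix A" "pos_def_matrix B" and le: "\<And>x. x \<bullet> (A *v x) \<le> x \<bullet> (B *v x)"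
  shows "x \<bullet> (matrix_inv B *v x) \<le> x \<bullet> (matrix_inv A *v x)"
  using quad_inv_ge[OF assms(1), of x "matrix_inv B *v x"] le[of "matrix_inv B *v x"]
  by (simp add: matrix_inv_vec[OF assms(2)] inner_commute)

text \<open>The Cauchy-Schwarz inequality in the inner product given by \<open>A\<close>.\<close>

lemma inner_sq_le_quad_inv:
  assumes "pos_def_matrix A" "u \<noteq> 0"
  shows "(u \<bullet> z)\<^sup>2 \<le> (u \<bullet> (A *v u)) * (z \<bullet> (matrix_inv A *v z))"
proof -
  let ?a = "u \<bullet> (A *v u)"
  have a: "?a > 0" by (rule pdD(1)[OF assms])
  have "2 * (z \<bullet> ((u \<bullet> z / ?a) *\<^sub>R u)) - ((u \<bullet> z / ?a) *\<^sub>R u) \<bullet> (A *v ((u \<bullet> z / ?a) *\<^sub>R u)) \<le> z \<bullet> (matrix_inv A *v z)"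
    by (rule quad_inv_ge[OF assms(1)])
  also have "2 * (z \<bullet> ((u \<bullet> z / ?a) *\<^sub>R u)) - ((u \<bullet> z / ?a) *\<^sub>R u) \<bullet> (A *v ((u \<bullet> z / ?a) *\<^sub>R u)) = (u \<bullet> z)\<^sup>2 / ?a"
    using a by (simp add: matrix_vector_mult_scaleR inner_commute field_simps power2_eq_square)
  finally show ?thesis using a by (simp add: field_simps)
qed

text \<open>If \<open>W\<close> dominates \<open>\<beta> x x\<^sup>T\<close>, test this at \<open>y = W\<^sup>-\<^sup>1 x\<close>, where both sides are expressed by
  the number \<open>x \<bullet> y\<close>.\<close>

lemma quad_inv_le_one:
  assumes W: "pos_def_matrix W" and le: "\<And>y. \<beta> * (x \<bullet> y)\<^sup>2 \<le> y \<bullet> (W *v y)"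
  shows "\<beta> * (x \<bullet> (matrix_inv W *v x)) \<le> 1"
proof (cases "x \<bullet> (matrix_inv W *v x) = 0")
  case False
  let ?y = "matrix_inv W *v x"
  have pos: "0 < x \<bullet> ?y" using False quad_inv_nonneg[OF W, of x] by linarith
  have "\<beta> * (x \<bullet> ?y)\<^sup>2 \<le> x \<bullet> ?y" using le[of ?y] by (simp add: matrix_inv_vec[OF W] inner_commute)
  then show ?thesis using pos by (simp add: power2_eq_square flip: mult.assoc)
qed simp

text \<open>After an orthogonal change of basis \<open>u\<close> points along a coordinate axis; then only one row differs from
  the identity matrix, and the determinant is its diagonal entry.\<close>

lemma det_mat_1_plus_rank_one:
  fixes u v :: "real^'p"
  shows "det (mat 1 + (\<chi> i j. u $ i * v $ j)) = 1 + u \<bullet> v"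
proof -
  obtain k :: 'p where True by simp
  obtain f where f: "orthogonal_transformation f" "f u = axis k (norm u)"
    using orthogonal_transformation_exists[of u "axis k (norm u)"] by (auto simp: norm_axis_1 axis_eq_0_iff norm_eq_sqrt_inner inner_axis_axis)
  define R where "R = matrix f"
  have R: "orthogonal_matrix R" using f(1) by (simp add: R_def orthogonal_transformation_matrix)
  have fv: "f x = R *v x" for x using f(1) 
    by (simp add: R_def matrix_works orthogonal_transformation_def)
  have RR: "R ** transpose R = mat 1" "transpose R ** R = mat 1" using R by (auto simp: orthogonal_matrix_def)
  let ?w = "R *v v"
  have uv: "u \<bullet> v = norm u * ?w $ k"
  proof -
    have "u \<bullet> v = f u \<bullet> f v" using f(1) by (simp add: orthogonal_transformation_def)
    also have "\<dots> = axis k (norm u) \<bullet> ?w" by (simp only: f(2) fv[of v])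
    finally show ?thesis by (simp add: inner_axis')
  qed
  have rank1: "R ** (\<chi> i j. u $ i * v $ j) ** transpose R = (\<chi> i j. (R *v u) $ i * ?w $ j)"
    by (simp add: vec_eq_iff matrix_matrix_mult_def matrix_vector_mult_def transpose_def
        sum_distrib_left sum_distrib_right mult_ac sum_product)
  have "det (mat 1 + (\<chi> i j. u $ i * v $ j)) = det (R ** (mat 1 + (\<chi> i j. u $ i * v $ j)) ** transpose R)"
    using arg_cong[OF RR(1), of det] by (simp add: det_mul mult_ac)
  also have "R ** (mat 1 + (\<chi> i j. u $ i * v $ j)) ** transpose R = mat 1 + (\<chi> i j. (R *v u) $ i * ?w $ j)"
    by (simp add: matrix_add_ldistrib matrix_add_rdistrib RR rank1)
  also have "\<dots> = (\<chi> i. if i = k then sum (\<lambda>i. (axis k 1 + norm u *\<^sub>R ?w)$i *s row i (mat 1)) UNIV else row i (mat 1))"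
    by (auto simp: vec_eq_iff fv[symmetric] f(2) axis_def row_def mat_def if_distrib cong: if_cong)
  also have "det \<dots> = (axis k 1 + norm u *\<^sub>R ?w) $ k * det (mat 1 :: real^'p^'p)"
    by (rule cramer_lemma_transpose)
  also have "\<dots> = 1 + u \<bullet> v" by (simp add: uv)
  finally show ?thesis .
qed

lemma det_add_outer:
  assumes "pos_def_matrix B"
  shows "det (B + outer x) = det B * (1 + x \<bullet> (matrix_inv B *v x))"
proof -
  have "B ** (\<chi> i j. y $ i * x $ j) = (\<chi> i j. (B *v y) $ i * x $ j)" for y
    by (simp add: vec_eq_iff matrix_matrix_mult_def matrix_vector_mult_def sum_distrib_left mult_ac)
  from this[of "matrix_inv B *v x"]
  have "B ** (\<chi> i j. (matrix_inv B *v x) $ i * x $ j) = outer x"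
    by (simp add: matrix_inv_vec[OF assms] outer_def)
  then have "B + outer x = B ** (mat 1 + (\<chi> i j. (matrix_inv B *v x) $ i * x $ j))"
    by (simp add: matrix_add_ldistrib matrix_inv_vec[OF assms])
  then show ?thesis by (simp add: det_mul det_mat_1_plus_rank_one inner_commute)
qed

section \<open>Diagonalisation by congruence and the log-determinant\<close>

lemma matrix_mult_scaleR_left: "(c *\<^sub>R A) ** B = c *\<^sub>R (A ** B)" for A :: "real^'p^'q"
  by (simp add: vec_eq_iff matrix_matrix_mult_def sum_distrib_left mult_ac)

lemma matrix_mult_scaleR_right: "A ** (c *\<^sub>R B) = c *\<^sub>R (A ** B)" for A :: "real^'p^'q"
  by (simp add: vec_eq_iff matrix_matrix_mult_def sum_distrib_left mult_ac)

lemma quad_congruence: "x \<bullet> ((R ** A ** transpose R) *v x) = (transpose R *v x) \<bullet> (A *v (transpose R *v x))"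
  for A :: "real^'p^'p" and R :: "real^'p^'q"
proof -
  have "(R ** A ** transpose R) *v x = R *v (A *v (transpose R *v x))"
    by (simp only: matrix_vector_mul_assoc[symmetric])
  then show ?thesis by (metis inner_commute inner_transpose_vec)
qed

lemma psd_congruence: "psd A \<Longrightarrow> psd (R ** A ** transpose R)"
  for A :: "real^'p^'p" and R :: "real^'p^'q"
  unfolding psd_def by (simp add: quad_congruence matrix_transpose_mul matrix_mul_assoc
      del: transpose_matrix_vector)

lemma pd_congruence:
  fixes A R :: "real^'p^'p"
  assumes "pos_def_matrix A" "invertible R"
  shows "pos_def_matrix (R ** A ** transpose R)"
proof -
  have "transpose R *v x \<noteq> 0" if "x \<noteq> 0" for x
  proof
    assume "transpose R *v x = 0"
    then have "transpose (matrix_inv R) *v (transpose R *v x) = 0" by (simp only: matrix_vector_mult_0_right)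
    then show False using that
      by (simp add: matrix_vector_mul_assoc matrix_inv_right[OF assms(2)] transpose_mat
          flip: matrix_transpose_mul del: transpose_matrix_vector)
  qed
  then show ?thesis using pdD[OF assms(1)]
    unfolding pos_def_matrix_def
    by (simp add: quad_congruence matrix_transpose_mul matrix_mul_assoc del: transpose_matrix_vector)
qed

lemma quad_axis: "axis i 1 \<bullet> (A *v axis i 1) = (A :: real^'p^'p) $ i $ i"
  by (simp add: inner_axis' matrix_vector_mul_component inner_axis)

lemma pd_diag_pos: "pos_def_matrix A \<Longrightarrow> 0 < A $ i $ i"
  using pdD(1)[of A "axis i 1"] by (simp add: quad_axis axis_eq_0_iff)

lemma psd_diag_nonneg: "psd A \<Longrightarrow> 0 \<le> A $ i $ i"
  using psdD(1)[of A "axis i 1"] by (simp add: quad_axis)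

text \<open>Gaussian elimination, one index at a time. Clearing row and column \<open>k\<close> by a unipotent congruence
  keeps the determinant and subtracts a nonnegative amount from each remaining diagonal entry. That the diagonal entries
  decrease is Hadamard's inequality in disguise, and is what \<open>ln_det_le_trace\<close> uses.\<close>

lemma pd_diagonalise_on:
  fixes A :: "real^'p^'p"
  assumes "finite I" "pos_def_matrix A" "\<And>i j. i \<noteq> j \<Longrightarrow> i \<notin> I \<or> j \<notin> I \<Longrightarrow> A $ i $ j = 0"
  shows "\<exists>R. det R = 1 \<and> (\<forall>i j. i \<noteq> j \<longrightarrow> (R ** A ** transpose R) $ i $ j = 0) \<and>
    (\<forall>i. (R ** A ** transpose R) $ i $ i \<le> A $ i $ i)"
  using assms
proof (induction I arbitrary: A rule: finite_induct)
  case empty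
  then show ?case by (intro exI[of _ "mat 1"]) (auto simp: transpose_mat)
next
  case (insert k I)
  note pd = \<open>pos_def_matrix A\<close>
  have a: "A $ k $ k > 0" by (rule pd_diag_pos[OF pd])
  have sym: "A $ i $ j = A $ j $ i" for i j
    using pdD(2)[OF pd] by (metis transpose_def vec_lambda_beta)
  \<comment> \<open>the elimination multipliers; \<open>u $ k = 0\<close> makes \<open>E\<close> have determinant \<open>1\<close>\<close>
  define u where "u = (\<chi> i. if i = k then 0 else A $ i $ k / A $ k $ k)"
  define E where "E = mat 1 + (\<chi> i j. (- u) $ i * axis k 1 $ j)"
  have detE: "det E = 1"
    unfolding E_def by (subst det_mat_1_plus_rank_one) (simp add: inner_axis u_def)
  then have invE: "invertible E" by (simp add: invertible_det_nz)
  define A' where "A' = E ** A ** transpose E"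
  have pd': "pos_def_matrix A'" unfolding A'_def by (rule pd_congruence[OF pd invE])
  have EA: "(E ** B) $ i $ j = B $ i $ j - u $ i * B $ k $ j" for B :: "real^'p^'p" and i j
  proof -
    have "((\<chi> i j. (- u) $ i * axis k 1 $ j) ** B) $ i $ j = (\<Sum>l\<in>UNIV. if l = k then - u $ i * B $ l $ j else 0)"
      unfolding matrix_matrix_mult_def vec_lambda_beta by (rule sum.cong) (auto simp: axis_def)
    then show ?thesis by (simp add: E_def matrix_add_rdistrib)
  qed
  have AE: "(B ** transpose E) $ i $ j = B $ i $ j - u $ j * B $ i $ k" for B :: "real^'p^'p" and i j
  proof -
    have "(B ** transpose E) $ i $ j = transpose (E ** transpose B) $ i $ j" 
      by (simp add: matrix_transpose_mul)
    then show ?thesis by (simp add: transpose_def EA)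
  qed
  have A': "A' $ i $ j = A $ i $ j - u $ i * A $ k $ j - u $ j * (A $ i $ k - u $ i * A $ k $ k)" for i j
    by (simp add: A'_def AE EA)
  have A'_diag: "A' $ i $ i \<le> A $ i $ i" for i
  proof (cases "i = k")
    case False
    then have "u $ i * A $ k $ k = A $ i $ k" "0 \<le> u $ i * A $ i $ k" using a by (simp_all add: u_def)
    then show ?thesis by (simp add: A' sym[of k i])
  qed (simp add: A' u_def)
  have "\<exists>R. det R = 1 \<and> (\<forall>i j. i \<noteq> j \<longrightarrow> (R ** A' ** transpose R) $ i $ j = 0) \<and>
    (\<forall>i. (R ** A' ** transpose R) $ i $ i \<le> A' $ i $ i)"
  proof (rule insert.IH[OF pd'])
    fix i j :: 'p assume ij: "i \<noteq> j" "i \<notin> I \<or> j \<notin> I"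
    show "A' $ i $ j = 0"
    proof (cases "i = k \<or> j = k")
      case True
      then show ?thesis using a ij(1) sym[of k i] sym[of k j] by (auto simp: A' u_def)
    next
      case False
      then have "A $ i $ j = 0" "A $ i $ k = 0 \<or> A $ j $ k = 0"
        using ij insert.prems(2) by auto
      then show ?thesis using False sym[of k j] by (auto simp: A' u_def)
    qed
  qed
  then obtain R where R: "det R = 1" "\<forall>i j. i \<noteq> j \<longrightarrow> (R ** A' ** transpose R) $ i $ j = 0"
    "\<forall>i. (R ** A' ** transpose R) $ i $ i \<le> A' $ i $ i" by (elim exE conjE)
  have "R ** A' ** transpose R = (R ** E) ** A ** transpose (R ** E)"
    by (simp add: A'_def matrix_transpose_mul matrix_mul_assoc)
  moreover have "det (R ** E) = 1" by (simp add: det_mul detE R)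
  moreover have "\<forall>i. (R ** A' ** transpose R) $ i $ i \<le> A $ i $ i"
    using R(3) A'_diag by (blast intro: order_trans)
  ultimately show ?case using R(2) by (intro exI[of _ "R ** E"]) simp
qed

lemma pd_diagonalise:
  fixes A :: "real^'p^'p"
  assumes "pos_def_matrix A"
  obtains R :: "real^'p^'p" and d where "det R = 1" "R ** A ** transpose R = (\<chi> i j. if i = j then d i else 0)"
    "\<forall>i. 0 < d i" "\<forall>i. d i \<le> A $ i $ i" "det A = prod d UNIV"
proof -
  have "\<exists>R. det R = 1 \<and> (\<forall>i j. i \<noteq> j \<longrightarrow> (R ** A ** transpose R) $ i $ j = 0) \<and>
    (\<forall>i. (R ** A ** transpose R) $ i $ i \<le> A $ i $ i)"
    by (rule pd_diagonalise_on[OF finite assms, of UNIV]) simp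
  then obtain R where R: "det R = 1" "\<forall>i j. i \<noteq> j \<longrightarrow> (R ** A ** transpose R) $ i $ j = 0"
    "\<forall>i. (R ** A ** transpose R) $ i $ i \<le> A $ i $ i" by (elim exE conjE)
  define D where "D = R ** A ** transpose R"
  have D: "pos_def_matrix D" unfolding D_def
    by (rule pd_congruence[OF assms]) (simp add: invertible_det_nz R(1))
  have offdiag: "D $ i $ j = 0" if "i \<noteq> j" for i j using R(2) that by (simp add: D_def)
  have "det A = det D" by (simp add: D_def det_mul R(1))
  also have "\<dots> = prod (\<lambda>i. D $ i $ i) UNIV"
    by (rule det_diagonal) (rule offdiag)
  finally have det: "det A = prod (\<lambda>i. D $ i $ i) UNIV" .
  have eq: "D = (\<chi> i j. if i = j then D $ i $ i else 0)"
    by (auto simp: vec_eq_iff offdiag)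
  have pos: "\<forall>i. 0 < D $ i $ i" by (rule allI, rule pd_diag_pos[OF D])
  show thesis
    by (rule that[OF R(1) eq[unfolded D_def] pos[unfolded D_def] R(3) det[unfolded D_def]])
qed

lemma pd_det_pos: "pos_def_matrix A \<Longrightarrow> 0 < det A"
  by (erule pd_diagonalise) (simp add: prod_pos)

lemma ln_det_le_trace: 
  fixes A :: "real^'p^'p"
  assumes "pos_def_matrix A" shows "ln (det A) \<le> trace A - real CARD('p)"
proof -
  obtain R :: "real^'p^'p" and d where "det R = 1" "R ** A ** transpose R = (\<chi> i j. if i = j then d i else 0)"
    and d: "\<forall>i. 0 < d i" "\<forall>i. d i \<le> A $ i $ i" "det A = prod d UNIV"
    by (rule pd_diagonalise[OF assms])
  have "ln (det A) = (\<Sum>i\<in>UNIV. ln (d i))" unfolding d(3) by (rule ln_prod) (use d(1) in \<open>auto simp: less_imp_neq[symmetric]\<close>)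
  also have "\<dots> \<le> (\<Sum>i\<in>UNIV. A $ i $ i - 1)"
  proof (rule sum_mono)
    fix i
    show "ln (d i) \<le> A $ i $ i - 1" using ln_le_minus_one[OF d(1)[rule_format, of i]] d(2)[rule_format, of i] by linarith
  qed
  finally show ?thesis by (simp add: trace_def sum_subtractf)
qed

lemma diag_mult: "(\<chi> i j. if i = j then a i else 0) ** B = (\<chi> i j. a i * B $ i $ j)"
  for B :: "real^'q^'p"
  by (simp add: vec_eq_iff matrix_matrix_mult_def if_distrib[of "\<lambda>x. x * y" for y] cong: if_cong)

lemma mult_diag: "B ** (\<chi> i j. if i = j then a i else 0) = (\<chi> i j. B $ i $ j * a j)"
  for B :: "real^'p^'q"
  by (simp add: vec_eq_iff matrix_matrix_mult_def if_distrib[of "\<lambda>x. y * x" for y] cong: if_cong)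

lemma transpose_diag: "transpose (\<chi> i j. if i = j then a i else 0) = (\<chi> i j. if i = j then a i else 0)"
  by (auto simp: vec_eq_iff transpose_def)

lemma pd_inv_eq_gram:
  fixes A :: "real^'p^'p"
  assumes "pos_def_matrix A"
  obtains R :: "real^'p^'p" where "invertible R" "matrix_inv A = transpose R ** R"
proof -
  obtain R :: "real^'p^'p" and d where R: "det R = 1" "R ** A ** transpose R = (\<chi> i j. if i = j then d i else 0)"
    "\<forall>i. 0 < d i" and "\<forall>i. d i \<le> A $ i $ i" "det A = prod d UNIV"
    by (rule pd_diagonalise[OF assms])
  define L :: "real^'p^'p" where "L = (\<chi> i j. if i = j then 1 / sqrt (d i) else 0)"
  define R' where "R' = L ** R"
  have "R' ** A ** transpose R' = L ** (R ** A ** transpose R) ** transpose L"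
    by (simp add: R'_def matrix_transpose_mul matrix_mul_assoc)
  also have "\<dots> = mat 1"
  proof -
    have "1 / sqrt (d i) * d i * (1 / sqrt (d i)) = 1" for i
      using R(3)[rule_format, of i] by (simp add: real_div_sqrt divide_simps)
    then show ?thesis
      unfolding R(2) L_def diag_mult mult_diag transpose_diag by (simp add: vec_eq_iff mat_def)
  qed
  finally have 1: "R' ** (A ** transpose R') = mat 1" by (simp add: matrix_mul_assoc)
  then have "A ** transpose R' ** R' = mat 1" using matrix_left_right_inverse by blast
  then have "matrix_inv A = transpose R' ** R'"
    by (intro matrix_inv_eqI) (simp add: matrix_mul_assoc)
  moreover have "invertible R'" using 1 invertible_right_inverse by blast
  ultimately show thesis using that by blast
qed

lemma pd_eq_gram:
  fixes A :: "real^'p^'p"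
  assumes "pos_def_matrix A"
  obtains R :: "real^'p^'p" where "A = transpose R ** R"
  using pd_inv_eq_gram[OF pd_matrix_inv[OF assms]] unfolding matrix_inv_inv[OF assms] by blast

text \<open>The risk truncates negative losses, so expectations of the loss can only be computed after this is known.\<close>

lemma stein_loss_nonneg:
  fixes A \<Sigma> :: "real^'p^'p"
  assumes "pos_def_matrix A" "pos_def_matrix \<Sigma>"
  shows "0 \<le> stein_loss A \<Sigma>"
proof -
  obtain R :: "real^'p^'p" where R: "invertible R" "matrix_inv \<Sigma> = transpose R ** R"
    by (rule pd_inv_eq_gram[OF assms(2)])
  have "ln (det (R ** A ** transpose R)) \<le> trace (R ** A ** transpose R) - real CARD('p)"
    by (intro ln_det_le_trace pd_congruence assms R)
  moreover have "trace (R ** A ** transpose R) = trace (A ** (transpose R ** R))"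
    by (metis matrix_mul_assoc trace_mul_sym)
  ultimately show ?thesis
    by (simp add: stein_loss_def R det_mul mult_ac)
qed

text \<open>With \<open>P = R\<^sup>T R\<close> the trace is a sum of quadratic forms evaluated at the rows of \<open>R\<close>.\<close>

lemma trace_mult_pd_mono:
  fixes A B P :: "real^'p^'p"
  assumes "pos_def_matrix P" "\<And>x. x \<bullet> (A *v x) \<le> x \<bullet> (B *v x)"
  shows "trace (P ** A) \<le> trace (P ** B)"
proof -
  obtain R :: "real^'p^'p" where R: "P = transpose R ** R"
    by (rule pd_eq_gram[OF assms(1)])
  have "trace (P ** C) = (\<Sum>i\<in>UNIV. (R $ i) \<bullet> (C *v (R $ i)))" for C
    by (subst trace_mul_sym) (simp add: R gram_eq_sum_outer trace_mult_sum_outer)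
  then show ?thesis using assms(2) by (simp add: sum_mono)
qed

lemma matrix_inv_add_outer:
  assumes "pos_def_matrix B"
  shows "matrix_inv (B + outer x) *v x = (1 / (1 + x \<bullet> (matrix_inv B *v x))) *\<^sub>R (matrix_inv B *v x)"
proof (rule matrix_inv_vec_eqI)
  show "pos_def_matrix (B + outer x)" by (rule pd_add_psd[OF assms psd_outer])
  have "(B + outer x) *v (matrix_inv B *v x) = (1 + x \<bullet> (matrix_inv B *v x)) *\<^sub>R x"
    by (simp add: matrix_vector_mult_add_rdistrib outer_mult_vec matrix_inv_vec[OF assms] scaleR_add_left)
  moreover have "1 + x \<bullet> (matrix_inv B *v x) \<noteq> 0" using quad_inv_nonneg[OF assms, of x] by linarith
  ultimately show "(B + outer x) *v ((1 / (1 + x \<bullet> (matrix_inv B *v x))) *\<^sub>R (matrix_inv B *v x)) = x"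
    by (simp add: matrix_vector_mult_scaleR)
qed

text \<open>A lower bound for the increment of the concave function \<open>ln det\<close> by its slope at the far end. Adding
  the rank one matrices one by one, each step contributes \<open>ln (1 + t) \<ge> t / (1 + t)\<close>, and \<open>t / (1 + t)\<close> is
  the quadratic form of the inverse after that step; later steps only decrease it.\<close>

lemma ln_det_add_gram_ge_aux:
  fixes B :: "real^'p^'p" and y :: "'i \<Rightarrow> real^'p"
  assumes "finite I" "pos_def_matrix B"
  shows "ln (det B) + (\<Sum>i\<in>I. y i \<bullet> (matrix_inv (B + (\<Sum>i\<in>I. outer (y i))) *v y i))
    \<le> ln (det (B + (\<Sum>i\<in>I. outer (y i))))"
  using assms(1)
proof (induction I rule: finite_induct)
  case (insert k I)
  let ?B = "B + (\<Sum>i\<in>I. outer (y i))"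
  let ?B' = "B + (\<Sum>i\<in>insert k I. outer (y i))"
  have B: "pos_def_matrix ?B" and B': "pos_def_matrix ?B'"
    by (rule pd_add_psd[OF assms(2) psd_sum[OF psd_outer]])+
  have eq: "?B' = ?B + outer (y k)" using insert.hyps by (simp add: add_ac)
  let ?t = "y k \<bullet> (matrix_inv ?B *v y k)"
  have t: "?t \<ge> 0" by (rule quad_inv_nonneg[OF B])
  have "y i \<bullet> (matrix_inv ?B' *v y i) \<le> y i \<bullet> (matrix_inv ?B *v y i)" for i
    by (rule quad_inv_antimono[OF B B'])
       (simp add: eq matrix_vector_mult_add_rdistrib inner_add_right psdD(1)[OF psd_outer])
  then have "(\<Sum>i\<in>I. y i \<bullet> (matrix_inv ?B' *v y i)) \<le> (\<Sum>i\<in>I. y i \<bullet> (matrix_inv ?B *v y i))"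
    by (intro sum_mono)
  moreover have "y k \<bullet> (matrix_inv ?B' *v y k) = ?t / (1 + ?t)"
    unfolding eq by (subst matrix_inv_add_outer[OF B]) simp
  moreover have "?t / (1 + ?t) \<le> ln (1 + ?t)"
  proof -
    have "?t / (1 + ?t) = 1 - 1 / (1 + ?t)" using t by (simp add: divide_simps)
    then show ?thesis using ln_le_minus_one[of "1 / (1 + ?t)"] t by (simp add: ln_div)
  qed
  moreover have "ln (det ?B') = ln (det ?B) + ln (1 + ?t)"
    unfolding eq by (subst det_add_outer[OF B]) (use pd_det_pos[OF B] t in \<open>simp add: ln_mult\<close>)
  ultimately show ?case using insert.IH insert.hyps
    by (simp only: sum.insert[OF insert.hyps])
qed simp

lemma outer_scaleR: "outer (c *\<^sub>R x) = c\<^sup>2 *\<^sub>R outer x"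
  by (simp add: vec_eq_iff outer_def power2_eq_square mult_ac)

lemma ln_det_add_gram_ge:
  fixes B :: "real^'p^'p" and X :: "real^'p^'m"
  assumes "pos_def_matrix B" "0 \<le> \<delta>"
  defines "Q \<equiv> transpose X ** X"
  shows "ln (det B) + \<delta> * (\<Sum>i\<in>UNIV. X $ i \<bullet> (matrix_inv (B + \<delta> *\<^sub>R Q) *v X $ i))
    \<le> ln (det (B + \<delta> *\<^sub>R Q))"
proof -
  have "(\<Sum>i\<in>UNIV. outer (sqrt \<delta> *\<^sub>R X $ i)) = \<delta> *\<^sub>R Q"
    using assms(2) by (simp add: Q_def outer_scaleR gram_eq_sum_outer scaleR_sum_right)
  moreover have sq: "sqrt \<delta> * (sqrt \<delta> * c) = \<delta> * c" for c
    using assms(2) by (simp add: mult.assoc[symmetric])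
  ultimately show ?thesis
    using ln_det_add_gram_ge_aux[of UNIV B "\<lambda>i. sqrt \<delta> *\<^sub>R X $ i"] assms(1,2)
    by (simp add: matrix_vector_mult_scaleR sum_distrib_left sq)
qed

text \<open>In the positive semidefinite order \<open>S + \<gamma> Q \<le> (\<gamma> / \<beta>) (S + \<beta> Q)\<close>, so the inverses are ordered the
  other way.\<close>

lemma quad_inv_add_scale:
  assumes S: "pos_def_matrix S" "psd Q" and "0 < \<beta>" "\<beta> \<le> \<gamma>"
  shows "\<beta> / \<gamma> * (x \<bullet> (matrix_inv (S + \<beta> *\<^sub>R Q) *v x)) \<le> x \<bullet> (matrix_inv (S + \<gamma> *\<^sub>R Q) *v x)"
proof -
  have pd: "pos_def_matrix (S + c *\<^sub>R Q)" if "c \<ge> 0" for c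
    by (rule pd_add_psd[OF S(1) psd_scaleR[OF S(2) that]])
  let ?W = "S + \<beta> *\<^sub>R Q" and ?W' = "S + \<gamma> *\<^sub>R Q"
  let ?y = "matrix_inv ?W *v x"
  have g: "\<gamma> > 0" using assms by simp
  have "2 * (x \<bullet> ((\<beta> / \<gamma>) *\<^sub>R ?y)) - ((\<beta> / \<gamma>) *\<^sub>R ?y) \<bullet> (?W' *v ((\<beta> / \<gamma>) *\<^sub>R ?y)) \<le> x \<bullet> (matrix_inv ?W' *v x)"
    by (rule quad_inv_ge[OF pd]) (use g in simp)
  moreover have "((\<beta> / \<gamma>) *\<^sub>R ?y) \<bullet> (?W' *v ((\<beta> / \<gamma>) *\<^sub>R ?y)) = (\<beta> / \<gamma>) * ((\<beta> / \<gamma>) * (?y \<bullet> (?W' *v ?y)))"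
    by (simp add: matrix_vector_mult_scaleR)
  moreover have "(\<beta> / \<gamma>) * (?y \<bullet> (?W' *v ?y)) \<le> ?y \<bullet> (?W *v ?y)"
  proof -
    have "\<beta> / \<gamma> * (?y \<bullet> (S *v ?y)) \<le> 1 * (?y \<bullet> (S *v ?y))"
      using assms g by (intro mult_right_mono psdD pd_imp_psd S) simp_all
    moreover have "?y \<bullet> ((S + c *\<^sub>R Q) *v ?y) = ?y \<bullet> (S *v ?y) + c * (?y \<bullet> (Q *v ?y))" for c
      by (simp add: matrix_vector_mult_add_rdistrib inner_add_right flip: scaleR_matrix_vector_assoc)
    ultimately show ?thesis using g by (simp add: distrib_left)
  qed
  then have "(\<beta> / \<gamma>) * ((\<beta> / \<gamma>) * (?y \<bullet> (?W' *v ?y))) \<le> (\<beta> / \<gamma>) * (x \<bullet> ?y)"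
    using assms g by (intro mult_left_mono) (simp_all add: matrix_inv_vec[OF pd] inner_commute)
  ultimately show ?thesis by simp
qed

section \<open>Deterministic inequalities for the correction term\<close>

lemma trace_gram_mult: "trace (transpose X ** X ** M) = (\<Sum>i\<in>UNIV. X $ i \<bullet> (M *v X $ i))"
  for X :: "real^'p^'m"
  by (subst trace_mul_sym) (simp add: gram_eq_sum_outer trace_mult_sum_outer)

text \<open>The derivative of \<open>\<gamma> \<mapsto> ln det (S + \<gamma> Q)\<close> is at least \<open>(\<beta> / \<gamma>) tr (Q (S + \<beta> Q)\<^sup>-\<^sup>1)\<close>, and integrating gives the
  logarithm. Differentiating the determinant is avoided by summing the finite increments of
  \<open>ln_det_add_gram_ge\<close> over a geometric grid between \<open>\<beta>\<close> and \<open>\<gamma>\<close> that becomes finer and finer.\<close>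

lemma ln_det_add_gram_ge_ln:
  fixes S :: "real^'p^'p" and X :: "real^'p^'m"
  assumes S: "pos_def_matrix S" and "0 < \<beta>" "\<beta> \<le> \<gamma>"
  defines "Q \<equiv> transpose X ** X"
  shows "ln (det (S + \<beta> *\<^sub>R Q)) + \<beta> * ln (\<gamma> / \<beta>) * trace (Q ** matrix_inv (S + \<beta> *\<^sub>R Q))
    \<le> ln (det (S + \<gamma> *\<^sub>R Q))"
proof -
  define h where "h c = ln (det (S + c *\<^sub>R Q))" for c
  define T where "T = trace (Q ** matrix_inv (S + \<beta> *\<^sub>R Q))"
  have Q: "psd Q" unfolding Q_def by (rule psd_gram)
  have pd: "pos_def_matrix (S + c *\<^sub>R Q)" if "c \<ge> 0" for c
    by (rule pd_add_psd[OF S psd_scaleR[OF Q that]])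
  have step: "h a + \<beta> * (1 - a / b) * T \<le> h b" if "\<beta> \<le> a" "a \<le> b" for a b
  proof -
    have pos: "0 < a" "0 < b" using that assms by auto
    have T': "\<beta> / b * T \<le> trace (Q ** matrix_inv (S + b *\<^sub>R Q))"
      unfolding T_def Q_def trace_gram_mult sum_distrib_left
      using quad_inv_add_scale[OF S Q \<open>0 < \<beta>\<close>, of b] that by (intro sum_mono) (simp add: Q_def)
    have eq: "S + a *\<^sub>R Q + (b - a) *\<^sub>R Q = S + b *\<^sub>R Q" by (simp add: algebra_simps)
    have "h a + (b - a) * trace (Q ** matrix_inv (S + b *\<^sub>R Q)) \<le> h b"
      using ln_det_add_gram_ge[OF pd, of a "b - a" X] that pos
      by (simp add: h_def eq[unfolded Q_def] trace_gram_mult Q_def)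
    moreover have "(b - a) * (\<beta> / b * T) \<le> (b - a) * trace (Q ** matrix_inv (S + b *\<^sub>R Q))"
      using T' that by (intro mult_left_mono) auto
    moreover have "(b - a) * (\<beta> / b * T) = \<beta> * (1 - a / b) * T"
      using pos by (simp add: field_simps)
    ultimately show ?thesis by linarith
  qed
  define L where "L = ln (\<gamma> / \<beta>)"
  have L: "0 \<le> L" "\<gamma> = \<beta> * exp L" using assms by (simp_all add: L_def)
  \<comment> \<open>the grid points are \<open>\<beta> exp (k L / N)\<close>; for \<open>N = 0\<close> the division by zero makes the claim trivial\<close>
  have grid: "h \<beta> + real k * (\<beta> * (1 - exp (- (L / real N))) * T) \<le> h (\<beta> * exp (real k * (L / real N)))"
    for k N
  proof (induction k)
    case (Suc k)
    let ?t = "L / real N"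
    have "h (\<beta> * exp (real k * ?t)) + \<beta> * (1 - (\<beta> * exp (real k * ?t)) / (\<beta> * exp (real (Suc k) * ?t))) * T
      \<le> h (\<beta> * exp (real (Suc k) * ?t))"
      by (rule step) (use assms L in \<open>auto intro!: divide_right_mono mult_right_mono\<close>)
    moreover have "(\<beta> * exp (real k * ?t)) / (\<beta> * exp (real (Suc k) * ?t)) = exp (- ?t)"
      using assms by (simp add: exp_diff[symmetric] algebra_simps add_divide_distrib)
    ultimately show ?case using Suc.IH by (simp add: algebra_simps)
  qed simp
  have "(\<lambda>N. h \<beta> + \<beta> * (real N * (1 - exp (- (L / real N)))) * T) \<longlonglongrightarrow> h \<beta> + \<beta> * L * T"
  proof -
    have "(\<lambda>N. real N * (1 - exp (- (L / real N)))) \<longlonglongrightarrow> L" by real_asymp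
    then show ?thesis by (intro tendsto_intros)
  qed
  moreover have "\<forall>\<^sub>F N in sequentially. h \<beta> + \<beta> * (real N * (1 - exp (- (L / real N)))) * T \<le> h \<gamma>"
    using eventually_gt_at_top[of 0]
  proof eventually_elim
    case (elim N)
    then show ?case using grid[of N N] by (simp add: L(2) mult_ac)
  qed
  ultimately have "h \<beta> + \<beta> * L * T \<le> h \<gamma>" by (intro tendsto_upperbound) auto
  then show ?thesis by (simp add: h_def L_def T_def)
qed

text \<open>This is where the number \<open>m\<close> of rows of \<open>X\<close> enters: each of the \<open>m\<close> quadratic forms in the trace
  is at most \<open>1 / \<beta>\<close>.\<close>

lemma trace_gram_inv_le:
  fixes W :: "real^'p^'p" and X :: "real^'p^'m"
  defines "Q \<equiv> transpose X ** X"
  assumes W: "pos_def_matrix W" and le: "\<And>x. \<beta> * (x \<bullet> (Q *v x)) \<le> x \<bullet> (W *v x)" and "0 < \<beta>"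
  shows "\<beta> * trace (Q ** matrix_inv W) \<le> real CARD('m)"
    and "\<beta> * trace (Q ** matrix_inv W ** Q ** matrix_inv W) \<le> trace (Q ** matrix_inv W)"
proof -
  let ?q = "\<lambda>i. X $ i \<bullet> (matrix_inv W *v X $ i)"
  have "\<beta> * ?q i \<le> 1" for i
  proof (rule quad_inv_le_one[OF W])
    fix y
    have "\<beta> * (X $ i \<bullet> y)\<^sup>2 \<le> \<beta> * (y \<bullet> (Q *v y))"
      unfolding Q_def gram_quad using \<open>0 < \<beta>\<close> by (intro mult_left_mono member_le_sum) auto
    also have "\<dots> \<le> y \<bullet> (W *v y)" by (rule le)
    finally show "\<beta> * (X $ i \<bullet> y)\<^sup>2 \<le> y \<bullet> (W *v y)" .
  qed
  then have "(\<Sum>i\<in>UNIV. \<beta> * ?q i) \<le> (\<Sum>i\<in>(UNIV :: 'm set). 1)" by (intro sum_mono)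
  then show "\<beta> * trace (Q ** matrix_inv W) \<le> real CARD('m)"
    by (simp add: Q_def trace_gram_mult sum_distrib_left)
  have "\<beta> * (X $ i \<bullet> ((matrix_inv W ** Q ** matrix_inv W) *v X $ i)) \<le> ?q i" for i
  proof -
    let ?y = "matrix_inv W *v X $ i"
    have "X $ i \<bullet> ((matrix_inv W ** Q ** matrix_inv W) *v X $ i) = ?y \<bullet> (Q *v ?y)"
      by (simp add: pd_inv_sym[OF W] flip: matrix_vector_mul_assoc)
    also have "\<beta> * \<dots> \<le> ?q i" using le[of ?y] by (simp add: matrix_inv_vec[OF W] inner_commute)
    finally show ?thesis .
  qed
  then have "(\<Sum>i\<in>UNIV. \<beta> * (X $ i \<bullet> ((matrix_inv W ** Q ** matrix_inv W) *v X $ i))) \<le> (\<Sum>i\<in>UNIV. ?q i)" 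
    by (intro sum_mono)
  moreover have "trace (Q ** matrix_inv W ** Q ** matrix_inv W) = trace (Q ** (matrix_inv W ** Q ** matrix_inv W))"
    by (simp add: matrix_mul_assoc)
  ultimately show "\<beta> * trace (Q ** matrix_inv W ** Q ** matrix_inv W) \<le> trace (Q ** matrix_inv W)"
    by (simp only: Q_def trace_gram_mult sum_distrib_left)
qed

definition correction :: "real \<Rightarrow> real^'p^'m \<Rightarrow> real^'p^'p \<Rightarrow> real^'p^'p" where
  "correction \<beta> X S = transpose X ** matrix_inv (mat 1 + \<beta> *\<^sub>R (X ** matrix_inv S ** transpose X)) ** X"

lemma pd_one_plus_F:
  fixes X :: "real^'p^'m"
  assumes "pos_def_matrix S" "0 < \<beta>"
  shows "pos_def_matrix (mat 1 + \<beta> *\<^sub>R (X ** matrix_inv S ** transpose X))"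
  using assms by (intro pd_add_psd pd_mat_1 psd_scaleR psd_congruence pd_imp_psd pd_matrix_inv) auto

lemma correction_quad:
  fixes X :: "real^'p^'m"
  shows "x \<bullet> (correction \<beta> X S *v x) =
     (X *v x) \<bullet> (matrix_inv (mat 1 + \<beta> *\<^sub>R (X ** matrix_inv S ** transpose X)) *v (X *v x))"
  using quad_congruence[of x "transpose X"] by (simp add: correction_def)

lemma psd_correction:
  assumes "pos_def_matrix S" "0 < \<beta>"
  shows "psd (correction \<beta> X S)"
  using psd_congruence[OF pd_imp_psd[OF pd_matrix_inv[OF pd_one_plus_F[OF assms]]], of "transpose X" X]
  by (simp add: correction_def)

lemma correction_le_gram:
  fixes X :: "real^'p^'m"
  assumes "pos_def_matrix S" "0 < \<beta>"
  shows "x \<bullet> (correction \<beta> X S *v x) \<le> x \<bullet> ((transpose X ** X) *v x)"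
proof -
  have inv1: "matrix_inv (mat 1) = (mat 1 :: real^'m^'m)" by (rule matrix_inv_eqI) simp
  have "(X *v x) \<bullet> (matrix_inv (mat 1 + \<beta> *\<^sub>R (X ** matrix_inv S ** transpose X)) *v (X *v x))
      \<le> (X *v x) \<bullet> (matrix_inv (mat 1) *v (X *v x))"
  proof (rule quad_inv_antimono[OF pd_mat_1 pd_one_plus_F[OF assms]])
    fix y :: "real^'m"
    have "psd (\<beta> *\<^sub>R (X ** matrix_inv S ** transpose X))"
      using assms by (intro psd_scaleR psd_congruence pd_imp_psd pd_matrix_inv) auto
    from psdD(1)[OF this, of y]
    show "y \<bullet> (mat 1 *v y) \<le> y \<bullet> ((mat 1 + \<beta> *\<^sub>R (X ** matrix_inv S ** transpose X)) *v y)"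
      by (simp only: matrix_vector_mult_add_rdistrib inner_add_right)
  qed
  then show ?thesis
    by (simp only: correction_quad inv1 matrix_vector_mul_lid matrix_vector_mul_assoc[symmetric] inner_transpose_vec)
qed

lemma correction_mono:
  fixes X :: "real^'p^'m"
  assumes S: "pos_def_matrix S" "pos_def_matrix S'" "0 < \<beta>" and le: "\<And>x. x \<bullet> (S *v x) \<le> x \<bullet> (S' *v x)"
  shows "x \<bullet> (correction \<beta> X S *v x) \<le> x \<bullet> (correction \<beta> X S' *v x)"
  unfolding correction_quad
proof (rule quad_inv_antimono[OF pd_one_plus_F[OF S(2,3)] pd_one_plus_F[OF S(1,3)]])
  fix y :: "real^'m"
  have "(transpose X *v y) \<bullet> (matrix_inv S' *v (transpose X *v y)) \<le> (transpose X *v y) \<bullet> (matrix_inv S *v (transpose X *v y))"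
    by (rule quad_inv_antimono[OF S(1,2) le])
  then have "y \<bullet> ((X ** matrix_inv S' ** transpose X) *v y) \<le> y \<bullet> ((X ** matrix_inv S ** transpose X) *v y)"
    unfolding quad_congruence .
  then show "y \<bullet> ((mat 1 + \<beta> *\<^sub>R (X ** matrix_inv S' ** transpose X)) *v y) \<le> y \<bullet> ((mat 1 + \<beta> *\<^sub>R (X ** matrix_inv S ** transpose X)) *v y)"
    using \<open>0 < \<beta>\<close> by (simp add: matrix_vector_mult_add_rdistrib inner_add_right flip: scaleR_matrix_vector_assoc)
qed

text \<open>The push-through identity moves the inverse from \<open>m \<times> m\<close> to \<open>p \<times> p\<close> matrices. It shows that
  \<open>H S\<^sup>-\<^sup>1 = Q (S + \<beta> Q)\<^sup>-\<^sup>1\<close>, and it is to the vector fields \<open>H S\<^sup>-\<^sup>1 z\<close> that Stein's identity is applied.\<close>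

lemma correction_eq:
  fixes X :: "real^'p^'m"
  assumes S: "pos_def_matrix S" "0 < \<beta>"
  defines "Q \<equiv> transpose X ** X"
  shows "correction \<beta> X S = Q ** matrix_inv (S + \<beta> *\<^sub>R Q) ** S"
proof -
  let ?K = "mat 1 + \<beta> *\<^sub>R (X ** matrix_inv S ** transpose X)"
  let ?W = "S + \<beta> *\<^sub>R Q"
  let ?M = "matrix_inv ?W"
  have W: "pos_def_matrix ?W" unfolding Q_def using S by (intro pd_add_psd psd_scaleR psd_gram) auto
  have K: "pos_def_matrix ?K" by (rule pd_one_plus_F[OF S])
  have "?K ** X = X ** matrix_inv S ** ?W"
    by (simp add: matrix_add_rdistrib matrix_add_ldistrib Q_def matrix_mult_scaleR_left matrix_mult_scaleR_right
        matrix_mul_assoc)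
       (simp add: matrix_inv_left[OF pd_invertible[OF S(1)]] flip: matrix_mul_assoc)
  then have "?K ** X ** ?M ** S = X ** matrix_inv S ** (?W ** ?M) ** S" by (simp add: matrix_mul_assoc)
  also have "\<dots> = X" 
    by (simp add: matrix_inv_right[OF pd_invertible[OF W]] matrix_inv_left[OF pd_invertible[OF S(1)]] flip: matrix_mul_assoc)
  finally have "matrix_inv ?K ** X = matrix_inv ?K ** (?K ** (X ** ?M ** S))" by (simp add: matrix_mul_assoc)
  also have "\<dots> = X ** ?M ** S" by (simp add: matrix_mul_assoc matrix_inv_left[OF pd_invertible[OF K]])
  finally show ?thesis by (simp add: correction_def Q_def flip: matrix_mul_assoc)
qed

text \<open>A factorisation: \<open>S + \<alpha> H = (S + (\<beta> + \<alpha>) Q) (S + \<beta> Q)\<^sup>-\<^sup>1 S\<close>.\<close>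

lemma det_correction:
  fixes X :: "real^'p^'m"
  assumes S: "pos_def_matrix S" "0 < \<beta>"
  defines "Q \<equiv> transpose X ** X"
  shows "det (S + \<alpha> *\<^sub>R correction \<beta> X S) * det (S + \<beta> *\<^sub>R Q) = det (S + (\<beta> + \<alpha>) *\<^sub>R Q) * det S"
proof -
  let ?W = "S + \<beta> *\<^sub>R Q"
  let ?M = "matrix_inv ?W"
  have W: "pos_def_matrix ?W" unfolding Q_def using S by (intro pd_add_psd psd_scaleR psd_gram) auto
  have WM: "?W ** ?M = mat 1" by (rule matrix_inv_right[OF pd_invertible[OF W]])
  have "(?W + \<alpha> *\<^sub>R Q) ** (?M ** S) = (?W ** ?M) ** S + \<alpha> *\<^sub>R (Q ** ?M ** S)"
    by (simp only: matrix_add_rdistrib matrix_mult_scaleR_left matrix_mul_assoc)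
  also have "\<dots> = S + \<alpha> *\<^sub>R correction \<beta> X S" by (simp only: WM correction_eq[OF S] Q_def[symmetric] matrix_mul_lid)
  finally have "det (S + \<alpha> *\<^sub>R correction \<beta> X S) * det ?W = det (?W + \<alpha> *\<^sub>R Q) * det S * (det ?W * det ?M)"
    by (metis (no_types, opaque_lifting) det_mul mult.assoc mult.commute)
  also have "det ?W * det ?M = 1" using WM by (metis det_I det_mul)
  also have "?W + \<alpha> *\<^sub>R Q = S + (\<beta> + \<alpha>) *\<^sub>R Q" by (simp add: algebra_simps)
  finally show ?thesis by simp
qed

lemma ln_det_correction_ge:
  fixes X :: "real^'p^'m"
  assumes S: "pos_def_matrix S" "0 < \<beta>" and "0 \<le> \<alpha>"
  defines "Q \<equiv> transpose X ** X"
  shows "ln (det S) + \<beta> * ln (1 + \<alpha> / \<beta>) * trace (Q ** matrix_inv (S + \<beta> *\<^sub>R Q))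
    \<le> ln (det (S + \<alpha> *\<^sub>R correction \<beta> X S))"
proof -
  have pd: "pos_def_matrix (S + c *\<^sub>R Q)" if "c \<ge> 0" for c
    unfolding Q_def by (rule pd_add_psd[OF S(1) psd_scaleR[OF psd_gram that]])
  have pdH: "pos_def_matrix (S + \<alpha> *\<^sub>R correction \<beta> X S)"
    by (intro pd_add_psd psd_scaleR psd_correction assms)
  have pos: "det (S + \<beta> *\<^sub>R Q) > 0" "det (S + (\<beta> + \<alpha>) *\<^sub>R Q) > 0" "det S > 0" "det (S + \<alpha> *\<^sub>R correction \<beta> X S) > 0"
    by (rule pd_det_pos, rule pd pdH S | use assms in simp)+
  have "ln (det (S + \<alpha> *\<^sub>R correction \<beta> X S) * det (S + \<beta> *\<^sub>R Q)) = ln (det (S + (\<beta> + \<alpha>) *\<^sub>R Q) * det S)"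
    by (simp add: det_correction[OF S] Q_def)
  then have "ln (det (S + \<alpha> *\<^sub>R correction \<beta> X S)) + ln (det (S + \<beta> *\<^sub>R Q)) = ln (det (S + (\<beta> + \<alpha>) *\<^sub>R Q)) + ln (det S)"
    using pos by (simp add: ln_mult)
  moreover have "(\<beta> + \<alpha>) / \<beta> = 1 + \<alpha> / \<beta>" using S by (simp add: field_simps)
  ultimately show ?thesis
    using ln_det_add_gram_ge_ln[OF S, of "\<beta> + \<alpha>" X] \<open>0 \<le> \<alpha>\<close> by (simp add: Q_def)
qed

lemma ln_one_plus_gt:
  fixes x :: real
  assumes "0 < x"
  shows "2 * x / (2 + x) < ln (1 + x)"
proof -
  let ?f = "\<lambda>x::real. ln (1 + x) - 2 * x / (2 + x)"
  have "?f 0 < ?f x"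
  proof (rule DERIV_pos_imp_increasing_open[OF assms])
    fix y :: real assume y: "0 < y" "y < x"
    have "(?f has_real_derivative (1 / (1 + y) - (2 * (2 + y) - 2 * y * 1) / ((2 + y) * (2 + y)))) (at y)"
      using y by (auto intro!: derivative_eq_intros)
    then have "(?f has_real_derivative (1 / (1 + y) - 4 / (2 + y)\<^sup>2)) (at y)"
      by (simp add: power2_eq_square)
    moreover have "1 / (1 + y) - 4 / (2 + y)\<^sup>2 > 0"
    proof -
      have "4 * (1 + y) < (2 + y)\<^sup>2" using y by (simp add: power2_eq_square algebra_simps)
      then show ?thesis using y by (simp add: divide_simps)
    qed
    ultimately show "\<exists>d. (?f has_real_derivative d) (at y) \<and> 0 < d" by blast
  next
    show "continuous_on {0..x} ?f" by (intro continuous_intros) auto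
  qed
  then show ?thesis by simp
qed

section \<open>Stein's identity for one Gaussian vector\<close>

lemma nn_integral_lborel_translate:
  fixes f :: "'a::euclidean_space \<Rightarrow> ennreal"
  assumes [measurable]: "f \<in> borel_measurable borel"
  shows "(\<integral>\<^sup>+z. f (z + a) \<partial>lborel) = (\<integral>\<^sup>+z. f z \<partial>lborel)"
proof -
  have "(\<integral>\<^sup>+z. f z \<partial>lborel) = (\<integral>\<^sup>+z. f z \<partial>distr lborel borel ((+) a))" by (simp add: lborel_distr_plus)
  also have "\<dots> = (\<integral>\<^sup>+z. f (a + z) \<partial>lborel)" by (rule nn_integral_distr) auto
  finally show ?thesis by (simp add: add.commute)
qed

lemma integrable_lborel_translate:
  fixes f :: "'a::euclidean_space \<Rightarrow> real"
  assumes "integrable lborel f"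
  shows "integrable lborel (\<lambda>z. f (z + a))" "(\<integral>z. f (z + a) \<partial>lborel) = (\<integral>z. f z \<partial>lborel)"
proof -
  have [measurable]: "f \<in> borel_measurable borel" using assms by auto
  have "integrable (distr lborel borel ((+) a)) f" using assms by (simp add: lborel_distr_plus)
  then show "integrable lborel (\<lambda>z. f (z + a))"
    by (subst (asm) integrable_distr_eq) (auto simp: add.commute)
  have "(\<integral>z. f z \<partial>lborel) = (\<integral>z. f z \<partial>distr lborel borel ((+) a))" by (simp add: lborel_distr_plus)
  also have "\<dots> = (\<integral>z. f (a + z) \<partial>lborel)" by (rule integral_distr) auto
  finally show "(\<integral>z. f (z + a) \<partial>lborel) = (\<integral>z. f z \<partial>lborel)" by (simp add: add.commute)
qed

text \<open>Translation invariance gives \<open>\<integral> f (z + e) - f z = 0\<close>. The integrand is \<open>\<integral>\<^sub>0\<^sup>1 D (z + s e) ds\<close>, and after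
  exchanging the integrals every inner integral equals \<open>\<integral> D\<close>. In this way integration by parts needs neither
  coordinates nor boundary terms.\<close>

lemma integral_directional_derivative_eq_0:
  fixes f D :: "'a::euclidean_space \<Rightarrow> real"
  assumes f: "integrable lborel f" and D: "integrable lborel D" and cont: "continuous_on UNIV D"
    and deriv: "\<And>z t. ((\<lambda>s. f (z + s *\<^sub>R e)) has_real_derivative D (z + t *\<^sub>R e)) (at t)"
  shows "(\<integral>z. D z \<partial>lborel) = 0"
proof -
  have [measurable]: "D \<in> borel_measurable borel" by (intro borel_measurable_continuous_onI cont)
  let ?g = "\<lambda>s z. D (z + s *\<^sub>R e) * indicator {0..1::real} s"
  have ftc: "(\<integral>s. ?g s z \<partial>lborel) = f (z + 1 *\<^sub>R e) - f (z + 0 *\<^sub>R e)" for z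
  proof (rule integral_FTC_Icc_real)
    show "isCont (\<lambda>s. D (z + s *\<^sub>R e)) s" for s
      by (rule continuous_on_interior[of UNIV]) 
         (auto intro!: continuous_on_compose2[OF cont] continuous_intros)
  qed (auto intro: deriv)
  have "integrable (lborel \<Otimes>\<^sub>M lborel) (\<lambda>(s, z). ?g s z)"
  proof (rule lborel_pair.Fubini_integrable)
    have "(\<integral>z. norm (?g s z) \<partial>lborel) = indicator {0..1} s * (\<integral>z. \<bar>D z\<bar> \<partial>lborel)" for s
      using integrable_lborel_translate(2)[of "\<lambda>z. \<bar>D z\<bar>" "s *\<^sub>R e"] D 
      by (simp add: abs_mult mult.commute)
    then show "integrable lborel (\<lambda>s. \<integral>z. norm (case (s, z) of (s, z) \<Rightarrow> ?g s z) \<partial>lborel)"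
      by simp
    show "AE s in lborel. integrable lborel (\<lambda>z. case (s, z) of (s, z) \<Rightarrow> ?g s z)"
      by (intro AE_I2) (auto intro!: integrable_mult_left integrable_lborel_translate D)
  qed measurable
  from lborel_pair.Fubini_integral[OF this]
  have "(\<integral>z. (\<integral>s. ?g s z \<partial>lborel) \<partial>lborel) = (\<integral>s. (\<integral>z. ?g s z \<partial>lborel) \<partial>lborel)" by simp
  also have "\<dots> = (\<integral>s. indicator {0..1::real} s * (\<integral>z. D z \<partial>lborel) \<partial>lborel)"
    by (simp add: integrable_lborel_translate[OF D] mult.commute)
  also have "\<dots> = (\<integral>z. D z \<partial>lborel)" by (simp add: content_real)
  also have "(\<integral>z. (\<integral>s. ?g s z \<partial>lborel) \<partial>lborel) = 0"
    unfolding ftc using integrable_lborel_translate[OF f, of e]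
    by (subst Bochner_Integration.integral_diff) (use f in auto)
  finally show ?thesis by simp
qed

lemma integrable_exp_neg_norm_sq:
  assumes "0 < a"
  shows "integrable lborel (\<lambda>z::'a::euclidean_space. exp (- a * (norm z)\<^sup>2))"
proof (rule integrableI_bounded)
  have one: "(\<integral>\<^sup>+x. ennreal (exp (- a * x\<^sup>2)) \<partial>lborel) < \<infinity>"
  proof -
    define \<sigma> where "\<sigma> = 1 / sqrt (2 * a)"
    have "integrable lborel (\<lambda>x. sqrt (2 * pi * \<sigma>\<^sup>2) * (normal_density 0 \<sigma> x * (x - 0) ^ 0))"
      using assms by (intro integrable_mult_right integrable_normal_moment) (simp add: \<sigma>_def)
    moreover have "sqrt (2 * pi * \<sigma>\<^sup>2) * (normal_density 0 \<sigma> x * (x - 0) ^ 0) = exp (- a * x\<^sup>2)" for x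
      using assms by (simp add: normal_density_def \<sigma>_def power_divide)
    ultimately have "integrable lborel (\<lambda>x. exp (- a * x\<^sup>2))" by (simp only:)
    then show ?thesis by (simp add: integrable_iff_bounded)
  qed
  have norm_sq: "(norm z)\<^sup>2 = (\<Sum>b\<in>Basis. (z \<bullet> b)\<^sup>2)" for z :: 'a
    unfolding power2_norm_eq_inner by (subst euclidean_inner) (simp add: power2_eq_square)
  have "ennreal (norm (exp (- a * (norm z)\<^sup>2))) = (\<Prod>b\<in>Basis. ennreal (exp (- a * (z \<bullet> b)\<^sup>2)))" for z :: 'a
    by (subst prod_ennreal)
       (auto simp: exp_sum[symmetric] sum_negf norm_sq simp flip: sum_distrib_left)
  then have "(\<integral>\<^sup>+z. ennreal (norm (exp (- a * (norm z)\<^sup>2))) \<partial>(lborel :: 'a measure)) = 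
      (\<Prod>b\<in>(Basis::'a set). (\<integral>\<^sup>+x. ennreal (exp (- a * x\<^sup>2)) \<partial>lborel))"
    by (simp only: nn_integral_lborel_prod[where f="\<lambda>b x. ennreal (exp (- a * x\<^sup>2))"])
       (subst nn_integral_lborel_prod; simp)
  also have "\<dots> < \<infinity>" using one by (simp add: ennreal_prod_eq_top power_less_top_ennreal)
  finally show "(\<integral>\<^sup>+z. ennreal (norm (exp (- a * (norm z)\<^sup>2))) \<partial>(lborel :: 'a measure)) < \<infinity>" .
qed auto

lemma pd_quad_le_trace:
  fixes A :: "real^'p^'p"
  assumes "pos_def_matrix A"
  shows "x \<bullet> (A *v x) \<le> trace A * (x \<bullet> x)"
proof -
  obtain R :: "real^'p^'p" where R: "A = transpose R ** R" by (rule pd_eq_gram[OF assms])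
  have "x \<bullet> (A *v x) = (\<Sum>i\<in>UNIV. (R $ i \<bullet> x)\<^sup>2)" by (simp only: R gram_quad)
  also have "\<dots> \<le> (\<Sum>i\<in>UNIV. (R $ i \<bullet> R $ i) * (x \<bullet> x))"
    by (intro sum_mono Cauchy_Schwarz_ineq)
  also have "\<dots> = trace A * (x \<bullet> x)"
    using trace_gram_mult[of R "mat 1"] by (simp add: R sum_distrib_right)
  finally show ?thesis .
qed

lemma pd_quad_ge:
  fixes A :: "real^'p^'p"
  assumes A: "pos_def_matrix A"
  obtains a where "0 < a" "\<And>x. a * (norm x)\<^sup>2 \<le> x \<bullet> (A *v x)"
proof -
  let ?t = "trace (matrix_inv A)"
  have t: "?t > 0"
    unfolding trace_def using pd_diag_pos[OF pd_matrix_inv[OF A]] by (intro sum_pos) auto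
  have "1 / ?t * (norm x)\<^sup>2 \<le> x \<bullet> (A *v x)" for x
  proof (cases "x = 0")
    case False
    then have "0 < x \<bullet> x" by simp
    have "(x \<bullet> x)\<^sup>2 \<le> (x \<bullet> (A *v x)) * (x \<bullet> (matrix_inv A *v x))"
      by (rule inner_sq_le_quad_inv[OF A False])
    also have "\<dots> \<le> (x \<bullet> (A *v x)) * (?t * (x \<bullet> x))"
      by (intro mult_left_mono pd_quad_le_trace pd_matrix_inv A psdD(1) pd_imp_psd)
    finally have "x \<bullet> x \<le> (x \<bullet> (A *v x)) * ?t"
      using \<open>0 < x \<bullet> x\<close> by (simp add: power2_eq_square mult_ac)
    then show ?thesis using t by (simp add: power2_norm_eq_inner divide_simps)
  qed simp
  with t show thesis by (intro that[of "1 / ?t"]) auto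
qed

lemma continuous_on_matrix_vec [continuous_intros]:
  "continuous_on S f \<Longrightarrow> continuous_on S (\<lambda>x. A *v (f x :: real^'p))" for A :: "real^'p^'q"
  by (rule bounded_linear.continuous_on[OF matrix_vector_mul_bounded_linear])

lemma borel_measurable_nth [measurable]:
  "f \<in> borel_measurable M \<Longrightarrow> (\<lambda>x. f x $ i) \<in> borel_measurable M" for f :: "'x \<Rightarrow> 'b::{second_countable_topology, real_normed_vector} ^ 'p"
  by (rule borel_measurable_continuous_on[of "\<lambda>x. x $ i"]) (auto intro: continuous_intros)

lemma DERIV_quad_line:
  fixes A :: "real^'p^'p"
  assumes "transpose A = A"
  shows "((\<lambda>s. (z + s *\<^sub>R e) \<bullet> (A *v (z + s *\<^sub>R e))) has_real_derivative 2 * (e \<bullet> (A *v (z + t *\<^sub>R e)))) (at t)"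
proof -
  have sym: "z \<bullet> (A *v e) = e \<bullet> (A *v z)" using symmetric_inner[OF assms, of z e] by (simp add: inner_commute)
  have "(\<lambda>s. (z + s *\<^sub>R e) \<bullet> (A *v (z + s *\<^sub>R e))) =
      (\<lambda>s. z \<bullet> (A *v z) + 2 * s * (e \<bullet> (A *v z)) + s * s * (e \<bullet> (A *v e)))"
    by (auto simp: fun_eq_iff matrix_vector_right_distrib matrix_vector_mult_scaleR inner_add_left inner_add_right sym algebra_simps)
  then show ?thesis
    by (auto intro!: derivative_eq_intros simp: matrix_vector_right_distrib matrix_vector_mult_scaleR inner_add_right algebra_simps)
qed

lemma norm_matrix_vec_bound:
  obtains K where "0 < K" "\<And>x. norm (A *v x) \<le> K * norm (x::real^'p)"
  using bounded_linear.pos_bounded[OF matrix_vector_mul_bounded_linear[of A]] by (auto simp: mult.commute)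

text \<open>For \<open>g (z) = Q W\<^sup>-\<^sup>1 z\<close> with \<open>W = B + z z\<^sup>T\<close>, this is the divergence of \<open>g\<close> at \<open>z\<close> minus
  \<open>g (z) \<bullet> P z\<close>, that is, the integrand of Stein's identity for a Gaussian vector with precision matrix \<open>P\<close>.\<close>

definition stein_term :: "real^'p^'p \<Rightarrow> real^'p^'p \<Rightarrow> real^'p^'p \<Rightarrow> real^'p \<Rightarrow> real" where
  "stein_term P Q W z = trace (Q ** matrix_inv W) * (1 - z \<bullet> (matrix_inv W *v z))
     - (matrix_inv W *v z) \<bullet> (Q *v (matrix_inv W *v z)) - (Q *v (matrix_inv W *v z)) \<bullet> (P *v z)"

text \<open>The constant \<open>c\<close> is left arbitrary: only finiteness and positivity of the total mass matter, because
  all comparisons are between integrals over the same measure.\<close>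

locale gaussian =
  fixes c :: real and P :: "real^'p^'p"
  assumes c_pos: "0 < c" and P: "pos_def_matrix P"
begin

definition dens :: "real^'p \<Rightarrow> real" where
  "dens z = c * exp (- (z \<bullet> (P *v z)) / 2)"

definition N :: "(real^'p) measure" where "N = density lborel (\<lambda>z. ennreal (dens z))"

lemma sets_N [measurable_cong, simp]: "sets N = sets borel" by (simp add: N_def)
lemma space_N [simp]: "space N = UNIV" by (simp add: N_def)

lemma dens_pos: "0 < dens z" using c_pos by (simp add: dens_def)

lemma continuous_dens [continuous_intros]: "continuous_on S dens"
  unfolding dens_def by (intro continuous_intros) auto

lemma measurable_dens [measurable]: "dens \<in> borel_measurable borel"
  by (intro borel_measurable_continuous_onI continuous_intros)

lemma dens_le: obtains a where "0 < a" "\<And>z. dens z \<le> c * exp (- a * (norm z)\<^sup>2)"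
proof -
  obtain a where a: "0 < a" "\<And>x. a * (norm x)\<^sup>2 \<le> x \<bullet> (P *v x)" using pd_quad_ge[OF P] by metis
  show thesis
  proof (rule that[of "a / 2"])
    show "dens z \<le> c * exp (- (a / 2) * (norm z)\<^sup>2)" for z
      unfolding dens_def using a(2)[of z] c_pos by (intro mult_left_mono) auto
  qed (use a in auto)
qed

lemma integrable_dens_norm_sq: "integrable lborel (\<lambda>z. dens z * (1 + (norm z)\<^sup>2))"
proof -
  obtain a where a: "0 < a" "\<And>z. dens z \<le> c * exp (- a * (norm z)\<^sup>2)" using dens_le by blast
  \<comment> \<open>half of the exponential decay absorbs the polynomial factor, since \<open>1 + t \<le> K (1 + a t / 2) \<le> K exp (a t / 2)\<close>\<close>
  define K where "K = max 1 (2 / a)"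
  have K: "1 + t \<le> K * exp (a / 2 * t)" if "0 \<le> t" for t
  proof -
    have "1 + t \<le> K * 1 + K * (a / 2 * t)"
    proof (intro add_mono)
      have "1 * t \<le> (K * (a / 2)) * t"
        using a by (intro mult_right_mono that) (simp add: K_def field_simps max_def)
      then show "t \<le> K * (a / 2 * t)" by (simp add: mult_ac)
    qed (simp add: K_def)
    also have "\<dots> = K * (1 + a / 2 * t)" by (simp add: algebra_simps)
    also have "\<dots> \<le> K * exp (a / 2 * t)" by (intro mult_left_mono exp_ge_add_one_self) (simp add: K_def)
    finally show ?thesis .
  qed
  show ?thesis
  proof (rule Bochner_Integration.integrable_bound)
    show "integrable lborel (\<lambda>z::real^'p. c * K * exp (- (a / 2) * (norm z)\<^sup>2))"
      using a by (intro integrable_mult_right integrable_exp_neg_norm_sq) auto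
    show "AE z in lborel. norm (dens z * (1 + (norm z)\<^sup>2)) \<le> norm (c * K * exp (- (a / 2) * (norm z)\<^sup>2))"
    proof (rule AE_I2)
      fix z :: "real^'p"
      have "dens z * (1 + (norm z)\<^sup>2) \<le> (c * exp (- a * (norm z)\<^sup>2)) * (K * exp (a / 2 * (norm z)\<^sup>2))"
        using dens_pos[of z] by (intro mult_mono a K) (use dens_pos[of z] c_pos in \<open>auto simp: less_imp_le\<close>)
      also have "\<dots> = c * K * exp (- (a / 2) * (norm z)\<^sup>2)"
        by (simp add: exp_add[symmetric] algebra_simps)
      finally show "norm (dens z * (1 + (norm z)\<^sup>2)) \<le> norm (c * K * exp (- (a / 2) * (norm z)\<^sup>2))"
        using dens_pos[of z] c_pos by (simp add: K_def)
    qed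
  qed simp
qed

lemma integrable_dens_bound:
  assumes [measurable]: "f \<in> borel_measurable borel" and "\<And>z. \<bar>f z\<bar> \<le> K * (1 + (norm z)\<^sup>2)"
  shows "integrable lborel (\<lambda>z. dens z * f z)"
proof (rule Bochner_Integration.integrable_bound)
  show "integrable lborel (\<lambda>z. K * (dens z * (1 + (norm z)\<^sup>2)))"
    by (intro integrable_mult_right integrable_dens_norm_sq)
  show "AE z in lborel. norm (dens z * f z) \<le> norm (K * (dens z * (1 + (norm z)\<^sup>2)))"
  proof (rule AE_I2)
    fix z
    have *: "dens z * \<bar>f z\<bar> \<le> dens z * (K * (1 + (norm z)\<^sup>2))"
      using dens_pos[of z] by (intro mult_left_mono assms) auto
    show "norm (dens z * f z) \<le> norm (K * (dens z * (1 + (norm z)\<^sup>2)))"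
    proof -
      have "K * (dens z * (1 + (norm z)\<^sup>2)) \<le> \<bar>K * (dens z * (1 + (norm z)\<^sup>2))\<bar>" by simp
      with * dens_pos[of z] show ?thesis by (simp add: abs_mult mult_ac)
    qed
  qed
qed simp

lemma finite_measure_N: "finite_measure N"
proof
  have "integrable lborel (\<lambda>z. dens z * 1)" by (rule integrable_dens_bound[of _ 1]) auto
  then have "(\<integral>\<^sup>+z. ennreal (dens z) \<partial>lborel) < \<infinity>"
    using dens_pos by (simp add: integrable_iff_bounded less_imp_le)
  then show "emeasure N (space N) \<noteq> \<infinity>" by (simp add: N_def emeasure_density)
qed

text \<open>By the Sherman-Morrison formula \<open>W\<^sup>-\<^sup>1 z = B\<^sup>-\<^sup>1 z / (1 + z \<bullet> B\<^sup>-\<^sup>1 z)\<close>, so the vector field \<open>Q W\<^sup>-\<^sup>1 z\<close> is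
  an explicit rational function without singularities. Its product with the density is integrated along each
  coordinate direction.\<close>

lemma stein_identity:
  fixes B Q :: "real^'p^'p"
  assumes B: "pos_def_matrix B"
  shows "(\<integral>z. stein_term P Q (B + outer z) z \<partial>N) = 0"
proof -
  define M where "M z = matrix_inv (B + outer z)" for z
  define C where "C = matrix_inv B"
  define G where "G = Q ** C"
  define q where "q z = 1 + z \<bullet> (C *v z)" for z
  have C: "pos_def_matrix C" unfolding C_def by (rule pd_matrix_inv[OF B])
  have q: "1 \<le> q z" for z using psdD(1)[OF pd_imp_psd[OF C], of z] by (simp add: q_def)
  have q': "q z \<noteq> 0" "0 < q z" for z using q[of z] by auto
  define D where "D i z = dens z * (G $ i $ i / q z - (G *v z) $ i * (2 * (C *v z) $ i) / (q z)\<^sup>2 - (G *v z) $ i * (P *v z) $ i / q z)" for i z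
  obtain KG where KG: "0 < KG" "\<And>x. norm (G *v x) \<le> KG * norm x" using norm_matrix_vec_bound[of G] by blast
  obtain KC where KC: "0 < KC" "\<And>x. norm (C *v x) \<le> KC * norm x" using norm_matrix_vec_bound[of C] by blast
  obtain KP where KP: "0 < KP" "\<And>x. norm (P *v x) \<le> KP * norm x" using norm_matrix_vec_bound[of P] by blast
  have comp: "\<bar>(G *v z) $ i\<bar> \<le> KG * norm z" "\<bar>(C *v z) $ i\<bar> \<le> KC * norm z" "\<bar>(P *v z) $ i\<bar> \<le> KP * norm z" for z i
    using KG(2)[of z] KC(2)[of z] KP(2)[of z] by (meson component_le_norm_cart order_trans)+
  have n1: "norm z \<le> 1 + (norm z)\<^sup>2" for z :: "real^'p"
    using sum_squares_bound[of "norm z" 1] norm_ge_zero[of z] unfolding power_one mult_1_right by linarith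
  have cont: "continuous_on UNIV (\<lambda>z. h z / q z ^ k)" if "continuous_on UNIV h" for h :: "real^'p \<Rightarrow> real" and k
    unfolding q_def by (intro continuous_intros that) (use q' in \<open>auto simp: q_def\<close>)
  have divq: "\<bar>x / q z ^ k\<bar> \<le> \<bar>x\<bar>" for x z k
    using one_le_power[OF q, of z k] by (simp add: abs_mult divide_le_eq mult_le_cancel_left1 abs_of_nonneg)
  have int0: "integrable lborel (\<lambda>z. dens z * ((G *v z) $ i / q z ^ 1))" for i
  proof (rule integrable_dens_bound[of _ KG])
    show "(\<lambda>z. (G *v z) $ i / q z ^ 1) \<in> borel_measurable borel"
      by (intro borel_measurable_continuous_onI cont continuous_intros)
    show "\<bar>(G *v z) $ i / q z ^ 1\<bar> \<le> KG * (1 + (norm z)\<^sup>2)" for z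
      using divq[of "(G *v z) $ i" z 1] comp(1)[where z=z and i=i] mult_left_mono[OF n1[of z], of KG] KG(1) by linarith
  qed
  have contD: "continuous_on UNIV (\<lambda>z. G $ i $ i / q z - (G *v z) $ i * (2 * (C *v z) $ i) / (q z)\<^sup>2 - (G *v z) $ i * (P *v z) $ i / q z)" for i
    by (intro continuous_intros cont cont[of _ 1, simplified])
  have intD: "integrable lborel (D i)" for i
    unfolding D_def
  proof (rule integrable_dens_bound)
    show "(\<lambda>z. G $ i $ i / q z - (G *v z) $ i * (2 * (C *v z) $ i) / (q z)\<^sup>2 - (G *v z) $ i * (P *v z) $ i / q z) \<in> borel_measurable borel"
      by (intro borel_measurable_continuous_onI contD)
    fix z :: "real^'p"
    let ?K = "\<bar>G $ i $ i\<bar> + 2 * (KG * KC) + KG * KP"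
    have prod: "\<bar>x * y\<bar> \<le> (k * l) * (norm z)\<^sup>2" if "\<bar>x\<bar> \<le> k * norm z" "\<bar>y\<bar> \<le> l * norm z" for x y k l
    proof -
      have "\<bar>x\<bar> * \<bar>y\<bar> \<le> (k * norm z) * (l * norm z)"
        by (rule mult_mono[OF that]) (use that in auto)
      then show ?thesis by (simp add: abs_mult power2_eq_square mult_ac)
    qed
    have "\<bar>G $ i $ i / q z\<bar> \<le> \<bar>G $ i $ i\<bar>" using divq[of _ z 1] by simp
    moreover have "\<bar>(G *v z) $ i * (2 * (C *v z) $ i) / (q z)\<^sup>2\<bar> \<le> 2 * (KG * KC) * (norm z)\<^sup>2"
      using divq[of "(G *v z) $ i * (2 * (C *v z) $ i)" z 2] prod[OF comp(1,2)[of z i]] by (simp add: abs_mult)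
    moreover have "\<bar>(G *v z) $ i * (P *v z) $ i / q z\<bar> \<le> KG * KP * (norm z)\<^sup>2"
      using divq[of "(G *v z) $ i * (P *v z) $ i" z 1] prod[OF comp(1,3)[of z i]] by simp
    moreover have "?K * (1 + (norm z)\<^sup>2) = \<bar>G $ i $ i\<bar> + \<bar>G $ i $ i\<bar> * (norm z)\<^sup>2 + (2 * (KG * KC) + KG * KP) + 2 * (KG * KC) * (norm z)\<^sup>2 + KG * KP * (norm z)\<^sup>2"
      by (simp add: algebra_simps)
    moreover have "0 \<le> \<bar>G $ i $ i\<bar> * (norm z)\<^sup>2" "0 \<le> 2 * (KG * KC) + KG * KP" using KG(1) KC(1) KP(1) by auto
    ultimately show "\<bar>G $ i $ i / q z - (G *v z) $ i * (2 * (C *v z) $ i) / (q z)\<^sup>2 - (G *v z) $ i * (P *v z) $ i / q z\<bar> \<le> ?K * (1 + (norm z)\<^sup>2)"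
      by linarith
  qed
  have zero: "(\<integral>z. D i z \<partial>lborel) = 0" for i
  proof (rule integral_directional_derivative_eq_0[OF int0[of i] intD])
    show "continuous_on UNIV (D i)" unfolding D_def by (intro continuous_intros contD)
    fix z t
    let ?e = "axis i (1::real)"
    have ax: "?e \<bullet> v = v $ i" for v :: "real^'p" by (simp add: inner_axis')
    have d1: "((\<lambda>s. dens (z + s *\<^sub>R ?e)) has_real_derivative dens (z + t *\<^sub>R ?e) * - ((P *v (z + t *\<^sub>R ?e)) $ i)) (at t)"
      unfolding dens_def
      by (rule derivative_eq_intros DERIV_quad_line[OF pdD(2)[OF P]] refl | simp add: ax)+
    have d2: "((\<lambda>s. q (z + s *\<^sub>R ?e)) has_real_derivative 2 * (C *v (z + t *\<^sub>R ?e)) $ i) (at t)"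
      unfolding q_def
      by (rule derivative_eq_intros DERIV_quad_line[OF pdD(2)[OF C]] refl | simp add: ax)+
    have "(\<lambda>s. (G *v (z + s *\<^sub>R ?e)) $ i) = (\<lambda>s. (G *v z) $ i + s * G $ i $ i)"
      by (auto simp: fun_eq_iff matrix_vector_right_distrib matrix_vector_mult_scaleR)
         (simp add: matrix_vector_mult_basis column_def)
    then have d3: "((\<lambda>s. (G *v (z + s *\<^sub>R ?e)) $ i) has_real_derivative G $ i $ i) (at t)"
      by (auto intro!: derivative_eq_intros)
    show "((\<lambda>s. dens (z + s *\<^sub>R ?e) * ((G *v (z + s *\<^sub>R ?e)) $ i / q (z + s *\<^sub>R ?e) ^ 1)) has_real_derivative D i (z + t *\<^sub>R ?e)) (at t)"
      unfolding power_one_right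
      by (rule DERIV_cong[OF DERIV_mult[OF d1 DERIV_divide[OF d3 d2 q'(1)]]])
         (simp add: D_def field_simps q' power2_eq_square)
  qed
  have eq: "trace (Q ** M z) * (1 - z \<bullet> (M z *v z)) - (M z *v z) \<bullet> (Q *v (M z *v z)) - (Q *v (M z *v z)) \<bullet> (P *v z)
     = trace G / q z - 2 * ((G *v z) \<bullet> (C *v z)) / (q z)\<^sup>2 - (G *v z) \<bullet> (P *v z) / q z" for z
  proof -
    have Bz: "pos_def_matrix (B + outer z)" by (intro pd_add_psd B psd_outer)
    have Mz: "M z *v z = (1 / q z) *\<^sub>R (C *v z)"
      by (simp add: M_def matrix_inv_add_outer[OF B] q_def C_def)
    have "M z = C - (1 / q z) *\<^sub>R outer (C *v z)"
    proof -
      have "M z *v x = (C - (1 / q z) *\<^sub>R outer (C *v z)) *v x" for x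
        unfolding M_def
      proof (rule matrix_inv_vec_eqI[OF Bz])
        have BC: "B *v (C *v x) = x" for x by (simp add: C_def matrix_inv_vec[OF B])
        have Cs: "(C *v z) \<bullet> x = z \<bullet> (C *v x)" by (simp add: symmetric_inner[OF pdD(2)[OF C]])
        have "(C - (1 / q z) *\<^sub>R outer (C *v z)) *v x = C *v x - ((z \<bullet> (C *v x)) / q z) *\<^sub>R (C *v z)"
          by (simp add: matrix_vector_mult_diff_rdistrib outer_mult_vec Cs flip: scaleR_matrix_vector_assoc)
        moreover have "(B + outer z) *v (C *v x - ((z \<bullet> (C *v x)) / q z) *\<^sub>R (C *v z)) = x"
        proof -
          have "z \<bullet> (C *v x) - (z \<bullet> (C *v x)) / q z * (z \<bullet> (C *v z)) - (z \<bullet> (C *v x)) / q z = 0"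
            using q'(1)[of z] by (simp add: field_simps) (simp add: q_def algebra_simps)
          moreover have "(B + outer z) *v (C *v x - ((z \<bullet> (C *v x)) / q z) *\<^sub>R (C *v z)) =
             x + (z \<bullet> (C *v x) - (z \<bullet> (C *v x)) / q z * (z \<bullet> (C *v z)) - (z \<bullet> (C *v x)) / q z) *\<^sub>R z"
            by (simp add: matrix_vector_mult_add_rdistrib matrix_vector_mult_diff_distrib matrix_vector_mult_scaleR BC outer_mult_vec algebra_simps inner_diff_right)
          ultimately show ?thesis by simp
        qed
        ultimately show "(B + outer z) *v ((C - (1 / q z) *\<^sub>R outer (C *v z)) *v x) = x" by simp
      qed
      then show ?thesis by (metis matrix_eq)
    qed
    then have "M z = C + (- 1 / q z) *\<^sub>R outer (C *v z)" by simp
    then have "trace (Q ** M z) = trace (Q ** C + (- 1 / q z) *\<^sub>R (Q ** outer (C *v z)))"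
      by (simp only: matrix_add_ldistrib matrix_mult_scaleR_right)
    also have "\<dots> = trace G - ((C *v z) \<bullet> (Q *v (C *v z))) / q z"
      by (simp only: trace_add trace_scaleR trace_mult_outer G_def) simp
    finally have T: "trace (Q ** M z) = trace G - ((G *v z) \<bullet> (C *v z)) / q z"
      by (simp add: G_def inner_commute flip: matrix_vector_mul_assoc)
    have e1: "1 - z \<bullet> (M z *v z) = 1 / q z" using q'(1)[of z] by (simp add: Mz field_simps) (simp add: q_def)
    have e2: "(M z *v z) \<bullet> (Q *v (M z *v z)) = ((G *v z) \<bullet> (C *v z)) / (q z)\<^sup>2"
      by (simp add: Mz matrix_vector_mult_scaleR G_def inner_commute power2_eq_square flip: matrix_vector_mul_assoc)
    have e3: "(Q *v (M z *v z)) \<bullet> (P *v z) = (G *v z) \<bullet> (P *v z) / q z"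
      by (simp add: Mz matrix_vector_mult_scaleR G_def flip: matrix_vector_mul_assoc)
    show ?thesis unfolding T e1 e2 e3 by (simp add: diff_divide_distrib power2_eq_square)
  qed
  have "dens z * (trace G / q z - 2 * ((G *v z) \<bullet> (C *v z)) / (q z)\<^sup>2 - (G *v z) \<bullet> (P *v z) / q z) = (\<Sum>i\<in>UNIV. D i z)" for z
    by (simp add: D_def trace_def inner_vec_def sum_distrib_left sum_divide_distrib sum_subtractf right_diff_distrib mult_ac)
  then have "(\<integral>z. dens z * (trace G / q z - 2 * ((G *v z) \<bullet> (C *v z)) / (q z)\<^sup>2 - (G *v z) \<bullet> (P *v z) / q z) \<partial>lborel) = 0"
    by (simp add: Bochner_Integration.integral_sum[OF intD] zero)
  moreover have "(\<lambda>z. trace G / q z - 2 * ((G *v z) \<bullet> (C *v z)) / (q z)\<^sup>2 - (G *v z) \<bullet> (P *v z) / q z) \<in> borel_measurable borel"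
    by (intro borel_measurable_continuous_onI continuous_intros cont cont[of _ 1, simplified])
  ultimately show ?thesis
    unfolding stein_term_def M_def[symmetric] eq N_def using dens_pos by (subst integral_density) (auto simp: less_imp_le)
qed

end

section \<open>Measurability, a logarithmic moment bound, and samples\<close>

lemma continuous_on_det [continuous_intros]:
  "continuous_on S f \<Longrightarrow> continuous_on S (\<lambda>x. det (f x :: real^'p^'p))"
  unfolding det_def by (intro continuous_intros)

lemma borel_measurable_det [measurable]:
  "f \<in> borel_measurable M \<Longrightarrow> (\<lambda>x. det (f x :: real^'p^'p)) \<in> borel_measurable M"
  by (rule borel_measurable_continuous_on) (auto intro: continuous_intros)

lemma borel_measurable_trace [measurable]:
  "f \<in> borel_measurable M \<Longrightarrow> (\<lambda>x. trace (f x :: real^'p^'p)) \<in> borel_measurable M"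
  by (rule borel_measurable_continuous_on) (auto simp: trace_def intro!: continuous_intros)

lemma borel_measurable_transpose [measurable]:
  "f \<in> borel_measurable M \<Longrightarrow> (\<lambda>x. transpose (f x :: real^'p^'q)) \<in> borel_measurable M"
  by (rule borel_measurable_continuous_on) (auto simp: transpose_def intro!: continuous_intros)

lemma borel_measurable_outer [measurable]:
  "f \<in> borel_measurable M \<Longrightarrow> (\<lambda>x. outer (f x :: real^'p)) \<in> borel_measurable M"
  by (rule borel_measurable_continuous_on) (auto simp: outer_def intro!: continuous_intros)

lemma borel_measurable_matrix_mult [measurable]:
  fixes f :: "'x \<Rightarrow> real^'p^'q" and g :: "'x \<Rightarrow> real^'r^'p"
  assumes "f \<in> borel_measurable M" "g \<in> borel_measurable M"
  shows "(\<lambda>x. f x ** g x) \<in> borel_measurable M"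
  using assms by (rule borel_measurable_continuous_Pair)
    (auto simp: matrix_matrix_mult_def intro!: continuous_intros)

lemma borel_measurable_matrix_vec_mult [measurable]:
  fixes f :: "'x \<Rightarrow> real^'p^'q" and g :: "'x \<Rightarrow> real^'p"
  assumes "f \<in> borel_measurable M" "g \<in> borel_measurable M"
  shows "(\<lambda>x. f x *v g x) \<in> borel_measurable M"
  using assms by (rule borel_measurable_continuous_Pair)
    (auto simp: matrix_vector_mult_def intro!: continuous_intros)

lemma matrix_inv_cramer:
  fixes A :: "real^'p^'p"
  assumes "det A \<noteq> 0"
  shows "matrix_inv A = (\<chi> k j. det (\<chi> i l. if l = k then axis j 1 $ i else A $ i $ l) / det A)"
proof -
  have inv: "invertible A" using assms by (simp add: invertible_det_nz)
  have "matrix_inv A $ k $ j * det A = det (\<chi> i l. if l = k then axis j 1 $ i else A $ i $ l)" for k j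
  proof -
    let ?x = "matrix_inv A *v axis j 1"
    have "A *v ?x = axis j 1" by (simp add: matrix_vector_mul_assoc matrix_inv_right[OF inv])
    moreover have "?x $ k = matrix_inv A $ k $ j" by (simp add: matrix_vector_mult_basis column_def)
    ultimately show ?thesis using cramer_lemma[where A=A and k=k and x="?x"] by (simp only:)
  qed
  then show ?thesis using assms by (simp add: vec_eq_iff eq_divide_eq)
qed

lemma borel_measurable_matrix_inv [measurable]:
  fixes f :: "'x \<Rightarrow> real^'p^'p"
  assumes "f \<in> borel_measurable M"
  shows "(\<lambda>x. matrix_inv (f x)) \<in> borel_measurable M"
proof -
  let ?U = "{A :: real^'p^'p. det A \<noteq> 0}"
  let ?g = "\<lambda>A :: real^'p^'p. (\<chi> k j. det (\<chi> i l. if l = k then axis j 1 $ i else A $ i $ l) / det A)"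
  have sing: "matrix_inv A = (SOME A'. False)" if "\<not> invertible A" for A :: "real^'p^'p"
  proof -
    have "(\<lambda>A'. A ** A' = mat 1 \<and> A' ** A = mat 1) = (\<lambda>_. False)"
      using that by (auto simp: invertible_def)
    then show ?thesis by (simp only: matrix_inv_def)
  qed
  have "matrix_inv A = matrix_inv (0 :: real^'p^'p)" if "det A = 0" for A :: "real^'p^'p"
  proof -
    have "det (0 :: real^'p^'p) = 0" using det_0 by (simp add: mat_def zero_vec_def)
    then have "\<not> invertible A" "\<not> invertible (0 :: real^'p^'p)"
      using that by (simp_all add: invertible_det_nz)
    then show ?thesis by (simp only: sing not_False_eq_True)
  qed
  then have eq: "matrix_inv = (\<lambda>A. if A \<in> ?U then ?g A else matrix_inv 0)"
    using matrix_inv_cramer by (auto simp: fun_eq_iff)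
  have "open ?U"
    by (intro open_Collect_neq continuous_intros)
  moreover have "continuous_on ?U ?g"
  proof (intro continuous_intros)
    show "continuous_on ?U (\<lambda>A. if l = k then axis j 1 $ i else A $ i $ l)" for i j k l :: 'p
      by (cases "l = k") (auto intro!: continuous_intros)
  qed auto
  ultimately have "(\<lambda>A. if A \<in> ?U then ?g A else matrix_inv 0) \<in> borel_measurable borel"
    by (intro borel_measurable_continuous_on_if) auto
  then have "matrix_inv \<in> borel_measurable (borel :: (real^'p^'p) measure)" by (simp only: eq[symmetric])
  then show ?thesis using assms by (rule measurable_compose[rotated])
qed

text \<open>A majorant of the positive part of \<open>- ln (y\<^sup>2)\<close> with a simple integral. Its value at \<open>0\<close> is infinite so that the bound
  \<open>neg_ln_sq_le\<close> can be used without excluding a null set.\<close>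

definition log_kernel :: "real \<Rightarrow> ennreal" where
  "log_kernel y = (if y = 0 then \<infinity> else ennreal (4 * \<bar>y\<bar> powr (- 1/2)) * indicator {-1..1} y)"

lemma measurable_log_kernel [measurable]: "log_kernel \<in> borel_measurable borel"
  unfolding log_kernel_def by measurable

lemma neg_ln_sq_le: "ennreal (- ln (y\<^sup>2)) \<le> log_kernel y"
proof (cases "y = 0 \<or> 1 < \<bar>y\<bar>")
  case True
  have "- ln (y\<^sup>2) \<le> 0" if "1 < \<bar>y\<bar>" 
    using power_mono[of 1 "\<bar>y\<bar>" 2] that by simp
  then show ?thesis using True by (auto simp: log_kernel_def ennreal_neg)
next
  case False
  then have y: "y \<noteq> 0" "\<bar>y\<bar> \<le> 1" by auto
  have "ln (\<bar>y\<bar> ^ 2) = 2 * ln \<bar>y\<bar>" using y by (subst ln_realpow) auto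
  then have "- ln (y\<^sup>2) = 4 * ln (\<bar>y\<bar> powr (- 1/2))" using y by (simp add: ln_powr)
  also have "\<dots> \<le> 4 * \<bar>y\<bar> powr (- 1/2)"
    using ln_le_minus_one[of "\<bar>y\<bar> powr (- 1/2)"] y by simp
  finally show ?thesis using y by (auto simp: log_kernel_def intro!: ennreal_leI split: split_indicator)
qed

lemma nn_integral_log_kernel: "(\<integral>\<^sup>+y. log_kernel y \<partial>lborel) \<le> ennreal 16"
proof -
  have 1: "(\<integral>\<^sup>+y. ennreal (indicator {0..1} y * (4 * y powr (-1/2))) \<partial>lborel) = ennreal 8"
  proof -
    have "((\<lambda>y::real. y powr (-1/2)) has_integral (1 powr (-1/2+1) / (-1/2+1))) {0..1}"
      by (rule has_integral_powr_from_0) auto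
    from has_integral_mult_right[OF this, of 4]
    have "((\<lambda>y::real. 4 * y powr (-1/2)) has_integral 8) {0..1}" by simp
    from nn_integral_has_integral_lebesgue[OF _ this] show ?thesis by simp
  qed
  have 2: "(\<integral>\<^sup>+y. ennreal (indicator {0..1} (- y) * (4 * (- y) powr (-1/2))) \<partial>lborel) = ennreal 8"
    using nn_integral_real_affine[of "\<lambda>y. ennreal (indicator {0..1} y * (4 * y powr (-1/2)))" "-1" 0] 1 by simp
  have "AE y::real in lborel. y \<noteq> 0" by (rule AE_lborel_singleton)
  then have "AE y in lborel. log_kernel y \<le> ennreal (indicator {0..1} y * (4 * y powr (-1/2)))
     + ennreal (indicator {0..1} (- y) * (4 * (- y) powr (-1/2)))"
    by eventually_elim (auto simp: log_kernel_def split: split_indicator)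
  then have "(\<integral>\<^sup>+y. log_kernel y \<partial>lborel) \<le> (\<integral>\<^sup>+y. ennreal (indicator {0..1} y * (4 * y powr (-1/2)))
     + ennreal (indicator {0..1} (- y) * (4 * (- y) powr (-1/2))) \<partial>lborel)"
    by (rule nn_integral_mono_AE)
  also have "\<dots> = ennreal 8 + ennreal 8" by (subst nn_integral_add) (simp_all only: 1 2, simp_all)
  also have "\<dots> = ennreal 16" by (simp flip: ennreal_plus)
  finally show ?thesis .
qed

context gaussian
begin

text \<open>The bound is uniform in the direction \<open>u\<close>. Averaging over the translates \<open>z + s u\<close> with
  \<open>0 \<le> s \<le> 1\<close> does not change the integral; a shift by at most \<open>1\<close> changes the Gaussian density
  only up to a fixed Gaussian majorant, and the inner integral over \<open>s\<close> becomes an integral of the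
  kernel over the line.\<close>

lemma nn_integral_log_kernel_le:
  obtains K :: real where "0 \<le> K" "\<forall>u. norm u = 1 \<longrightarrow> (\<integral>\<^sup>+z. log_kernel (u \<bullet> z) \<partial>N) \<le> ennreal K"
proof -
  obtain a where a: "0 < a" "\<And>z. dens z \<le> c * exp (- a * (norm z)\<^sup>2)" using dens_le by blast
  define \<psi> where "\<psi> z = c * exp a * exp (- (a / 2) * (norm z)\<^sup>2)" for z :: "real^'p"
  have int: "integrable lborel \<psi>" unfolding \<psi>_def
    using a by (intro integrable_mult_right integrable_exp_neg_norm_sq) auto
  have \<psi>0: "0 \<le> \<psi> z" for z using c_pos by (simp add: \<psi>_def)
  have [measurable]: "\<psi> \<in> borel_measurable borel" using int by auto
  have shift: "dens (z + s *\<^sub>R u) \<le> \<psi> z" if "norm u = 1" "s \<in> {0..1}" for z u s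
  proof -
    have "norm z \<le> norm (z + s *\<^sub>R u) + 1"
      using norm_triangle_ineq4[of "z + s *\<^sub>R u" "s *\<^sub>R u"] that by simp
    then have "(norm z)\<^sup>2 \<le> (norm (z + s *\<^sub>R u) + 1)\<^sup>2" by (intro power_mono) auto
    also have "\<dots> \<le> 2 * (norm (z + s *\<^sub>R u))\<^sup>2 + 2"
      using sum_squares_bound[of "norm (z + s *\<^sub>R u)" 1] by (simp add: power2_sum)
    finally have "a * ((norm z)\<^sup>2 / 2) \<le> a * ((norm (z + s *\<^sub>R u))\<^sup>2 + 1)"
      using a by (intro mult_left_mono) auto
    then have "- a * (norm (z + s *\<^sub>R u))\<^sup>2 \<le> a + - (a / 2) * (norm z)\<^sup>2" by (simp add: algebra_simps)
    then have "c * exp (- a * (norm (z + s *\<^sub>R u))\<^sup>2) \<le> c * exp (a + - (a / 2) * (norm z)\<^sup>2)"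
      using c_pos by (intro mult_left_mono) auto
    with a(2)[of "z + s *\<^sub>R u"] show ?thesis unfolding \<psi>_def exp_add by (simp add: mult_ac)
  qed
  have "(\<integral>\<^sup>+z. log_kernel (u \<bullet> z) \<partial>N) \<le> ennreal (16 * (\<integral>z. \<psi> z \<partial>lborel))" if u: "norm u = 1" for u
  proof -
    let ?F = "\<lambda>s z. log_kernel (u \<bullet> (z + s *\<^sub>R u)) * ennreal (dens (z + s *\<^sub>R u)) * indicator {0..1::real} s"
    have uu: "u \<bullet> u = 1" using u by (simp add: norm_eq_1)
    have "(\<integral>\<^sup>+z. log_kernel (u \<bullet> z) \<partial>N) = (\<integral>\<^sup>+z. log_kernel (u \<bullet> z) * ennreal (dens z) \<partial>lborel)"
      by (simp add: N_def nn_integral_density mult.commute)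
    also have "\<dots> = (\<integral>\<^sup>+s. (\<integral>\<^sup>+z. log_kernel (u \<bullet> z) * ennreal (dens z) \<partial>lborel) * indicator {0..1::real} s \<partial>lborel)"
      by (subst nn_integral_cmult) auto
    also have "\<dots> = (\<integral>\<^sup>+s. (\<integral>\<^sup>+z. ?F s z \<partial>lborel) \<partial>lborel)"
    proof (rule nn_integral_cong)
      fix s :: real
      have "(\<integral>\<^sup>+z. ?F s z \<partial>lborel) = (\<integral>\<^sup>+z. log_kernel (u \<bullet> (z + s *\<^sub>R u)) * ennreal (dens (z + s *\<^sub>R u)) \<partial>lborel) * indicator {0..1} s"
        by (subst nn_integral_multc) auto
      also have "(\<integral>\<^sup>+z. log_kernel (u \<bullet> (z + s *\<^sub>R u)) * ennreal (dens (z + s *\<^sub>R u)) \<partial>lborel) = (\<integral>\<^sup>+z. log_kernel (u \<bullet> z) * ennreal (dens z) \<partial>lborel)"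
        by (rule nn_integral_lborel_translate[where f="\<lambda>z. log_kernel (u \<bullet> z) * ennreal (dens z)"]) simp
      finally show "(\<integral>\<^sup>+z. log_kernel (u \<bullet> z) * ennreal (dens z) \<partial>lborel) * indicator {0..1::real} s = (\<integral>\<^sup>+z. ?F s z \<partial>lborel)" by simp
    qed
    also have "\<dots> = (\<integral>\<^sup>+z. (\<integral>\<^sup>+s. ?F s z \<partial>lborel) \<partial>lborel)"
      by (rule lborel_pair.Fubini'[symmetric]) simp
    also have "\<dots> \<le> (\<integral>\<^sup>+z. ennreal (\<psi> z) * ennreal 16 \<partial>lborel)"
    proof (rule nn_integral_mono)
      fix z :: "real^'p"
      have "?F s z \<le> ennreal (\<psi> z) * log_kernel (s + u \<bullet> z)" for s
      proof (cases "s \<in> {0..1}")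
        case True
        have "log_kernel (s + u \<bullet> z) * ennreal (dens (z + s *\<^sub>R u)) \<le> log_kernel (s + u \<bullet> z) * ennreal (\<psi> z)"
          by (intro mult_left_mono ennreal_leI shift[OF u True]) simp
        then show ?thesis by (simp add: inner_add_right uu add.commute mult.commute split: split_indicator)
      qed simp
      then have "(\<integral>\<^sup>+s. ?F s z \<partial>lborel) \<le> (\<integral>\<^sup>+s. ennreal (\<psi> z) * log_kernel (s + u \<bullet> z) \<partial>lborel)"
        by (intro nn_integral_mono)
      also have "\<dots> = ennreal (\<psi> z) * (\<integral>\<^sup>+s. log_kernel (s + u \<bullet> z) \<partial>lborel)"
        by (rule nn_integral_cmult) simp
      also have "(\<integral>\<^sup>+s. log_kernel (s + u \<bullet> z) \<partial>lborel) = (\<integral>\<^sup>+s. log_kernel s \<partial>lborel)"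
        by (rule nn_integral_lborel_translate) simp
      also have "\<dots> \<le> ennreal 16" by (rule nn_integral_log_kernel)
      finally show "(\<integral>\<^sup>+s. ?F s z \<partial>lborel) \<le> ennreal (\<psi> z) * ennreal 16" by (simp add: mult_left_mono)
    qed
    also have "\<dots> = ennreal (16 * (\<integral>z. \<psi> z \<partial>lborel))"
      using nn_integral_eq_integral[OF int] \<psi>0 
      by (subst nn_integral_multc) (auto simp: ennreal_mult integral_nonneg_AE mult.commute)
    finally show ?thesis .
  qed
  then show thesis
    using \<psi>0 by (intro that[of "16 * (\<integral>z. \<psi> z \<partial>lborel)"]) (auto intro: integral_nonneg_AE)
qed

sublocale product_sigma_finite "\<lambda>_::nat. N"
proof (rule product_sigma_finite.intro)
  interpret finite_measure N by (rule finite_measure_N)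
  show "sigma_finite_measure N" by unfold_locales
qed

abbreviation sample :: "nat set \<Rightarrow> (nat \<Rightarrow> real^'p) measure" where
  "sample I \<equiv> PiM I (\<lambda>_. N)"

lemma finite_measure_sample: assumes "finite I" shows "finite_measure (sample I)"
proof
  interpret finite_measure N by (rule finite_measure_N)
  have "emeasure (sample I) (space (sample I)) = (\<Prod>i\<in>I. emeasure N (space N))"
    unfolding space_PiM using assms by (intro emeasure_PiM) auto
  also have "\<dots> \<noteq> \<infinity>" using emeasure_finite[of UNIV] by (simp add: power_eq_top_ennreal)
  finally show "emeasure (sample I) (space (sample I)) \<noteq> \<infinity>" .
qed

lemma measurable_sample_component [measurable]: "k \<in> I \<Longrightarrow> (\<lambda>z. z k) \<in> borel_measurable (sample I)"
  using measurable_component_singleton[of k I "\<lambda>_. N"] measurable_cong_sets[OF refl sets_N] by blast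

lemma nn_integral_sample_coord_le:
  assumes "finite I" "k \<in> I" and f: "f \<in> borel_measurable (sample I)"
    and le: "\<And>x. (\<integral>\<^sup>+y. f (x(k := y)) \<partial>N) \<le> K"
  shows "(\<integral>\<^sup>+z. f z \<partial>sample I) \<le> K * emeasure (sample (I - {k})) (space (sample (I - {k})))"
proof -
  have I: "insert k (I - {k}) = I" using assms by auto
  have "(\<integral>\<^sup>+z. f z \<partial>sample I) = (\<integral>\<^sup>+x. (\<integral>\<^sup>+y. f (x(k := y)) \<partial>N) \<partial>sample (I - {k}))"
    using product_nn_integral_insert[of "I - {k}" k f, unfolded I] assms by simp
  also have "\<dots> \<le> (\<integral>\<^sup>+x. K \<partial>sample (I - {k}))" by (intro nn_integral_mono le)
  finally show ?thesis by simp
qed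

lemma nn_integral_sample_coord_finite:
  assumes "finite I" "k \<in> I" and f: "f \<in> borel_measurable (sample I)"
    and le: "\<And>x. (\<integral>\<^sup>+y. f (x(k := y)) \<partial>N) \<le> ennreal K"
  shows "(\<integral>\<^sup>+z. f z \<partial>sample I) < \<infinity>"
proof -
  interpret F: finite_measure "sample (I - {k})" by (rule finite_measure_sample) (use assms in simp)
  from nn_integral_sample_coord_le[OF assms] show ?thesis
  proof (rule order_le_less_trans)
    show "ennreal K * emeasure (sample (I - {k})) (space (sample (I - {k}))) < \<infinity>"
      using F.emeasure_finite[of "space (sample (I - {k}))"] by (simp add: ennreal_mult_eq_top_iff less_top[symmetric])
  qed
qed

lemma integral_sample_coord:
  fixes f :: "_ \<Rightarrow> real"
  assumes "finite I" "k \<in> I" "integrable (sample I) f" and "\<And>x. (\<integral>y. f (x(k := y)) \<partial>N) = 0"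
  shows "(\<integral>z. f z \<partial>sample I) = 0"
  using product_integral_insert[of "I - {k}" k f] assms by (simp add: insert_absorb)

lemma integrable_norm_sq_coord:
  assumes "finite I" "k \<in> I" shows "integrable (sample I) (\<lambda>z. (norm (z k))\<^sup>2)"
proof (rule integrableI_bounded)
  have "integrable lborel (\<lambda>z. dens z * (norm z)\<^sup>2)" by (rule integrable_dens_bound[of _ 1]) auto
  then have "integrable N (\<lambda>z. (norm z)\<^sup>2)"
    unfolding N_def using dens_pos by (subst integrable_density) (auto simp: less_imp_le)
  then have "(\<integral>\<^sup>+z. ennreal (norm ((norm z)\<^sup>2)) \<partial>N) = ennreal (\<integral>z. (norm z)\<^sup>2 \<partial>N)"
    by (subst nn_integral_eq_integral) auto
  then show "(\<integral>\<^sup>+z. ennreal (norm ((norm (z k))\<^sup>2)) \<partial>sample I) < \<infinity>"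
    using assms by (intro nn_integral_sample_coord_finite[OF assms]) auto
qed (use assms in simp)

end

section \<open>The log-determinant of a Wishart matrix has finite expectation\<close>

abbreviation scatter :: "(nat \<Rightarrow> real^'p) \<Rightarrow> nat \<Rightarrow> real^'p^'p" where
  "scatter z n \<equiv> (\<Sum>k<n. outer (z k))"

lemma scatter_quad: "x \<bullet> (scatter z n *v x) = (\<Sum>k<n. (z k \<bullet> x)\<^sup>2)"
  by (simp add: sum_matrix_vec outer_mult_vec inner_sum_right power2_eq_square inner_commute)

lemma psd_scatter: "psd (scatter z n)"
  by (intro psd_sum psd_outer)

lemma pd_scatter:
  assumes "0 < det (scatter z n)"
  shows "pos_def_matrix (scatter z n)"
  unfolding pos_def_matrix_def
proof (intro conjI allI impI)
  show "transpose (scatter z n) = scatter z n" by (rule psdD[OF psd_scatter])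
  fix x :: "real^'a" assume "x \<noteq> 0"
  show "0 < x \<bullet> (scatter z n *v x)"
  proof (rule ccontr)
    assume "\<not> ?thesis"
    then have "(\<Sum>k<n. (z k \<bullet> x)\<^sup>2) = 0"
      using psdD(1)[OF psd_scatter, of x z n] by (simp add: scatter_quad)
    then have "\<forall>k<n. z k \<bullet> x = 0" by (simp add: sum_nonneg_eq_0_iff)
    then have "scatter z n *v x = 0" by (simp add: sum_matrix_vec outer_mult_vec)
    moreover have "inj ((*v) (scatter z n))" using assms by (simp add: inj_matrix_vector_mult invertible_det_nz)
    ultimately show False using \<open>x \<noteq> 0\<close> by (metis injD matrix_vector_mult_0_right)
  qed
qed

text \<open>The value \<open>\<infinity>\<close> for \<open>d \<le> 0\<close> makes finiteness of an integral of \<open>neg_ln\<close> include the statement that \<open>d\<close> is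
  positive almost everywhere.\<close>

definition neg_ln :: "real \<Rightarrow> ennreal" where
  "neg_ln d = (if d \<le> 0 then \<infinity> else ennreal (- ln d))"

lemma measurable_neg_ln [measurable]: "neg_ln \<in> borel_measurable borel"
  unfolding neg_ln_def by measurable

lemma neg_ln_le_liminf:
  fixes d :: "nat \<Rightarrow> real"
  assumes "d \<longlonglongrightarrow> l" "\<And>i. 0 < d i"
  shows "neg_ln l \<le> liminf (\<lambda>i. ennreal (- ln (d i)))"
proof (cases "0 < l")
  case True
  then have "(\<lambda>i. ennreal (- ln (d i))) \<longlonglongrightarrow> ennreal (- ln l)"
    by (intro tendsto_ennrealI tendsto_intros assms) auto
  then have "liminf (\<lambda>i. ennreal (- ln (d i))) = ennreal (- ln l)" by (intro lim_imp_Liminf) auto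
  then show ?thesis using True by (simp add: neg_ln_def)
next
  case False
  have "0 \<le> l" using assms by (intro LIMSEQ_le_const) (auto intro: less_imp_le)
  with False have "l = 0" by simp
  then have lim: "filterlim d (at_right 0) sequentially"
    using assms by (auto simp: filterlim_at less_imp_neq[symmetric])
  have "ennreal r \<le> liminf (\<lambda>i. ennreal (- ln (d i)))" for r
  proof (rule Liminf_bounded)
    have "filterlim (\<lambda>i. ln (d i)) at_bot sequentially"
      by (rule filterlim_compose[OF ln_at_0 lim])
    then have "\<forall>\<^sub>F i in sequentially. ln (d i) \<le> - r" by (simp add: filterlim_at_bot)
    then show "\<forall>\<^sub>F i in sequentially. ennreal r \<le> ennreal (- ln (d i))"
      by eventually_elim (simp add: ennreal_leI)
  qed
  then have "\<exists>r\<ge>0. liminf (\<lambda>i. ennreal (- ln (d i))) = ennreal r \<Longrightarrow> False"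
    by (metis ennreal_le_iff less_add_one not_le)
  then have "liminf (\<lambda>i. ennreal (- ln (d i))) = \<infinity>"
    by (metis ennreal_cases infinity_ennreal_def)
  then show ?thesis by simp
qed

context gaussian
begin

lemma measurable_scatter [measurable]:
  "k \<le> n \<Longrightarrow> (\<lambda>z. scatter z k) \<in> borel_measurable (sample {..<n})"
  by (intro borel_measurable_sum borel_measurable_outer measurable_sample_component) auto

text \<open>Build \<open>\<epsilon> I + S\<close> by adding the vectors \<open>z k\<close> one at a time. While \<open>k < p\<close> there is a unit vector \<open>u\<close>
  orthogonal to the previous ones, and along \<open>u\<close> the current matrix is \<open>\<epsilon>\<close>; hence the step multiplies the
  determinant by at least \<open>(u \<bullet> z k)\<^sup>2 / \<epsilon>\<close>. The \<open>p\<close> factors \<open>1 / \<epsilon>\<close> cancel the initial determinant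
  \<open>\<epsilon>\<^sup>p\<close>, the later steps only increase the determinant, and the remaining factors are controlled by
  \<open>nn_integral_log_kernel_le\<close> uniformly in \<open>\<epsilon>\<close>. Fatou's lemma lets \<open>\<epsilon>\<close> tend to \<open>0\<close>.\<close>

lemma nn_integral_neg_ln_det_scatter:
  assumes "CARD('p) \<le> n"
  shows "(\<integral>\<^sup>+z. neg_ln (det (scatter z n)) \<partial>sample {..<n}) < \<infinity>"
proof -
  let ?p = "CARD('p)"
  let ?W = "\<lambda>\<epsilon> z k. \<epsilon> *\<^sub>R mat 1 + scatter z k :: real^'p^'p"
  let ?t = "\<lambda>\<epsilon> k z. - ln (\<epsilon> * (det (?W \<epsilon> z (Suc k)) / det (?W \<epsilon> z k)))"
  have W: "pos_def_matrix (?W \<epsilon> z k)" if "0 < \<epsilon>" for \<epsilon> z k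
    by (intro pd_add_psd pd_scaleR pd_mat_1 that psd_scatter)
  have ratio: "det (?W \<epsilon> z (Suc k)) / det (?W \<epsilon> z k) = 1 + z k \<bullet> (matrix_inv (?W \<epsilon> z k) *v z k)" if "0 < \<epsilon>" for \<epsilon> z k
  proof -
    have eq: "?W \<epsilon> z (Suc k) = ?W \<epsilon> z k + outer (z k)" by (simp only: sum.lessThan_Suc add.assoc)
    show ?thesis unfolding eq det_add_outer[OF W[OF that]] using pd_det_pos[OF W[OF that], of z k] by simp
  qed
  have mW: "(\<lambda>z. ?W \<epsilon> z k) \<in> borel_measurable (sample {..<n})" if "k \<le> n" for \<epsilon> k
    by (intro borel_measurable_add borel_measurable_const measurable_scatter that)
  have mt: "(\<lambda>z. ennreal (?t \<epsilon> k z)) \<in> borel_measurable (sample {..<n})" if "k < n" for \<epsilon> k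
    using that by (intro measurable_compose[OF _ measurable_ennreal] borel_measurable_uminus borel_measurable_ln
      borel_measurable_times borel_measurable_divide borel_measurable_const borel_measurable_det mW) auto
  obtain K where K: "0 \<le> K" "\<forall>u. norm u = 1 \<longrightarrow> (\<integral>\<^sup>+z. log_kernel (u \<bullet> z) \<partial>N) \<le> ennreal K"
    by (rule nn_integral_log_kernel_le)
  have step: "(\<integral>\<^sup>+z. ennreal (?t \<epsilon> k z) \<partial>sample {..<n}) \<le> ennreal K * emeasure (sample ({..<n} - {k})) (space (sample ({..<n} - {k})))"
    if \<epsilon>: "0 < \<epsilon>" and k: "k < ?p" for \<epsilon> k
  proof (rule nn_integral_sample_coord_le)
    show "(\<lambda>z. ennreal (?t \<epsilon> k z)) \<in> borel_measurable (sample {..<n})"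
      by (rule mt) (use k assms in simp)
    fix x :: "nat \<Rightarrow> real^'p"
    \<comment> \<open>fewer than \<open>p\<close> vectors leave room for an orthogonal unit vector\<close>
    have "dim (x ` {..<k}) < DIM(real^'p)"
      using dim_le_card'[of "x ` {..<k}"] card_image_le[of "{..<k}" x] k by simp
    then obtain v where v: "v \<noteq> 0" "\<And>y. y \<in> span (x ` {..<k}) \<Longrightarrow> orthogonal v y"
      by (rule orthogonal_to_subspace_exists) blast
    define u where "u = v /\<^sub>R norm v"
    have u: "norm u = 1" "u \<noteq> 0" using v(1) by (auto simp: u_def)
    have orth: "x j \<bullet> u = 0" if "j < k" for j
      using v(2)[of "x j"] that by (auto simp: u_def orthogonal_def inner_commute span_base)
    have Wu: "u \<bullet> (?W \<epsilon> x k *v u) = \<epsilon>"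
      using u(1) by (simp add: matrix_vector_mult_add_rdistrib inner_add_right scatter_quad orth norm_eq_1 flip: scaleR_matrix_vector_assoc)
    have "ennreal (?t \<epsilon> k (x(k := y))) \<le> log_kernel (u \<bullet> y)" for y
    proof (cases "u \<bullet> y = 0")
      case False
      have eq: "scatter (x(k := y)) k = scatter x k" by (intro sum.cong) auto
      have "(u \<bullet> y)\<^sup>2 \<le> \<epsilon> * (y \<bullet> (matrix_inv (?W \<epsilon> x k) *v y))"
        using inner_sq_le_quad_inv[OF W[OF \<epsilon>] u(2), of y x k] by (simp add: Wu)
      also have "\<dots> \<le> \<epsilon> * (1 + y \<bullet> (matrix_inv (?W \<epsilon> x k) *v y))" using \<epsilon> by simp
      also have "\<dots> = \<epsilon> * (det (?W \<epsilon> (x(k := y)) (Suc k)) / det (?W \<epsilon> (x(k := y)) k))"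
        unfolding ratio[OF \<epsilon>] unfolding eq by simp
      finally have "ln ((u \<bullet> y)\<^sup>2) \<le> ln (\<epsilon> * (det (?W \<epsilon> (x(k := y)) (Suc k)) / det (?W \<epsilon> (x(k := y)) k)))"
        using False by (intro ln_mono) auto
      then have "ennreal (?t \<epsilon> k (x(k := y))) \<le> ennreal (- ln ((u \<bullet> y)\<^sup>2))"
        by (intro ennreal_leI) simp
      also have "\<dots> \<le> log_kernel (u \<bullet> y)" by (rule neg_ln_sq_le)
      finally show ?thesis .
    qed (simp add: log_kernel_def)
    then have "(\<integral>\<^sup>+y. ennreal (?t \<epsilon> k (x(k := y))) \<partial>N) \<le> (\<integral>\<^sup>+y. log_kernel (u \<bullet> y) \<partial>N)"
      by (intro nn_integral_mono)
    also have "\<dots> \<le> ennreal K" using K(2) u(1) by blast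
    finally show "(\<integral>\<^sup>+y. ennreal (?t \<epsilon> k (x(k := y))) \<partial>N) \<le> ennreal K" .
  qed (use k assms in auto)
  define C where "C = (\<Sum>k<?p. ennreal K * emeasure (sample ({..<n} - {k})) (space (sample ({..<n} - {k}))))"
  have C: "C < \<infinity>"
  proof -
    have "emeasure (sample ({..<n} - {k})) (space (sample ({..<n} - {k}))) < \<infinity>" for k
      using finite_measure.emeasure_finite[OF finite_measure_sample] by (simp add: less_top[symmetric])
    then show ?thesis unfolding C_def by (auto simp: ennreal_mult_less_top)
  qed
  \<comment> \<open>telescoping; the factors with index at least \<open>p\<close> are at least \<open>1\<close> and are dropped\<close>
  have logdet: "- ln (det (?W \<epsilon> z n)) \<le> (\<Sum>k<?p. ?t \<epsilon> k z)" if \<epsilon>: "0 < \<epsilon>" for \<epsilon> z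
  proof -
    let ?r = "\<lambda>k. det (?W \<epsilon> z (Suc k)) / det (?W \<epsilon> z k)"
    have r: "1 \<le> ?r k" for k using quad_inv_nonneg[OF W[OF \<epsilon>], of "z k" z k] unfolding ratio[OF \<epsilon>] by linarith
    have "ln (det (?W \<epsilon> z k)) = ln (det (?W \<epsilon> z 0)) + (\<Sum>j<k. ln (?r j))" for k
    proof (induction k)
      case (Suc k)
      have "ln (?r k) = ln (det (?W \<epsilon> z (Suc k))) - ln (det (?W \<epsilon> z k))"
        using pd_det_pos[OF W[OF \<epsilon>], of z k] pd_det_pos[OF W[OF \<epsilon>], of z "Suc k"]
        by (simp add: ln_div del: sum.lessThan_Suc)
      moreover have "(\<Sum>j<Suc k. ln (?r j)) = (\<Sum>j<k. ln (?r j)) + ln (?r k)" by (rule sum.lessThan_Suc)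
      ultimately show ?case using Suc.IH by linarith
    qed simp
    from this[of n] have "ln (det (?W \<epsilon> z n)) = ln (det (?W \<epsilon> z 0)) + (\<Sum>j<n. ln (?r j))" .
    moreover have "(\<Sum>j<?p. ln (?r j)) \<le> (\<Sum>j<n. ln (?r j))"
      by (rule sum_mono2) (use assms r in \<open>auto simp del: sum.lessThan_Suc intro!: ln_ge_zero\<close>)
    moreover have "ln (det (?W \<epsilon> z 0)) = (\<Sum>j<?p. ln \<epsilon>)"
    proof -
      have "det (?W \<epsilon> z 0) = (\<Prod>i\<in>(UNIV :: 'p set). \<epsilon>)"
        by (subst det_diagonal) (auto simp: mat_def)
      then show ?thesis using \<epsilon> by (simp add: ln_realpow)
    qed
    moreover have "(\<Sum>j<?p. ln \<epsilon>) + (\<Sum>j<?p. ln (?r j)) = - (\<Sum>k<?p. ?t \<epsilon> k z)"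
    proof -
      have "ln (\<epsilon> * ?r k) = ln \<epsilon> + ln (?r k)" for k
        by (rule ln_mult_pos[OF \<epsilon> order_less_le_trans[OF zero_less_one r]])
      then show ?thesis by (simp only: sum_negf sum.distrib minus_minus)
    qed
    ultimately show ?thesis by linarith
  qed
  have bound: "(\<integral>\<^sup>+z. ennreal (- ln (det (?W \<epsilon> z n))) \<partial>sample {..<n}) \<le> C" if \<epsilon>: "0 < \<epsilon>" for \<epsilon>
  proof -
    have "(\<integral>\<^sup>+z. ennreal (- ln (det (?W \<epsilon> z n))) \<partial>sample {..<n}) \<le> (\<integral>\<^sup>+z. (\<Sum>k<?p. ennreal (?t \<epsilon> k z)) \<partial>sample {..<n})"
    proof (rule nn_integral_mono)
      fix z
      have "(\<Sum>k<?p. ?t \<epsilon> k z) \<le> (\<Sum>k<?p. max 0 (?t \<epsilon> k z))" by (intro sum_mono) auto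
      then have "ennreal (- ln (det (?W \<epsilon> z n))) \<le> ennreal (\<Sum>k<?p. max 0 (?t \<epsilon> k z))"
        using logdet[OF \<epsilon>, of z] by (intro ennreal_leI) linarith
      also have "\<dots> = (\<Sum>k<?p. ennreal (max 0 (?t \<epsilon> k z)))" by (rule sum_ennreal[symmetric]) auto
      also have "\<dots> = (\<Sum>k<?p. ennreal (?t \<epsilon> k z))" by (simp only: ennreal_max_0)
      finally show "ennreal (- ln (det (?W \<epsilon> z n))) \<le> (\<Sum>k<?p. ennreal (?t \<epsilon> k z))" .
    qed
    also have "\<dots> = (\<Sum>k<?p. \<integral>\<^sup>+z. ennreal (?t \<epsilon> k z) \<partial>sample {..<n})"
      by (rule nn_integral_sum) (rule mt, use assms in simp)
    also have "\<dots> \<le> C" unfolding C_def using step[OF \<epsilon>] by (intro sum_mono) auto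
    finally show ?thesis .
  qed
  let ?e = "\<lambda>i. 1 / real (Suc i)"
  have "(\<integral>\<^sup>+z. neg_ln (det (scatter z n)) \<partial>sample {..<n}) \<le> (\<integral>\<^sup>+z. liminf (\<lambda>i. ennreal (- ln (det (?W (?e i) z n)))) \<partial>sample {..<n})"
  proof (intro nn_integral_mono neg_ln_le_liminf)
    fix z :: "nat \<Rightarrow> real^'p"
    have "isCont (\<lambda>\<epsilon>. det (?W \<epsilon> z n)) 0"
      by (rule continuous_on_interior[of UNIV]) (auto intro!: continuous_intros)
    moreover have "?e \<longlonglongrightarrow> 0" using LIMSEQ_inverse_real_of_nat by (simp add: inverse_eq_divide)
    ultimately have "(\<lambda>i. det (?W (?e i) z n)) \<longlonglongrightarrow> det (?W 0 z n)"
      by (rule isCont_tendsto_compose)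
    then show "(\<lambda>i. det (?W (?e i) z n)) \<longlonglongrightarrow> det (scatter z n)" by simp
    show "0 < det (?W (?e i) z n)" for i by (rule pd_det_pos[OF W]) simp
  qed
  also have "\<dots> \<le> liminf (\<lambda>i. \<integral>\<^sup>+z. ennreal (- ln (det (?W (?e i) z n))) \<partial>sample {..<n})"
    by (rule nn_integral_liminf) (intro measurable_compose[OF _ measurable_ennreal] borel_measurable_uminus borel_measurable_ln borel_measurable_det mW order_refl)
  also have "\<dots> \<le> liminf (\<lambda>i. C)" by (intro Liminf_mono always_eventually allI bound) simp
  also have "\<dots> = C" by (simp add: Liminf_const)
  also note C
  finally show ?thesis .
qed

lemma AE_pd_scatter:
  assumes "CARD('p) \<le> n"
  shows "AE z in sample {..<n}. pos_def_matrix (scatter z n)"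
proof -
  have "AE z in sample {..<n}. neg_ln (det (scatter z n)) \<noteq> \<infinity>"
    by (rule nn_integral_PInf_AE) (use nn_integral_neg_ln_det_scatter[OF assms] in auto)
  then show ?thesis
    by eventually_elim (rule pd_scatter, simp add: neg_ln_def split: if_splits)
qed

end

section \<open>The expected trace of the correction term\<close>

lemma inv_vec_norm_le:
  assumes W: "pos_def_matrix W" and le: "\<And>y. \<epsilon> * (y \<bullet> y) \<le> y \<bullet> (W *v y)"
  shows "\<epsilon> * norm (matrix_inv W *v z) \<le> norm z"
proof (cases "matrix_inv W *v z = 0")
  case False
  let ?y = "matrix_inv W *v z"
  have "\<epsilon> * (norm ?y)\<^sup>2 \<le> z \<bullet> ?y"
    using le[of ?y] by (simp add: matrix_inv_vec[OF W] inner_commute power2_norm_eq_inner)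
  also have "\<dots> \<le> norm z * norm ?y" by (rule norm_cauchy_schwarz)
  finally have "(\<epsilon> * norm ?y) * norm ?y \<le> norm z * norm ?y" by (simp add: power2_eq_square mult_ac)
  then show ?thesis using False by simp
qed simp

text \<open>Serves to integrate the Stein term over the sample: everything except the last summand is bounded, and the
  last one grows quadratically because \<open>W \<ge> \<epsilon> I\<close>.\<close>

lemma stein_term_bound:
  fixes W P :: "real^'p^'p" and X :: "real^'p^'m"
  defines "Q \<equiv> transpose X ** X"
  assumes W: "pos_def_matrix W" and "0 < \<beta>" "0 < \<epsilon>"
    and le: "\<And>y. \<beta> * (y \<bullet> (Q *v y)) + \<epsilon> * (y \<bullet> y) + (z \<bullet> y)\<^sup>2 \<le> y \<bullet> (W *v y)"
    and KQ: "\<And>y. norm (Q *v y) \<le> KQ * norm y" and KP: "\<And>y. norm (P *v y) \<le> KP * norm y" 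
    and K: "0 < KQ" "0 < KP"
  shows "\<bar>stein_term P Q W z\<bar> \<le> (real CARD('m) + 1) / \<beta> + KQ * KP / \<epsilon> * (norm z)\<^sup>2"
proof -
  let ?M = "matrix_inv W"
  let ?y = "?M *v z"
  have Q0: "0 \<le> y \<bullet> (Q *v y)" for y by (simp add: Q_def gram_quad sum_nonneg)
  have leQ: "\<beta> * (y \<bullet> (Q *v y)) \<le> y \<bullet> (W *v y)" for y
    using le[of y] mult_nonneg_nonneg[OF less_imp_le[OF \<open>0 < \<epsilon>\<close>] inner_ge_zero[of y]] zero_le_power2[of "z \<bullet> y"] by linarith
  have lez: "1 * (z \<bullet> y)\<^sup>2 \<le> y \<bullet> (W *v y)" for y
    using le[of y] mult_nonneg_nonneg[OF less_imp_le[OF \<open>0 < \<epsilon>\<close>] inner_ge_zero[of y]]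
      mult_nonneg_nonneg[OF less_imp_le[OF \<open>0 < \<beta>\<close>] Q0[of y]] by linarith
  have le\<epsilon>: "\<epsilon> * (y \<bullet> y) \<le> y \<bullet> (W *v y)" for y
    using le[of y] mult_nonneg_nonneg[OF less_imp_le[OF \<open>0 < \<beta>\<close>] Q0[of y]] zero_le_power2[of "z \<bullet> y"] by linarith
  have T: "0 \<le> trace (Q ** ?M)" "trace (Q ** ?M) \<le> real CARD('m) / \<beta>"
    using trace_gram_inv_le(1)[OF W leQ[unfolded Q_def] \<open>0 < \<beta>\<close>] \<open>0 < \<beta>\<close> 
    by (auto simp: Q_def trace_gram_mult field_simps intro!: sum_nonneg quad_inv_nonneg W)
  have q: "0 \<le> z \<bullet> ?y" "z \<bullet> ?y \<le> 1"
    using quad_inv_nonneg[OF W] quad_inv_le_one[OF W lez] by auto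
  have "\<beta> * (?y \<bullet> (Q *v ?y)) \<le> z \<bullet> ?y"
    using leQ[of ?y] by (simp add: matrix_inv_vec[OF W] inner_commute)
  then have r: "0 \<le> ?y \<bullet> (Q *v ?y)" "?y \<bullet> (Q *v ?y) \<le> 1 / \<beta>"
    using Q0 q \<open>0 < \<beta>\<close> by (auto simp: field_simps)
  have s: "\<bar>(Q *v ?y) \<bullet> (P *v z)\<bar> \<le> KQ * KP / \<epsilon> * (norm z)\<^sup>2"
  proof -
    have "norm ?y \<le> norm z / \<epsilon>"
      using inv_vec_norm_le[OF W le\<epsilon>, of z] \<open>0 < \<epsilon>\<close> by (simp add: field_simps)
    then have "norm (Q *v ?y) \<le> KQ * (norm z / \<epsilon>)"
      using KQ[of ?y] K by (meson mult_left_mono less_imp_le order_trans)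
    then have "norm (Q *v ?y) * norm (P *v z) \<le> (KQ * (norm z / \<epsilon>)) * (KP * norm z)"
      using KP[of z] K \<open>0 < \<epsilon>\<close> by (intro mult_mono) auto
    then show ?thesis using Cauchy_Schwarz_ineq2[of "Q *v ?y" "P *v z"] by (simp add: power2_eq_square mult_ac)
  qed
  have t1: "0 \<le> trace (Q ** ?M) * (1 - z \<bullet> ?y)" "trace (Q ** ?M) * (1 - z \<bullet> ?y) \<le> real CARD('m) / \<beta>"
  proof -
    have "trace (Q ** ?M) * (1 - z \<bullet> ?y) \<le> trace (Q ** ?M) * 1" using q T by (intro mult_left_mono) auto
    with T show "trace (Q ** ?M) * (1 - z \<bullet> ?y) \<le> real CARD('m) / \<beta>" by simp
  qed (use q T in auto)
  have "(real CARD('m) + 1) / \<beta> = real CARD('m) / \<beta> + 1 / \<beta>" by (simp add: add_divide_distrib)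
  then show ?thesis unfolding stein_term_def using t1 r s by linarith
qed

text \<open>The sum over \<open>k\<close> of the terms in Stein's identity consists of traces of \<open>M S\<close>, \<open>M Q M S\<close> and
  \<open>P Q M S\<close>, where \<open>M = W\<^sup>-\<^sup>1\<close>. Substituting \<open>M S = I - \<beta> M Q - \<epsilon> M\<close> and using the two bounds
  of \<open>trace_gram_inv_le\<close> produces the factor \<open>n - p + m\<close>. All errors caused by \<open>\<epsilon>\<close> are collected in one
  multiple of \<open>\<epsilon> tr M\<close>.\<close>

lemma stein_pointwise:
  fixes P :: "real^'p^'p" and X :: "real^'p^'m" and z :: "nat \<Rightarrow> real^'p"
  assumes P: "pos_def_matrix P" and S: "pos_def_matrix (scatter z n)" and "0 < \<beta>" "0 < \<epsilon>"
  defines "Q \<equiv> transpose X ** X"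
  defines "W \<equiv> \<epsilon> *\<^sub>R mat 1 + \<beta> *\<^sub>R Q + scatter z n"
  defines "K \<equiv> 2 * real CARD('m) / \<beta> + (\<Sum>i\<in>UNIV. ((X $ i) \<bullet> (X $ i) + (P *v X $ i) \<bullet> (P *v X $ i)) / 2)"
  assumes "CARD('p) \<le> n"
  shows "trace (P ** correction \<beta> X (scatter z n)) \<le>
     (real n - real CARD('p) + real CARD('m)) * trace (Q ** matrix_inv (scatter z n + \<beta> *\<^sub>R Q))
     + K * (\<epsilon> * trace (matrix_inv W)) - (\<Sum>k<n. stein_term P Q W (z k))"
proof -
  let ?S = "scatter z n"
  let ?M = "matrix_inv W"
  let ?T = "trace (Q ** ?M)"
  have Qpsd: "psd Q" unfolding Q_def by (rule psd_gram)
  have W: "pos_def_matrix W"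
    unfolding W_def by (intro pd_add_psd pd_scaleR pd_mat_1 psd_scaleR Qpsd psd_scatter) (use assms in auto)
  have S\<epsilon>: "pos_def_matrix (?S + \<epsilon> *\<^sub>R mat 1)"
    by (intro pd_add_psd S psd_scaleR pd_imp_psd pd_mat_1) (use assms in auto)
  have W0: "pos_def_matrix (?S + \<beta> *\<^sub>R Q)"
    by (intro pd_add_psd S psd_scaleR Qpsd) (use assms in auto)
  have Wx: "x \<bullet> (W *v x) = \<epsilon> * (x \<bullet> x) + \<beta> * (x \<bullet> (Q *v x)) + x \<bullet> (?S *v x)" for x
    by (simp add: W_def matrix_vector_mult_add_rdistrib inner_add_right flip: scaleR_matrix_vector_assoc)
  have leQ: "\<beta> * (x \<bullet> (Q *v x)) \<le> x \<bullet> (W *v x)" for x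
    unfolding Wx using psdD(1)[OF psd_scatter, of x z n] \<open>0 < \<epsilon>\<close> by simp
  have M: "pos_def_matrix ?M" by (rule pd_matrix_inv[OF W])
  have trM: "0 \<le> trace ?M"
    unfolding trace_def using pd_diag_pos[OF M] by (intro sum_nonneg) (auto simp: less_imp_le)
  have T0: "0 \<le> ?T" by (auto simp: Q_def trace_gram_mult intro!: sum_nonneg quad_inv_nonneg W)
  note tr = trace_gram_inv_le[OF W leQ[unfolded Q_def] \<open>0 < \<beta>\<close>, folded Q_def]
  have MW: "?M ** W = mat 1" by (rule matrix_inv_left[OF pd_invertible[OF W]])
  have MS: "?M ** ?S = mat 1 + (- \<beta>) *\<^sub>R (?M ** Q) + (- \<epsilon>) *\<^sub>R ?M"
  proof -
    have "?S = W + (- \<beta>) *\<^sub>R Q + (- \<epsilon>) *\<^sub>R mat 1" by (simp add: W_def)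
    then have "?M ** ?S = ?M ** (W + (- \<beta>) *\<^sub>R Q + (- \<epsilon>) *\<^sub>R mat 1)" by (rule arg_cong)
    then show ?thesis by (simp only: matrix_add_ldistrib MW matrix_mult_scaleR_right matrix_mul_rid)
  qed
  have s1: "(\<Sum>k<n. z k \<bullet> (?M *v z k)) = real CARD('p) - \<beta> * ?T - \<epsilon> * trace ?M"
  proof -
    have "(\<Sum>k<n. z k \<bullet> (?M *v z k)) = trace (?M ** ?S)" by (rule trace_mult_sum_outer[symmetric])
    also have "\<dots> = real CARD('p) - \<beta> * trace (?M ** Q) - \<epsilon> * trace ?M"
      unfolding MS by (simp only: trace_add trace_scaleR trace_I)
    finally show ?thesis by (simp only: trace_mul_sym[of ?M Q])
  qed
  have s2: "(\<Sum>k<n. (?M *v z k) \<bullet> (Q *v (?M *v z k))) = ?T - \<beta> * trace (Q ** ?M ** Q ** ?M) - \<epsilon> * trace (?M ** Q ** ?M)"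
  proof -
    have "(?M *v z k) \<bullet> (Q *v (?M *v z k)) = z k \<bullet> ((?M ** Q ** ?M) *v z k)" for k
      by (simp add: pd_inv_sym[OF W, symmetric] matrix_vector_mul_assoc matrix_mul_assoc)
    then have "(\<Sum>k<n. (?M *v z k) \<bullet> (Q *v (?M *v z k))) = trace (?M ** Q ** ?M ** ?S)"
      by (simp only: trace_mult_sum_outer)
    also have "\<dots> = trace (?M ** Q ** (?M ** ?S))" by (simp only: matrix_mul_assoc)
    also have "\<dots> = trace (?M ** Q) + (- \<beta>) * trace (?M ** Q ** (?M ** Q)) + (- \<epsilon>) * trace (?M ** Q ** ?M)"
      unfolding MS by (simp only: matrix_add_ldistrib matrix_mult_scaleR_right matrix_mul_rid trace_add trace_scaleR)
    also have "trace (?M ** Q) = ?T" by (rule trace_mul_sym)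
    also have "trace (?M ** Q ** (?M ** Q)) = trace (Q ** ?M ** Q ** ?M)"
      by (metis matrix_mul_assoc trace_mul_sym)
    finally show ?thesis by simp
  qed
  have s3: "(\<Sum>k<n. (Q *v (?M *v z k)) \<bullet> (P *v z k)) = trace (P ** Q ** ?M ** ?S)"
  proof -
    have "(Q *v (?M *v z k)) \<bullet> (P *v z k) = z k \<bullet> ((P ** Q ** ?M) *v z k)" for k
      using symmetric_inner[OF pdD(2)[OF P], of "z k"] by (simp add: matrix_vector_mul_assoc[symmetric] inner_commute)
    then show ?thesis by (simp only: trace_mult_sum_outer)
  qed
  have sum: "(\<Sum>k<n. stein_term P Q W (z k)) = ?T * (real n - (\<Sum>k<n. z k \<bullet> (?M *v z k)))
      - (\<Sum>k<n. (?M *v z k) \<bullet> (Q *v (?M *v z k))) - (\<Sum>k<n. (Q *v (?M *v z k)) \<bullet> (P *v z k))"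
    by (simp add: stein_term_def sum_subtractf sum_distrib_left[symmetric])
  \<comment> \<open>replacing \<open>S\<close> by \<open>S + \<epsilon> I\<close> only increases the correction, which permits comparison with \<open>M\<close>\<close>
  have trace_H: "trace (P ** correction \<beta> X ?S) \<le> trace (P ** Q ** ?M ** ?S) + \<epsilon> * trace (P ** Q ** ?M)"
  proof -
    have "trace (P ** correction \<beta> X ?S) \<le> trace (P ** correction \<beta> X (?S + \<epsilon> *\<^sub>R mat 1))"
    proof (intro trace_mult_pd_mono[OF P] correction_mono[OF S S\<epsilon> \<open>0 < \<beta>\<close>])
      fix x :: "real^'p"
      show "x \<bullet> (?S *v x) \<le> x \<bullet> ((?S + \<epsilon> *\<^sub>R mat 1) *v x)" using \<open>0 < \<epsilon>\<close>
        by (simp add: matrix_vector_mult_add_rdistrib inner_add_right flip: scaleR_matrix_vector_assoc)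
    qed
    also have "correction \<beta> X (?S + \<epsilon> *\<^sub>R mat 1) = Q ** ?M ** (?S + \<epsilon> *\<^sub>R mat 1)"
      unfolding correction_eq[OF S\<epsilon> \<open>0 < \<beta>\<close>] Q_def[symmetric] W_def by (simp add: add_ac)
    also have "trace (P ** \<dots>) = trace (P ** Q ** ?M ** ?S) + \<epsilon> * trace (P ** Q ** ?M)"
      by (simp only: matrix_add_ldistrib matrix_mult_scaleR_right matrix_mul_rid trace_add trace_scaleR matrix_mul_assoc)
    finally show ?thesis .
  qed
  have T_mono: "?T \<le> trace (Q ** matrix_inv (?S + \<beta> *\<^sub>R Q))"
    unfolding Q_def trace_gram_mult unfolding Q_def[symmetric]
  proof (intro sum_mono quad_inv_antimono W W0)
    show "x \<bullet> ((?S + \<beta> *\<^sub>R Q) *v x) \<le> x \<bullet> (W *v x)" for x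
      unfolding Wx using \<open>0 < \<epsilon>\<close>
      by (simp add: matrix_vector_mult_add_rdistrib inner_add_right flip: scaleR_matrix_vector_assoc)
  qed
  \<comment> \<open>\<open>tr (M Q M)\<close> is quadratic in \<open>M\<close>, and one factor is bounded by its trace\<close>
  have r1: "trace (?M ** Q ** ?M) \<le> trace ?M * ?T"
  proof -
    have "trace (?M ** Q ** ?M) = trace (Q ** (?M ** ?M))" by (metis matrix_mul_assoc trace_mul_sym)
    also have "\<dots> = (\<Sum>i\<in>UNIV. (?M *v X $ i) \<bullet> (?M *v X $ i))"
      by (simp add: Q_def trace_gram_mult pd_inv_sym[OF W] flip: matrix_vector_mul_assoc)
    also have "\<dots> \<le> (\<Sum>i\<in>UNIV. trace ?M * (X $ i \<bullet> (?M *v X $ i)))"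
    proof (rule sum_mono)
      fix i
      let ?y = "?M *v X $ i"
      show "?y \<bullet> ?y \<le> trace ?M * (X $ i \<bullet> ?y)"
      proof (cases "?y = 0")
        case False
        have "(?y \<bullet> ?y)\<^sup>2 \<le> (?y \<bullet> (W *v ?y)) * (?y \<bullet> (?M *v ?y))"
          by (rule inner_sq_le_quad_inv[OF W False])
        also have "\<dots> \<le> (X $ i \<bullet> ?y) * (trace ?M * (?y \<bullet> ?y))"
          by (intro mult_mono pd_quad_le_trace M quad_inv_nonneg W) (simp_all add: matrix_inv_vec[OF W] inner_commute)
        finally have "(?y \<bullet> ?y) * (?y \<bullet> ?y) \<le> (trace ?M * (X $ i \<bullet> ?y)) * (?y \<bullet> ?y)"
          by (simp add: power2_eq_square mult_ac)
        then show ?thesis using False by (simp add: mult_le_cancel_right)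
      qed simp
    qed
    finally show ?thesis by (simp add: Q_def trace_gram_mult sum_distrib_left)
  qed
  have r2: "trace (P ** Q ** ?M) \<le> trace ?M * (\<Sum>i\<in>UNIV. ((X $ i) \<bullet> (X $ i) + (P *v X $ i) \<bullet> (P *v X $ i)) / 2)"
  proof -
    have "trace (P ** Q ** ?M) = trace (Q ** (?M ** P))" by (metis matrix_mul_assoc trace_mul_sym)
    also have "\<dots> = (\<Sum>i\<in>UNIV. X $ i \<bullet> (?M *v (P *v X $ i)))"
      by (simp add: Q_def trace_gram_mult flip: matrix_vector_mul_assoc)
    also have "\<dots> \<le> (\<Sum>i\<in>UNIV. trace ?M * (((X $ i) \<bullet> (X $ i) + (P *v X $ i) \<bullet> (P *v X $ i)) / 2))"
    proof (rule sum_mono)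
      fix i
      let ?x = "X $ i" and ?y = "P *v X $ i"
      have "0 \<le> (?x - ?y) \<bullet> (?M *v (?x - ?y))" by (rule quad_inv_nonneg[OF W])
      also have "\<dots> = ?x \<bullet> (?M *v ?x) + ?y \<bullet> (?M *v ?y) - 2 * (?x \<bullet> (?M *v ?y))"
        using pd_inv_sym[OF W, of ?x ?y]
        by (simp add: matrix_vector_mult_diff_distrib inner_diff_left inner_diff_right inner_commute)
      also have "\<dots> \<le> trace ?M * (?x \<bullet> ?x) + trace ?M * (?y \<bullet> ?y) - 2 * (?x \<bullet> (?M *v ?y))"
        by (intro diff_right_mono add_mono pd_quad_le_trace M)
      finally show "?x \<bullet> (?M *v ?y) \<le> trace ?M * ((?x \<bullet> ?x + ?y \<bullet> ?y) / 2)" by (simp add: algebra_simps)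
    qed
    finally show ?thesis by (simp add: sum_distrib_left)
  qed
  let ?K2 = "\<Sum>i\<in>UNIV. ((X $ i) \<bullet> (X $ i) + (P *v X $ i) \<bullet> (P *v X $ i)) / 2"
  have r3: "?T * trace ?M \<le> real CARD('m) / \<beta> * trace ?M"
    using tr(1) \<open>0 < \<beta>\<close> trM by (intro mult_right_mono) (simp_all add: field_simps)
  have err: "?T * trace ?M + trace (?M ** Q ** ?M) + trace (P ** Q ** ?M) \<le> K * trace ?M"
  proof -
    have K: "K = real CARD('m) / \<beta> + real CARD('m) / \<beta> + ?K2" by (simp add: K_def)
    have "K * trace ?M = real CARD('m) / \<beta> * trace ?M + real CARD('m) / \<beta> * trace ?M + ?K2 * trace ?M"
      unfolding K by (simp only: distrib_right)
    moreover have "trace ?M * ?T = ?T * trace ?M" "trace ?M * ?K2 = ?K2 * trace ?M" by (rule mult.commute)+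
    moreover have "x + y + w \<le> k" if "k = c + c + d" "t = x" "d' = d" "y \<le> t" "w \<le> d'" "x \<le> c"
      for c d d' t x y w k :: real using that by linarith
    ultimately show ?thesis using r1 r2 r3 by blast
  qed
  have err': "\<epsilon> * (?T * trace ?M + trace (?M ** Q ** ?M) + trace (P ** Q ** ?M)) \<le> \<epsilon> * (K * trace ?M)"
    by (rule mult_left_mono[OF err]) (use \<open>0 < \<epsilon>\<close> in simp)
  have tt: "?T * (\<beta> * ?T) \<le> ?T * real CARD('m)" by (rule mult_left_mono[OF tr(1) T0])
  have mono: "(real n - real CARD('p) + real CARD('m)) * ?T \<le>
      (real n - real CARD('p) + real CARD('m)) * trace (Q ** matrix_inv (?S + \<beta> *\<^sub>R Q))"
    using T_mono \<open>CARD('p) \<le> n\<close> by (intro mult_left_mono) auto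
  \<comment> \<open>linear once the products are treated as atoms\<close>
  have arith: "h \<le> V + K * (\<epsilon> * \<mu>) - s"
    if "s = t * (n' - (p - \<beta> * t - \<epsilon> * \<mu>)) - (t - \<beta> * q2 - \<epsilon> * d) - a"
      "\<beta> * q2 \<le> t" "h \<le> a + \<epsilon> * b" "\<epsilon> * (t * \<mu> + d + b) \<le> \<epsilon> * (K * \<mu>)" "t * (\<beta> * t) \<le> t * m"
      "(n' - p + m) * t \<le> V" for h V \<mu> s t n' p q2 d a b m :: real
  proof -
    have "s = t * n' - t * p + t * (\<beta> * t) + \<epsilon> * (t * \<mu>) - t + \<beta> * q2 + \<epsilon> * d - a"
      unfolding that(1) by (simp add: algebra_simps)
    moreover have "(n' - p + m) * t = t * n' - t * p + t * m" by (simp add: algebra_simps)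
    moreover have "\<epsilon> * (t * \<mu> + d + b) = \<epsilon> * (t * \<mu>) + \<epsilon> * d + \<epsilon> * b" by (simp add: algebra_simps)
    moreover have "K * (\<epsilon> * \<mu>) = \<epsilon> * (K * \<mu>)" by simp
    ultimately show ?thesis using that(2-6) by linarith
  qed
  show ?thesis by (rule arith[OF sum[unfolded s1 s2 s3] tr(2) trace_H err' tt mono])
qed

context gaussian
begin

text \<open>With all vectors but \<open>z k\<close> fixed, \<open>W\<close> has the form \<open>B + z k (z k)\<^sup>T\<close> with \<open>B \<ge> \<epsilon> I\<close>, so
  \<open>stein_identity\<close> applies to the inner integral.\<close>

lemma stein_term_sample:
  fixes X :: "real^'p^'m"
  assumes "0 < \<beta>" "0 < \<epsilon>" "k < n"
  defines "Q \<equiv> transpose X ** X"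
  defines "W z \<equiv> \<epsilon> *\<^sub>R mat 1 + \<beta> *\<^sub>R Q + scatter z n"
  shows "integrable (sample {..<n}) (\<lambda>z. stein_term P Q (W z) (z k))"
    and "(\<integral>z. stein_term P Q (W z) (z k) \<partial>sample {..<n}) = 0"
proof -
  have Qpsd: "psd Q" unfolding Q_def by (rule psd_gram)
  have pd0: "pos_def_matrix (\<epsilon> *\<^sub>R mat 1 + \<beta> *\<^sub>R Q)"
    by (intro pd_add_psd pd_scaleR pd_mat_1 psd_scaleR Qpsd) (use assms in auto)
  have W: "pos_def_matrix (W z)" for z unfolding W_def by (intro pd_add_psd pd0 psd_scatter)
  obtain KQ where KQ: "0 < KQ" "\<And>x. norm (Q *v x) \<le> KQ * norm x" using norm_matrix_vec_bound[of Q] by blast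
  obtain KP where KP: "0 < KP" "\<And>x. norm (P *v x) \<le> KP * norm x" using norm_matrix_vec_bound[of P] by blast
  have bound: "\<bar>stein_term P Q (W z) (z k)\<bar> \<le> (real CARD('m) + 1) / \<beta> + KQ * KP / \<epsilon> * (norm (z k))\<^sup>2" for z
    unfolding Q_def
  proof (rule stein_term_bound[OF W assms(1,2)])
    fix y :: "real^'p"
    have "(z k \<bullet> y)\<^sup>2 \<le> (\<Sum>j<n. (z j \<bullet> y)\<^sup>2)" by (rule member_le_sum) (use \<open>k < n\<close> in auto)
    then show "\<beta> * (y \<bullet> ((transpose X ** X) *v y)) + \<epsilon> * (y \<bullet> y) + (z k \<bullet> y)\<^sup>2 \<le> y \<bullet> (W z *v y)"
      by (simp add: W_def matrix_vector_mult_add_rdistrib inner_add_right scatter_quad Q_def flip: scaleR_matrix_vector_assoc)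
  qed (use KQ KP in \<open>auto simp: Q_def\<close>)
  have mz: "(\<lambda>z. z k) \<in> borel_measurable (sample {..<n})" using \<open>k < n\<close> by simp
  have mM: "(\<lambda>z. matrix_inv (W z)) \<in> borel_measurable (sample {..<n})"
    unfolding W_def by (intro borel_measurable_matrix_inv borel_measurable_add borel_measurable_const measurable_scatter) simp
  have meas: "(\<lambda>z. stein_term P Q (W z) (z k)) \<in> borel_measurable (sample {..<n})"
    unfolding stein_term_def
    by (intro borel_measurable_diff borel_measurable_times borel_measurable_trace borel_measurable_matrix_mult
        borel_measurable_const borel_measurable_inner borel_measurable_matrix_vec_mult mM mz)
  interpret fin: finite_measure "sample {..<n}" by (rule finite_measure_sample) simp
  show int: "integrable (sample {..<n}) (\<lambda>z. stein_term P Q (W z) (z k))"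
  proof (rule Bochner_Integration.integrable_bound)
    show "integrable (sample {..<n}) (\<lambda>z. (real CARD('m) + 1) / \<beta> + KQ * KP / \<epsilon> * (norm (z k))\<^sup>2)"
      using \<open>k < n\<close> by (intro Bochner_Integration.integrable_add integrable_mult_right integrable_norm_sq_coord) auto
    show "AE z in sample {..<n}. norm (stein_term P Q (W z) (z k)) \<le> norm ((real CARD('m) + 1) / \<beta> + KQ * KP / \<epsilon> * (norm (z k))\<^sup>2)"
      using bound by (intro AE_I2) (auto intro: order_trans[OF _ abs_ge_self])
  qed (rule meas)
  show "(\<integral>z. stein_term P Q (W z) (z k) \<partial>sample {..<n}) = 0"
  proof (rule integral_sample_coord[OF _ _ int])
    fix x :: "nat \<Rightarrow> real^'p"
    let ?B = "\<epsilon> *\<^sub>R mat 1 + \<beta> *\<^sub>R Q + (\<Sum>j\<in>{..<n} - {k}. outer (x j))"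
    have "W (x(k := y)) = ?B + outer y" for y
    proof -
      have "scatter (x(k := y)) n = outer y + (\<Sum>j\<in>{..<n} - {k}. outer ((x(k := y)) j))"
        using \<open>k < n\<close> by (subst sum.remove[of _ k]) auto
      also have "(\<Sum>j\<in>{..<n} - {k}. outer ((x(k := y)) j)) = (\<Sum>j\<in>{..<n} - {k}. outer (x j))"
        by (rule sum.cong) auto
      finally show ?thesis by (simp add: W_def add_ac)
    qed
    moreover have "pos_def_matrix ?B" by (intro pd_add_psd pd0 psd_sum psd_outer)
    ultimately show "(\<integral>y. stein_term P Q (W (x(k := y))) ((x(k := y)) k) \<partial>N) = 0"
      using stein_identity[of ?B Q] by simp
  qed (use \<open>k < n\<close> in auto)
qed

text \<open>Integrating \<open>stein_pointwise\<close> removes the Stein terms. The error term \<open>\<epsilon> tr M\<close> never exceeds \<open>p\<close> and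
  tends to \<open>0\<close> wherever \<open>S\<close> is positive definite, so dominated convergence applies.\<close>

lemma expectation_trace_correction_le:
  fixes X :: "real^'p^'m"
  assumes "0 < \<beta>" and n: "CARD('p) \<le> n"
  defines "Q \<equiv> transpose X ** X"
  defines "T z \<equiv> trace (Q ** matrix_inv (scatter z n + \<beta> *\<^sub>R Q))"
  defines "H z \<equiv> trace (P ** correction \<beta> X (scatter z n))"
  shows "integrable (sample {..<n}) T" and "integrable (sample {..<n}) H"
    and "(\<integral>z. H z \<partial>sample {..<n}) \<le> (real n - real CARD('p) + real CARD('m)) * (\<integral>z. T z \<partial>sample {..<n})"
proof -
  interpret fin: finite_measure "sample {..<n}" by (rule finite_measure_sample) simp
  have Qpsd: "psd Q" unfolding Q_def by (rule psd_gram)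
  have mS: "(\<lambda>z. scatter z n) \<in> borel_measurable (sample {..<n})" by (rule measurable_scatter) simp
  have mT: "T \<in> borel_measurable (sample {..<n})" unfolding T_def
    by (intro borel_measurable_trace borel_measurable_matrix_mult borel_measurable_matrix_inv borel_measurable_add borel_measurable_const mS)
  have mH: "H \<in> borel_measurable (sample {..<n})" unfolding H_def correction_def
    by (intro borel_measurable_trace borel_measurable_matrix_mult borel_measurable_matrix_inv borel_measurable_add borel_measurable_const
       borel_measurable_scaleR mS)
  have T: "0 \<le> T z \<and> T z \<le> real CARD('m) / \<beta>" if S: "pos_def_matrix (scatter z n)" for z
  proof -
    have W: "pos_def_matrix (scatter z n + \<beta> *\<^sub>R Q)"
      by (intro pd_add_psd S psd_scaleR Qpsd) (use assms in auto)
    have le: "\<beta> * (x \<bullet> (Q *v x)) \<le> x \<bullet> ((scatter z n + \<beta> *\<^sub>R Q) *v x)" for x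
      using psdD(1)[OF psd_scatter, of x z n] 
      by (simp add: matrix_vector_mult_add_rdistrib inner_add_right flip: scaleR_matrix_vector_assoc)
    have "\<beta> * T z \<le> real CARD('m)"
      unfolding T_def Q_def by (rule trace_gram_inv_le(1)[OF W[unfolded Q_def] le[unfolded Q_def] \<open>0 < \<beta>\<close>])
    then have "T z \<le> real CARD('m) / \<beta>" using \<open>0 < \<beta>\<close> by (simp add: field_simps)
    moreover have "0 \<le> T z" unfolding T_def Q_def trace_gram_mult
      by (intro sum_nonneg quad_inv_nonneg W[unfolded Q_def])
    ultimately show ?thesis by simp
  qed
  have H: "0 \<le> H z \<and> H z \<le> trace (P ** Q)" if S: "pos_def_matrix (scatter z n)" for z
  proof
    have "trace (P ** 0) \<le> H z" unfolding H_def
      by (rule trace_mult_pd_mono[OF P]) (use psdD(1)[OF psd_correction[OF S \<open>0 < \<beta>\<close>]] in simp)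
    then show "0 \<le> H z" by (simp add: trace_def matrix_matrix_mult_def)
    show "H z \<le> trace (P ** Q)" unfolding H_def Q_def
      by (rule trace_mult_pd_mono[OF P]) (rule correction_le_gram[OF S \<open>0 < \<beta>\<close>])
  qed
  note AE = AE_pd_scatter[OF n]
  show iT: "integrable (sample {..<n}) T"
  proof (rule fin.integrable_const_bound[OF _ mT])
    show "AE z in sample {..<n}. norm (T z) \<le> real CARD('m) / \<beta>"
      using AE by eventually_elim (use T in simp)
  qed
  show iH: "integrable (sample {..<n}) H"
  proof (rule fin.integrable_const_bound[OF _ mH])
    show "AE z in sample {..<n}. norm (H z) \<le> trace (P ** Q)"
      using AE by eventually_elim (use H in simp)
  qed
  let ?W = "\<lambda>\<epsilon> z. \<epsilon> *\<^sub>R mat 1 + \<beta> *\<^sub>R Q + scatter z n"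
  let ?r = "\<lambda>\<epsilon> z. \<epsilon> * trace (matrix_inv (?W \<epsilon> z))"
  have mr: "?r \<epsilon> \<in> borel_measurable (sample {..<n})" for \<epsilon>
    by (intro borel_measurable_times borel_measurable_trace borel_measurable_matrix_inv borel_measurable_add borel_measurable_const mS)
  have W: "pos_def_matrix (?W \<epsilon> z)" if "0 < \<epsilon>" for \<epsilon> z
    by (intro pd_add_psd pd_scaleR pd_mat_1 psd_scaleR Qpsd psd_scatter) (use assms that in auto)
  have Wx: "x \<bullet> (?W \<epsilon> z *v x) = \<epsilon> * (x \<bullet> x) + \<beta> * (x \<bullet> (Q *v x)) + x \<bullet> (scatter z n *v x)" for \<epsilon> z x
    by (simp add: matrix_vector_mult_add_rdistrib inner_add_right flip: scaleR_matrix_vector_assoc)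
  have nn: "0 \<le> \<beta> * (x \<bullet> (Q *v x))" "0 \<le> x \<bullet> (scatter z n *v x)" for z x
    using psdD(1)[OF Qpsd] psdD(1)[OF psd_scatter] \<open>0 < \<beta>\<close> by auto
  have r: "0 \<le> ?r \<epsilon> z" "?r \<epsilon> z \<le> real CARD('p)" if \<epsilon>: "0 < \<epsilon>" for \<epsilon> z
  proof -
    have d: "0 \<le> matrix_inv (?W \<epsilon> z) $ i $ i" "\<epsilon> * matrix_inv (?W \<epsilon> z) $ i $ i \<le> 1" for i
    proof -
      show "0 \<le> matrix_inv (?W \<epsilon> z) $ i $ i" by (rule psd_diag_nonneg[OF pd_imp_psd[OF pd_matrix_inv[OF W[OF \<epsilon>]]]])
      have "\<epsilon> * (axis i 1 \<bullet> (matrix_inv (?W \<epsilon> z) *v axis i 1)) \<le> 1"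
      proof (rule quad_inv_le_one[OF W[OF \<epsilon>]])
        fix y :: "real^'p"
        have "(axis i 1 \<bullet> y)\<^sup>2 \<le> y \<bullet> y" using Cauchy_Schwarz_ineq[of "axis i 1" y] by (simp add: inner_axis_axis)
        then have "\<epsilon> * (axis i 1 \<bullet> y)\<^sup>2 \<le> \<epsilon> * (y \<bullet> y)" using \<epsilon> by (intro mult_left_mono) auto
        then show "\<epsilon> * (axis i 1 \<bullet> y)\<^sup>2 \<le> y \<bullet> (?W \<epsilon> z *v y)" using nn(1)[of y] nn(2)[of y z] unfolding Wx by linarith
      qed
      then show "\<epsilon> * matrix_inv (?W \<epsilon> z) $ i $ i \<le> 1" by (simp only: quad_axis)
    qed
    show "0 \<le> ?r \<epsilon> z" using \<epsilon> d by (auto simp: trace_def intro!: mult_nonneg_nonneg sum_nonneg)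
    have "?r \<epsilon> z \<le> (\<Sum>i\<in>(UNIV :: 'p set). 1)" unfolding trace_def sum_distrib_left by (intro sum_mono d)
    then show "?r \<epsilon> z \<le> real CARD('p)" by simp
  qed
  have rn: "norm (?r \<epsilon> z) \<le> real CARD('p)" if "0 < \<epsilon>" for \<epsilon> z
    unfolding real_norm_def abs_of_nonneg[OF r(1)[OF that]] by (rule r(2)[OF that])
  have ir: "integrable (sample {..<n}) (?r \<epsilon>)" if "0 < \<epsilon>" for \<epsilon>
  proof (rule fin.integrable_const_bound[OF _ mr])
    show "AE z in sample {..<n}. norm (?r \<epsilon> z) \<le> real CARD('p)"
      by (intro AE_I2 rn that)
  qed
  define K where "K = 2 * real CARD('m) / \<beta> + (\<Sum>i\<in>UNIV. ((X $ i) \<bullet> (X $ i) + (P *v X $ i) \<bullet> (P *v X $ i)) / 2)"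
  define \<nu> where "\<nu> = real n - real CARD('p) + real CARD('m)"
  have main: "(\<integral>z. H z \<partial>sample {..<n}) \<le> \<nu> * (\<integral>z. T z \<partial>sample {..<n}) + K * (\<integral>z. ?r \<epsilon> z \<partial>sample {..<n})"
    if \<epsilon>: "0 < \<epsilon>" for \<epsilon>
  proof -
    note st = stein_term_sample[OF \<open>0 < \<beta>\<close> \<epsilon>, of _ n X, folded Q_def]
    let ?rhs = "\<lambda>z. \<nu> * T z + K * ?r \<epsilon> z - (\<Sum>k<n. stein_term P Q (?W \<epsilon> z) (z k))"
    have ist: "integrable (sample {..<n}) (\<lambda>z. \<Sum>k<n. stein_term P Q (?W \<epsilon> z) (z k))"
      by (intro Bochner_Integration.integrable_sum st(1)) simp
    have "(\<integral>z. H z \<partial>sample {..<n}) \<le> (\<integral>z. ?rhs z \<partial>sample {..<n})"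
    proof (rule integral_mono_AE[OF iH])
      show "integrable (sample {..<n}) ?rhs"
        by (intro Bochner_Integration.integrable_diff Bochner_Integration.integrable_add integrable_mult_right iT ir \<epsilon> ist)
      show "AE z in sample {..<n}. H z \<le> ?rhs z"
        using AE
      proof eventually_elim
        case (elim z)
        show ?case using stein_pointwise[OF P elim \<open>0 < \<beta>\<close> \<epsilon> n, of X]
          unfolding H_def T_def K_def \<nu>_def Q_def .
      qed
    qed
    also have "\<dots> = \<nu> * (\<integral>z. T z \<partial>sample {..<n}) + K * (\<integral>z. ?r \<epsilon> z \<partial>sample {..<n}) - (\<integral>z. (\<Sum>k<n. stein_term P Q (?W \<epsilon> z) (z k)) \<partial>sample {..<n})"
      by (simp only: Bochner_Integration.integral_diff Bochner_Integration.integral_add integral_mult_right_zero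
          Bochner_Integration.integrable_add integrable_mult_right iT ir[OF \<epsilon>] ist)
    also have "(\<integral>z. (\<Sum>k<n. stein_term P Q (?W \<epsilon> z) (z k)) \<partial>sample {..<n}) = 0"
      using st(2) by (subst Bochner_Integration.integral_sum[OF st(1)]) simp_all
    finally show ?thesis by simp
  qed
  let ?e = "\<lambda>i. 1 / real (Suc i)"
  have e0: "?e \<longlonglongrightarrow> 0" using LIMSEQ_inverse_real_of_nat by (simp add: inverse_eq_divide)
  have lim: "(\<lambda>i. \<integral>z. ?r (?e i) z \<partial>sample {..<n}) \<longlonglongrightarrow> (\<integral>z. 0 \<partial>sample {..<n})"
  proof (rule integral_dominated_convergence[where w="\<lambda>_. real CARD('p)"])
    show "AE z in sample {..<n}. (\<lambda>i. ?r (?e i) z) \<longlonglongrightarrow> 0"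
      using AE
    proof eventually_elim
      case (elim z)
      have up: "?r \<epsilon> z \<le> \<epsilon> * trace (matrix_inv (scatter z n))" if "0 < \<epsilon>" for \<epsilon>
      proof -
        have "matrix_inv (?W \<epsilon> z) $ i $ i \<le> matrix_inv (scatter z n) $ i $ i" for i
        proof -
          have "axis i 1 \<bullet> (matrix_inv (?W \<epsilon> z) *v axis i 1) \<le> axis i 1 \<bullet> (matrix_inv (scatter z n) *v axis i 1)"
          proof (rule quad_inv_antimono[OF elim W[OF that]])
            show "x \<bullet> (scatter z n *v x) \<le> x \<bullet> (?W \<epsilon> z *v x)" for x
              unfolding Wx using nn(1)[of x] mult_nonneg_nonneg[OF less_imp_le[OF that] inner_ge_zero[of x]] by linarith
          qed
          then show ?thesis by (simp only: quad_axis)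
        qed
        then show ?thesis using that by (auto simp: trace_def intro!: mult_left_mono sum_mono)
      qed
      show ?case
      proof (rule tendsto_sandwich[where f="\<lambda>_. 0" and h="\<lambda>i. ?e i * trace (matrix_inv (scatter z n))"])
        show "(\<lambda>i. ?e i * trace (matrix_inv (scatter z n))) \<longlonglongrightarrow> 0"
          using tendsto_mult_left_zero[OF e0] by simp
        show "\<forall>\<^sub>F i in sequentially. ?r (?e i) z \<le> ?e i * trace (matrix_inv (scatter z n))"
          by (intro always_eventually allI up) simp
        show "\<forall>\<^sub>F i in sequentially. 0 \<le> ?r (?e i) z"
          by (intro always_eventually allI r(1)) simp
      qed simp
    qed
    show "AE z in sample {..<n}. norm (?r (?e i) z) \<le> real CARD('p)" for i
      by (intro AE_I2 rn) simp
    show "(\<lambda>z. ?r (?e i) z) \<in> borel_measurable (sample {..<n})" for i by (rule mr)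
  qed simp_all
  have "(\<lambda>i. \<nu> * (\<integral>z. T z \<partial>sample {..<n}) + K * (\<integral>z. ?r (?e i) z \<partial>sample {..<n})) \<longlonglongrightarrow> \<nu> * (\<integral>z. T z \<partial>sample {..<n}) + K * 0"
    by (intro tendsto_add tendsto_const tendsto_mult_left) (use lim in \<open>simp only: integral_zero\<close>)
  then have "(\<integral>z. H z \<partial>sample {..<n}) \<le> \<nu> * (\<integral>z. T z \<partial>sample {..<n}) + K * 0"
    by (rule LIMSEQ_le_const) (intro exI allI impI main, simp)
  then show "(\<integral>z. H z \<partial>sample {..<n}) \<le> (real n - real CARD('p) + real CARD('m)) * (\<integral>z. T z \<partial>sample {..<n})"
    by (simp add: \<nu>_def)
qed

lemma emeasure_N_pos: "0 < emeasure N UNIV"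
proof (rule ccontr)
  assume "\<not> ?thesis"
  then have "(\<integral>\<^sup>+z. ennreal (dens z) \<partial>lborel) = 0" by (simp add: N_def emeasure_density)
  then have "AE z in lborel. ennreal (dens z) = 0" by (subst (asm) nn_integral_0_iff_AE) auto
  then have "AE z in (lborel :: (real^'p) measure). False"
    by (rule eventually_mono) (metis dens_pos ennreal_eq_0_iff not_le)
  then have "UNIV \<in> null_sets (lborel :: (real^'p) measure)" by (simp add: AE_iff_null)
  then show False by (auto dest: null_setsD1)
qed

lemma emeasure_sample_pos:
  assumes "finite I"
  shows "0 < emeasure (sample I) (space (sample I))"
proof -
  have "emeasure (sample I) (space (sample I)) = (\<Prod>i\<in>I. emeasure N (space N))"
    unfolding space_PiM using assms by (intro emeasure_PiM) auto
  then have "emeasure (sample I) (space (sample I)) = emeasure N UNIV ^ card I" by simp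
  then show ?thesis using emeasure_N_pos by (metis not_gr_zero power_eq_0_iff)
qed

end

section \<open>Comparison of the risks\<close>

lemma measurable_stein_loss [measurable]:
  fixes f :: "'x \<Rightarrow> real^'p^'p"
  assumes "f \<in> borel_measurable M"
  shows "(\<lambda>x. stein_loss (f x) \<Sigma>) \<in> borel_measurable M"
  unfolding stein_loss_def
  by (intro borel_measurable_diff borel_measurable_trace borel_measurable_ln borel_measurable_det borel_measurable_matrix_mult
      borel_measurable_const assms)

lemma stein_loss_scaleR:
  fixes A \<Sigma> :: "real^'p^'p"
  assumes "pos_def_matrix A" "pos_def_matrix \<Sigma>" "0 < c"
  shows "stein_loss (c *\<^sub>R A) \<Sigma> = c * trace (matrix_inv \<Sigma> ** A) - ln (det A)
    - (ln (det (c *\<^sub>R mat 1 ** matrix_inv \<Sigma>)) + real CARD('p))"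
proof -
  have "pos_def_matrix (c *\<^sub>R mat 1 :: real^'p^'p)" by (intro pd_scaleR pd_mat_1 assms)
  then have pos: "0 < det (c *\<^sub>R mat 1 :: real^'p^'p)" "0 < det (matrix_inv \<Sigma>)" "0 < det A"
    using pd_det_pos pd_matrix_inv assms by blast+
  have "c *\<^sub>R A = (c *\<^sub>R mat 1) ** A" by (simp add: matrix_mult_scaleR_left)
  then have "ln (det (c *\<^sub>R A ** matrix_inv \<Sigma>)) = ln (det (c *\<^sub>R mat 1 ** matrix_inv \<Sigma>)) + ln (det A)"
    using pos by (simp add: det_mul ln_mult)
  moreover have "trace (c *\<^sub>R A ** matrix_inv \<Sigma>) = c * trace (matrix_inv \<Sigma> ** A)"
    by (simp add: matrix_mult_scaleR_left trace_scaleR trace_mul_sym[of A])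
  ultimately show ?thesis by (simp add: stein_loss_def)
qed

lemma Sigma_hat_G1_eq:
  "Sigma_hat_G1 n \<alpha> \<beta> X S = (1 / real n) *\<^sub>R (S + \<alpha> *\<^sub>R correction \<beta> X S)"
  by (simp add: Sigma_hat_G1_def Sigma_hat_0_def correction_def scaleR_add_right)

lemma stein_loss_G1_le:
  fixes S \<Sigma> :: "real^'p^'p" and X :: "real^'p^'m"
  assumes S: "pos_def_matrix S" and \<Sigma>: "pos_def_matrix \<Sigma>" and "0 < n" "0 < \<alpha>" "0 < \<beta>"
  shows "stein_loss (Sigma_hat_G1 n \<alpha> \<beta> X S) \<Sigma> \<le> stein_loss (Sigma_hat_0 n X S) \<Sigma>
    + \<alpha> / real n * trace (matrix_inv \<Sigma> ** correction \<beta> X S)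
    - \<beta> * ln (1 + \<alpha> / \<beta>) * trace (transpose X ** X ** matrix_inv (S + \<beta> *\<^sub>R (transpose X ** X)))"
proof -
  have pd: "pos_def_matrix (S + \<alpha> *\<^sub>R correction \<beta> X S)"
    by (intro pd_add_psd S psd_scaleR psd_correction) (use assms in auto)
  have c: "0 < 1 / real n" using \<open>0 < n\<close> by simp
  have "trace (matrix_inv \<Sigma> ** (S + \<alpha> *\<^sub>R correction \<beta> X S)) = trace (matrix_inv \<Sigma> ** S) + \<alpha> * trace (matrix_inv \<Sigma> ** correction \<beta> X S)"
    by (simp only: matrix_add_ldistrib matrix_mult_scaleR_right trace_add trace_scaleR)
  then have "1 / real n * trace (matrix_inv \<Sigma> ** (S + \<alpha> *\<^sub>R correction \<beta> X S)) =
     1 / real n * trace (matrix_inv \<Sigma> ** S) + \<alpha> / real n * trace (matrix_inv \<Sigma> ** correction \<beta> X S)"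
    by (simp add: add_divide_distrib)
  then show ?thesis
    unfolding Sigma_hat_G1_eq Sigma_hat_0_def stein_loss_scaleR[OF pd \<Sigma> c] stein_loss_scaleR[OF S \<Sigma> c]
    using ln_det_correction_ge[OF S \<open>0 < \<beta>\<close>, of \<alpha> X] \<open>0 < \<alpha>\<close> by linarith
qed

context gaussian
begin

lemma stein_loss_integrable:
  assumes n: "CARD('p) \<le> n" and \<Sigma>: "pos_def_matrix \<Sigma>" "P = matrix_inv \<Sigma>"
  shows "integrable (sample {..<n}) (\<lambda>z. stein_loss ((1 / real n) *\<^sub>R scatter z n) \<Sigma>)"
proof (rule integrableI_bounded)
  have n0: "0 < n" using n by (metis gr0I not_gr_zero zero_less_card_finite le_zero_eq)
  then have c: "0 < 1 / real n" by simp
  interpret fin: finite_measure "sample {..<n}" by (rule finite_measure_sample) simp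
  have mS: "(\<lambda>z. scatter z n) \<in> borel_measurable (sample {..<n})" by (rule measurable_scatter) simp
  show "(\<lambda>z. stein_loss ((1 / real n) *\<^sub>R scatter z n) \<Sigma>) \<in> borel_measurable (sample {..<n})"
    by (intro measurable_stein_loss borel_measurable_scaleR borel_measurable_const mS)
  define k where "k = - (ln (det ((1 / real n) *\<^sub>R mat 1 ** matrix_inv \<Sigma>)) + real CARD('p))"
  obtain KP where KP: "0 < KP" "\<And>x. norm (P *v x) \<le> KP * norm x" using norm_matrix_vec_bound[of P] by blast
  have tr: "trace (matrix_inv \<Sigma> ** scatter z n) \<le> (\<Sum>k<n. KP * (norm (z k))\<^sup>2)" for z
    unfolding trace_mult_sum_outer \<Sigma>(2)[symmetric]
  proof (rule sum_mono)
    fix i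
    have "z i \<bullet> (P *v z i) \<le> norm (z i) * norm (P *v z i)" by (rule norm_cauchy_schwarz)
    also have "\<dots> \<le> norm (z i) * (KP * norm (z i))" by (intro mult_left_mono KP) simp
    finally show "z i \<bullet> (P *v z i) \<le> KP * (norm (z i))\<^sup>2" by (simp add: power2_eq_square mult_ac)
  qed
  let ?u = "\<lambda>z. 1 / real n * (\<Sum>k<n. KP * (norm (z k))\<^sup>2) + \<bar>k\<bar>"
  have iu: "integrable (sample {..<n}) ?u"
    by (intro Bochner_Integration.integrable_add integrable_mult_right Bochner_Integration.integrable_sum integrable_norm_sq_coord) auto
  have "(\<integral>\<^sup>+z. ennreal (norm (stein_loss ((1 / real n) *\<^sub>R scatter z n) \<Sigma>)) \<partial>sample {..<n})
    \<le> (\<integral>\<^sup>+z. ennreal (norm (?u z)) + neg_ln (det (scatter z n)) \<partial>sample {..<n})"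
  proof (rule nn_integral_mono_AE)
    show "AE z in sample {..<n}. ennreal (norm (stein_loss ((1 / real n) *\<^sub>R scatter z n) \<Sigma>)) \<le> ennreal (norm (?u z)) + neg_ln (det (scatter z n))"
      using AE_pd_scatter[OF n]
    proof eventually_elim
      case (elim z)
      have nn: "0 \<le> stein_loss ((1 / real n) *\<^sub>R scatter z n) \<Sigma>"
        by (intro stein_loss_nonneg pd_scaleR elim \<Sigma> c)
      have "stein_loss ((1 / real n) *\<^sub>R scatter z n) \<Sigma> = 1 / real n * trace (matrix_inv \<Sigma> ** scatter z n) + k - ln (det (scatter z n))"
        unfolding stein_loss_scaleR[OF elim \<Sigma>(1) c] k_def by simp
      also have "\<dots> \<le> ?u z + max 0 (- ln (det (scatter z n)))"
        using mult_left_mono[OF tr[of z] less_imp_le[OF c]] by linarith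
      also have "\<dots> \<le> norm (?u z) + max 0 (- ln (det (scatter z n)))" unfolding real_norm_def by linarith
      finally have "ennreal (norm (stein_loss ((1 / real n) *\<^sub>R scatter z n) \<Sigma>)) \<le> ennreal (norm (?u z) + max 0 (- ln (det (scatter z n))))"
        unfolding real_norm_def[of "stein_loss _ _"] abs_of_nonneg[OF nn] by (rule ennreal_leI)
      also have "\<dots> = ennreal (norm (?u z)) + ennreal (max 0 (- ln (det (scatter z n))))"
        by (rule ennreal_plus) auto
      also have "ennreal (max 0 (- ln (det (scatter z n)))) = neg_ln (det (scatter z n))"
        unfolding ennreal_max_0 neg_ln_def using pd_det_pos[OF elim] by simp
      finally show ?case .
    qed
  qed
  also have "\<dots> = (\<integral>\<^sup>+z. ennreal (norm (?u z)) \<partial>sample {..<n}) + (\<integral>\<^sup>+z. neg_ln (det (scatter z n)) \<partial>sample {..<n})"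
  proof (rule nn_integral_add)
    show "(\<lambda>z. ennreal (norm (?u z))) \<in> borel_measurable (sample {..<n})" using iu by measurable
    show "(\<lambda>z. neg_ln (det (scatter z n))) \<in> borel_measurable (sample {..<n})"
      by (intro measurable_compose[OF _ measurable_neg_ln] borel_measurable_det mS)
  qed
  also have "\<dots> < \<infinity>"
    using nn_integral_neg_ln_det_scatter[OF n] iu unfolding integrable_iff_bounded by simp
  finally show "(\<integral>\<^sup>+z. ennreal (norm (stein_loss ((1 / real n) *\<^sub>R scatter z n) \<Sigma>)) \<partial>sample {..<n}) < \<infinity>" .
qed

text \<open>The risks are compared for each fixed \<open>X\<close>. The upper bound for the loss of the new estimator has a
  finite expectation, and the expected gain is at least \<open>\<rho> E T\<close> with \<open>\<rho> > 0\<close>.\<close>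

lemma conditional_risk:
  fixes X :: "real^'p^'m"
  assumes n: "CARD('p) \<le> n" and m: "CARD('m) < CARD('p)" and \<alpha>: "0 < \<alpha>" and \<beta>: "0 < \<beta>"
    and ratio: "\<alpha> / \<beta> \<le> 2 * (real CARD('p) - real CARD('m)) / (real n - real CARD('p) + real CARD('m))"
    and \<Sigma>: "pos_def_matrix \<Sigma>" "P = matrix_inv \<Sigma>"
  defines "R1 \<equiv> \<integral>\<^sup>+z. ennreal (stein_loss (Sigma_hat_G1 n \<alpha> \<beta> X (scatter z n)) \<Sigma>) \<partial>sample {..<n}"
    and "R0 \<equiv> \<integral>\<^sup>+z. ennreal (stein_loss (Sigma_hat_0 n X (scatter z n)) \<Sigma>) \<partial>sample {..<n}"
  shows "R0 < \<infinity>" and "R1 \<le> R0" and "X \<noteq> 0 \<Longrightarrow> R1 < R0"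
proof -
  let ?N = "sample {..<n}"
  let ?l0 = "\<lambda>z. stein_loss (Sigma_hat_0 n X (scatter z n)) \<Sigma>"
  let ?l1 = "\<lambda>z. stein_loss (Sigma_hat_G1 n \<alpha> \<beta> X (scatter z n)) \<Sigma>"
  define T where "T z = trace (transpose X ** X ** matrix_inv (scatter z n + \<beta> *\<^sub>R (transpose X ** X)))" for z
  define H where "H z = trace (P ** correction \<beta> X (scatter z n))" for z
  define \<nu> where "\<nu> = real n - real CARD('p) + real CARD('m)"
  define \<rho> where "\<rho> = \<beta> * ln (1 + \<alpha> / \<beta>) - \<alpha> / real n * \<nu>"
  have n0: "0 < n" using m n by linarith
  have c: "0 < 1 / real n" using n0 by simp
  have "0 < real CARD('m)" "real CARD('p) \<le> real n" using n by simp_all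
  then have \<nu>: "0 < \<nu>" unfolding \<nu>_def by linarith
  have \<rho>: "0 < \<rho>"
  proof -
    let ?x = "\<alpha> / \<beta>"
    have x: "0 < ?x" using \<alpha> \<beta> by simp
    have "?x * \<nu> \<le> 2 * (real CARD('p) - real CARD('m))"
      using ratio \<nu> by (simp add: \<nu>_def[symmetric] pos_le_divide_eq)
    then have "\<nu> * (2 + ?x) \<le> 2 * real n" by (simp add: \<nu>_def algebra_simps)
    moreover have "0 < 2 + ?x" using x by linarith
    ultimately have "\<nu> / real n \<le> 2 / (2 + ?x)" using n0
      by (simp only: pos_divide_le_eq pos_le_divide_eq of_nat_0_less_iff times_divide_eq_left)
    then have "?x * (\<nu> / real n) \<le> ?x * (2 / (2 + ?x))" using x by (intro mult_left_mono) auto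
    also have "\<dots> < ln (1 + ?x)" using ln_one_plus_gt[OF x] by (simp add: mult_ac)
    finally have "\<beta> * (?x * (\<nu> / real n)) < \<beta> * ln (1 + ?x)" using \<beta> by (rule mult_strict_left_mono)
    then show ?thesis using \<beta> by (simp add: \<rho>_def)
  qed
  note E = expectation_trace_correction_le[OF \<beta> n, of X, folded T_def H_def \<nu>_def]
  have iT: "integrable ?N T" using E(1) by (simp only: T_def[abs_def])
  have iH: "integrable ?N H" using E(2) by (simp only: H_def[abs_def])
  have EH: "(\<integral>z. H z \<partial>?N) \<le> \<nu> * (\<integral>z. T z \<partial>?N)" using E(3) by (simp only: H_def T_def)
  have i0: "integrable ?N ?l0"
    unfolding Sigma_hat_0_def by (rule stein_loss_integrable[OF n \<Sigma>])
  note AE = AE_pd_scatter[OF n]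
  have l0: "0 \<le> ?l0 z" if "pos_def_matrix (scatter z n)" for z
    unfolding Sigma_hat_0_def by (intro stein_loss_nonneg pd_scaleR that \<Sigma> c)
  have l1: "0 \<le> ?l1 z" if "pos_def_matrix (scatter z n)" for z
    unfolding Sigma_hat_G1_eq using \<alpha> \<beta>
    by (intro stein_loss_nonneg pd_scaleR pd_add_psd psd_scaleR psd_correction that \<Sigma> c) auto
  \<comment> \<open>an integrable majorant of the loss of the new estimator\<close>
  let ?e = "\<lambda>z. ?l0 z + \<alpha> / real n * H z - \<beta> * ln (1 + \<alpha> / \<beta>) * T z"
  have ie: "integrable ?N ?e"
    by (intro Bochner_Integration.integrable_diff Bochner_Integration.integrable_add integrable_mult_right i0 iH iT)
  have l1e: "?l1 z \<le> ?e z" if "pos_def_matrix (scatter z n)" for z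
    using stein_loss_G1_le[OF that \<Sigma>(1) n0 \<alpha> \<beta>, of X] unfolding H_def T_def \<Sigma>(2) .
  have R0: "R0 = ennreal (\<integral>z. ?l0 z \<partial>?N)"
    unfolding R0_def
  proof (rule nn_integral_eq_integral[OF i0])
    show "AE z in ?N. 0 \<le> ?l0 z" using AE by eventually_elim (rule l0)
  qed
  then show "R0 < \<infinity>" by simp
  have e0: "AE z in ?N. 0 \<le> ?e z"
    using AE by eventually_elim (rule order_trans[OF l1 l1e])
  have "R1 \<le> (\<integral>\<^sup>+z. ennreal (?e z) \<partial>?N)"
    unfolding R1_def
  proof (rule nn_integral_mono_AE)
    show "AE z in ?N. ennreal (?l1 z) \<le> ennreal (?e z)"
      using AE by eventually_elim (intro ennreal_leI l1e)
  qed
  also have "\<dots> = ennreal (\<integral>z. ?e z \<partial>?N)" by (rule nn_integral_eq_integral[OF ie e0])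
  finally have R1: "R1 \<le> ennreal (\<integral>z. ?e z \<partial>?N)" .
  have Ee: "(\<integral>z. ?e z \<partial>?N) \<le> (\<integral>z. ?l0 z \<partial>?N) - \<rho> * (\<integral>z. T z \<partial>?N)"
  proof -
    have "(\<integral>z. ?e z \<partial>?N) = (\<integral>z. ?l0 z \<partial>?N) + \<alpha> / real n * (\<integral>z. H z \<partial>?N) - \<beta> * ln (1 + \<alpha> / \<beta>) * (\<integral>z. T z \<partial>?N)"
      by (simp only: Bochner_Integration.integral_diff Bochner_Integration.integral_add integral_mult_right_zero
          Bochner_Integration.integrable_add integrable_mult_right i0 iH iT)
    moreover have "\<alpha> / real n * (\<integral>z. H z \<partial>?N) \<le> \<alpha> / real n * (\<nu> * (\<integral>z. T z \<partial>?N))"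
      using \<alpha> by (intro mult_left_mono EH) auto
    moreover have "\<rho> * (\<integral>z. T z \<partial>?N) = \<beta> * ln (1 + \<alpha> / \<beta>) * (\<integral>z. T z \<partial>?N) - \<alpha> / real n * (\<nu> * (\<integral>z. T z \<partial>?N))"
      by (simp add: \<rho>_def algebra_simps)
    ultimately show ?thesis by linarith
  qed
  have W: "pos_def_matrix (scatter z n + \<beta> *\<^sub>R (transpose X ** X))" if "pos_def_matrix (scatter z n)" for z
    by (intro pd_add_psd that psd_scaleR psd_gram) (use \<beta> in auto)
  have T0: "AE z in ?N. 0 \<le> T z"
    using AE
  proof eventually_elim
    case (elim z)
    show ?case unfolding T_def trace_gram_mult by (intro sum_nonneg quad_inv_nonneg W elim)
  qed
  have ET: "0 \<le> (\<integral>z. T z \<partial>?N)" by (rule integral_nonneg_AE[OF T0])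
  have "ennreal (\<integral>z. ?e z \<partial>?N) \<le> ennreal (\<integral>z. ?l0 z \<partial>?N)"
    using Ee mult_nonneg_nonneg[OF less_imp_le[OF \<rho>] ET] by (intro ennreal_leI) linarith
  then show "R1 \<le> R0" unfolding R0 by (rule order_trans[OF R1])
  assume "X \<noteq> 0"
  then obtain i where i: "X $ i \<noteq> 0" by (auto simp: vec_eq_iff)
  have "(\<integral>z. T z \<partial>?N) \<noteq> 0"
  proof
    assume "(\<integral>z. T z \<partial>?N) = 0"
    then have "AE z in ?N. T z = 0" using integral_nonneg_eq_0_iff_AE[OF iT T0] by simp
    then have "AE z in ?N. False"
      using AE
    proof eventually_elim
      case (elim z)
      have "0 < X $ i \<bullet> (matrix_inv (scatter z n + \<beta> *\<^sub>R (transpose X ** X)) *v X $ i)"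
        by (rule pdD(1)[OF pd_matrix_inv[OF W[OF elim(2)]] i])
      also have "\<dots> \<le> T z" unfolding T_def trace_gram_mult
        by (rule member_le_sum) (auto intro!: quad_inv_nonneg W elim)
      finally show False using elim(1) by simp
    qed
    then have "space ?N \<in> null_sets ?N" by (simp add: AE_iff_null)
    then show False using emeasure_sample_pos[of "{..<n}"] by (auto dest: null_setsD1)
  qed
  then have pos: "0 < \<rho> * (\<integral>z. T z \<partial>?N)" using ET \<rho> by simp
  have "0 \<le> (\<integral>z. ?e z \<partial>?N)" by (rule integral_nonneg_AE[OF e0])
  then have "ennreal (\<integral>z. ?e z \<partial>?N) < ennreal (\<integral>z. ?l0 z \<partial>?N)"
    using Ee pos by (intro ennreal_lessI) linarith+
  then show "R1 < R0" unfolding R0 by (rule order_le_less_trans[OF R1])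
qed

end

lemma gaussian_multivariate_normal:
  fixes \<Sigma> :: "real^'p^'p"
  assumes "pos_def_matrix \<Sigma>"
  obtains c where "gaussian c (matrix_inv \<Sigma>)" "multivariate_normal 0 \<Sigma> = gaussian.N c (matrix_inv \<Sigma>)"
proof -
  let ?c = "1 / sqrt ((2 * pi) ^ CARD('p) * det \<Sigma>)"
  have g: "gaussian ?c (matrix_inv \<Sigma>)"
    using pd_det_pos[OF assms] by unfold_locales (auto intro: pd_matrix_inv assms)
  have "multivariate_normal 0 \<Sigma> = gaussian.N ?c (matrix_inv \<Sigma>)"
    unfolding multivariate_normal_def gaussian.N_def[OF g] gaussian.dens_def[OF g] by simp
  with g show thesis by (rule that)
qed

lemma measurable_Sigma_hat_G1 [measurable]:
  fixes f :: "'x \<Rightarrow> real^'p^'m" and g :: "'x \<Rightarrow> real^'p^'p"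
  assumes "f \<in> borel_measurable M" "g \<in> borel_measurable M"
  shows "(\<lambda>x. Sigma_hat_G1 n \<alpha> \<beta> (f x) (g x)) \<in> borel_measurable M"
  unfolding Sigma_hat_G1_eq correction_def
  by (intro borel_measurable_add borel_measurable_scaleR borel_measurable_matrix_mult borel_measurable_transpose
     borel_measurable_matrix_inv borel_measurable_const assms)

lemma risk_iterated:
  fixes \<Sigma> :: "real^'p^'p" and \<delta> :: "real^'p^'m \<Rightarrow> real^'p^'p \<Rightarrow> real^'p^'p"
  assumes g: "gaussian c P" and N: "multivariate_normal 0 \<Sigma> = gaussian.N c P"
    and m: "(\<lambda>(X, S). \<delta> X S) \<in> borel_measurable (borel \<Otimes>\<^sub>M borel)"
  shows "risk stein_loss n \<delta> \<Theta> \<Sigma> =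
    (\<integral>\<^sup>+X. (\<integral>\<^sup>+z. ennreal (stein_loss (\<delta> X (scatter z n)) \<Sigma>) \<partial>PiM {..<n} (\<lambda>_. gaussian.N c P)) \<partial>matrix_normal \<Theta> \<Sigma>)"
proof -
  interpret gaussian c P by (rule g)
  have mS: "(\<lambda>z. scatter z n) \<in> sample {..<n} \<rightarrow>\<^sub>M borel" by (rule measurable_scatter) simp
  have w: "wishart n \<Sigma> = distr (sample {..<n}) borel (\<lambda>z. scatter z n)"
    by (simp add: wishart_def N outer_def)
  interpret fin: finite_measure "sample {..<n}" by (rule finite_measure_sample) simp
  interpret W: finite_measure "wishart n \<Sigma>"
    unfolding w by (rule fin.finite_measure_distr[OF mS])
  have sets: "sets (matrix_normal \<Theta> \<Sigma> \<Otimes>\<^sub>M wishart n \<Sigma>) = sets (borel \<Otimes>\<^sub>M borel)"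
    by (intro sets_pair_measure_cong) (simp_all add: matrix_normal_def wishart_def)
  have mloss: "(\<lambda>(X, S). ennreal (stein_loss (\<delta> X S) \<Sigma>)) \<in> borel_measurable (borel \<Otimes>\<^sub>M borel)"
    using measurable_compose[OF measurable_stein_loss[OF m] measurable_ennreal] by (simp add: case_prod_beta')
  then have "(\<lambda>(X, S). ennreal (stein_loss (\<delta> X S) \<Sigma>)) \<in> borel_measurable (matrix_normal \<Theta> \<Sigma> \<Otimes>\<^sub>M wishart n \<Sigma>)"
    using measurable_cong_sets[OF sets refl] by blast
  from W.nn_integral_fst[OF this]
  have "risk stein_loss n \<delta> \<Theta> \<Sigma> = (\<integral>\<^sup>+X. (\<integral>\<^sup>+S. ennreal (stein_loss (\<delta> X S) \<Sigma>) \<partial>wishart n \<Sigma>) \<partial>matrix_normal \<Theta> \<Sigma>)"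
    by (simp add: risk_def)
  also have "\<dots> = (\<integral>\<^sup>+X. (\<integral>\<^sup>+z. ennreal (stein_loss (\<delta> X (scatter z n)) \<Sigma>) \<partial>sample {..<n}) \<partial>matrix_normal \<Theta> \<Sigma>)"
  proof (rule nn_integral_cong)
    fix X :: "real^'p^'m"
    have "(\<lambda>S. ennreal (stein_loss (\<delta> X S) \<Sigma>)) \<in> borel_measurable borel"
      using measurable_compose_Pair1[OF _ mloss, of X] by simp
    then show "(\<integral>\<^sup>+S. ennreal (stein_loss (\<delta> X S) \<Sigma>) \<partial>wishart n \<Sigma>) = (\<integral>\<^sup>+z. ennreal (stein_loss (\<delta> X (scatter z n)) \<Sigma>) \<partial>sample {..<n})"
      unfolding w by (subst nn_integral_distr[OF mS]) simp_all
  qed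
  finally show ?thesis .
qed

text \<open>Strictness holds for every \<open>X \<noteq> 0\<close>; for it to survive integration over \<open>X\<close>, the matrix \<open>X\<close> must not vanish
  almost surely.\<close>

lemma matrix_normal_centered:
  fixes \<Sigma> :: "real^'p^'p"
  assumes \<Sigma>: "pos_def_matrix \<Sigma>"
  defines "M \<equiv> matrix_normal (0 :: real^'p^'m) \<Sigma>"
  shows "finite_measure M" and "\<not> (AE X in M. X = 0)"
proof -
  obtain c where g: "gaussian c (matrix_inv \<Sigma>)" and N: "multivariate_normal 0 \<Sigma> = gaussian.N c (matrix_inv \<Sigma>)"
    by (rule gaussian_multivariate_normal[OF \<Sigma>])
  interpret gaussian c "matrix_inv \<Sigma>" by (rule g)
  interpret fN: finite_measure N by (rule finite_measure_N)
  interpret M: product_sigma_finite "\<lambda>_::'m. N"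
    by (rule product_sigma_finite.intro) unfold_locales
  let ?M = "PiM (UNIV :: 'm set) (\<lambda>_. N)"
  let ?f = "\<lambda>x :: 'm \<Rightarrow> real^'p. \<chi> i. x i"
  have em: "emeasure ?M (PiE UNIV (\<lambda>_. A)) = emeasure N A ^ CARD('m)" if "A \<in> sets borel" for A
    using that by (subst M.emeasure_PiM) auto
  have M: "M = distr ?M borel ?f" by (simp add: M_def matrix_normal_def N)
  have mf: "?f \<in> ?M \<rightarrow>\<^sub>M borel"
  proof -
    have "(\<lambda>x. x i) \<in> ?M \<rightarrow>\<^sub>M borel" for i
      using measurable_component_singleton[of i UNIV "\<lambda>_. N"] measurable_cong_sets[OF refl sets_N] by blast
    then show ?thesis
      by (subst borel_measurable_euclidean_space) (auto simp: Basis_vec_def inner_axis intro!: borel_measurable_inner)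
  qed
  have sp: "emeasure ?M (space ?M) = emeasure N UNIV ^ CARD('m)"
    using em[of UNIV] by (simp add: space_PiM)
  interpret fM: finite_measure ?M
    by (rule finite_measureI) (use fN.emeasure_finite[of UNIV] in \<open>simp add: sp power_eq_top_ennreal\<close>)
  show "finite_measure M" unfolding M by (rule fM.finite_measure_distr[OF mf])
  show "\<not> (AE X in M. X = 0)"
  proof
    assume "AE X in M. X = 0"
    then have "AE x in ?M. ?f x = 0" unfolding M by (subst (asm) AE_distr_iff[OF mf]) auto
    moreover have "AE x in ?M. ?f x \<noteq> 0"
    proof (rule AE_I')
      have "emeasure N {0} = 0" by (simp add: N_def emeasure_density nn_integral_indicator_singleton)
      then have "emeasure ?M (PiE UNIV (\<lambda>_. {0})) = 0" using em[of "{0}"] by simp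
      moreover have "PiE UNIV (\<lambda>_. {0}) \<in> sets ?M" by (rule sets_PiM_I_finite) simp_all
      ultimately show "PiE UNIV (\<lambda>_. {0}) \<in> null_sets ?M" by (rule null_setsI)
      show "{x \<in> space ?M. \<not> ?f x \<noteq> 0} \<subseteq> PiE UNIV (\<lambda>_. {0})"
        by (auto simp: vec_eq_iff PiE_def)
    qed
    ultimately have "AE x in ?M. False" by eventually_elim simp
    then have "space ?M \<in> null_sets ?M" by (simp add: AE_iff_null)
    then have "emeasure N UNIV ^ CARD('m) = 0" using sp by (auto dest: null_setsD1)
    then show False using emeasure_N_pos by simp
  qed
qed

theorem theorem4p2:
  fixes n :: nat and \<alpha> \<beta> :: real
  assumes "n \<ge> CARD('p::finite)"
    and "CARD('p) > CARD('m::finite)"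
    and "\<alpha> > 0" and "\<beta> > 0"
    and "\<alpha> / \<beta> \<le> 2 * (real CARD('p) - real CARD('m)) / (real n - real CARD('p) + real CARD('m))"
  shows "dominates stein_loss n
           (Sigma_hat_G1 n \<alpha> \<beta> :: real^'p^'m \<Rightarrow> real^'p^'p \<Rightarrow> real^'p^'p)
           (Sigma_hat_0 n)"
  unfolding dominates_def
proof (intro conjI allI impI)
  let ?G1 = "Sigma_hat_G1 n \<alpha> \<beta> :: real^'p^'m \<Rightarrow> real^'p^'p \<Rightarrow> real^'p^'p"
  let ?S0 = "Sigma_hat_0 n :: real^'p^'m \<Rightarrow> real^'p^'p \<Rightarrow> real^'p^'p"
  have mG1: "(\<lambda>(X, S). ?G1 X S) \<in> borel_measurable (borel \<Otimes>\<^sub>M borel)"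
    unfolding case_prod_beta' by (intro measurable_Sigma_hat_G1 measurable_fst measurable_snd)
  have mS0: "(\<lambda>(X, S). ?S0 X S) \<in> borel_measurable (borel \<Otimes>\<^sub>M borel)"
    unfolding case_prod_beta' Sigma_hat_0_def by (intro borel_measurable_scaleR borel_measurable_const measurable_snd)
  {
    fix \<Theta> :: "real^'p^'m" and \<Sigma> :: "real^'p^'p"
    assume \<Sigma>: "pos_def_matrix \<Sigma>"
    obtain c where g: "gaussian c (matrix_inv \<Sigma>)" and N: "multivariate_normal 0 \<Sigma> = gaussian.N c (matrix_inv \<Sigma>)"
      by (rule gaussian_multivariate_normal[OF \<Sigma>])
    interpret gaussian c "matrix_inv \<Sigma>" by (rule g)
    show "risk stein_loss n ?G1 \<Theta> \<Sigma> \<le> risk stein_loss n ?S0 \<Theta> \<Sigma>"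
      unfolding risk_iterated[OF g N mG1] risk_iterated[OF g N mS0]
      by (intro nn_integral_mono conditional_risk(2)[OF assms \<Sigma> refl])
  }
  \<comment> \<open>strictness is only needed at one parameter; \<open>\<Theta> = 0\<close> and \<open>\<Sigma> = I\<close> are convenient\<close>
  let ?\<Sigma> = "mat 1 :: real^'p^'p"
  have \<Sigma>: "pos_def_matrix ?\<Sigma>" by (rule pd_mat_1)
  obtain c where g: "gaussian c (matrix_inv ?\<Sigma>)" and N: "multivariate_normal 0 ?\<Sigma> = gaussian.N c (matrix_inv ?\<Sigma>)"
    by (rule gaussian_multivariate_normal[OF \<Sigma>])
  interpret gaussian c "matrix_inv ?\<Sigma>" by (rule g)
  let ?M = "matrix_normal (0 :: real^'p^'m) ?\<Sigma>"
  let ?R = "\<lambda>\<delta> X. \<integral>\<^sup>+z. ennreal (stein_loss (\<delta> X (scatter z n)) ?\<Sigma>) \<partial>sample {..<n}"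
  interpret M: finite_measure ?M by (rule matrix_normal_centered(1)[OF \<Sigma>])
  interpret fin: finite_measure "sample {..<n}" by (rule finite_measure_sample) simp
  have cr: "?R ?S0 X < \<infinity>" "?R ?G1 X \<le> ?R ?S0 X" "X \<noteq> 0 \<Longrightarrow> ?R ?G1 X < ?R ?S0 X" for X
    by (rule conditional_risk[OF assms \<Sigma> refl], assumption?)+
  have mR: "?R \<delta> \<in> borel_measurable ?M" if "(\<lambda>(X, S). \<delta> X S) \<in> borel_measurable (borel \<Otimes>\<^sub>M borel)" 
    for \<delta> :: "real^'p^'m \<Rightarrow> real^'p^'p \<Rightarrow> real^'p^'p"
  proof -
    have mS: "(\<lambda>z. scatter z n) \<in> sample {..<n} \<rightarrow>\<^sub>M borel" by (rule measurable_scatter) simp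
    have "(\<lambda>w. (fst w, scatter (snd w) n)) \<in> borel \<Otimes>\<^sub>M sample {..<n} \<rightarrow>\<^sub>M borel \<Otimes>\<^sub>M borel"
      by (intro measurable_Pair measurable_fst measurable_compose[OF measurable_snd mS])
    from measurable_compose[OF this that]
    have "(\<lambda>w. \<delta> (fst w) (scatter (snd w) n)) \<in> borel \<Otimes>\<^sub>M sample {..<n} \<rightarrow>\<^sub>M borel" by simp
    from measurable_compose[OF measurable_stein_loss[OF this] measurable_ennreal]
    have "(\<lambda>(X, z). ennreal (stein_loss (\<delta> X (scatter z n)) ?\<Sigma>)) \<in> borel_measurable (borel \<Otimes>\<^sub>M sample {..<n})"
      by (simp add: case_prod_beta')
    then have "?R \<delta> \<in> borel_measurable borel" by (rule fin.borel_measurable_nn_integral)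
    moreover have "sets ?M = sets borel" by (simp add: matrix_normal_def)
    ultimately show ?thesis using measurable_cong_sets[of ?M borel borel borel] by blast
  qed
  have S0_const: "?R ?S0 X = ?R ?S0 0" for X by (simp add: Sigma_hat_0_def)
  have "(\<integral>\<^sup>+X. ?R ?G1 X \<partial>?M) < (\<integral>\<^sup>+X. ?R ?S0 X \<partial>?M)"
  proof (rule nn_integral_less)
    show "?R ?G1 \<in> borel_measurable ?M" "?R ?S0 \<in> borel_measurable ?M" by (intro mR mG1 mS0)+
    show "AE X in ?M. ?R ?G1 X \<le> ?R ?S0 X" by (intro AE_I2 cr)
    have "(\<integral>\<^sup>+X. ?R ?G1 X \<partial>?M) \<le> (\<integral>\<^sup>+X. ?R ?S0 0 \<partial>?M)"
      by (intro nn_integral_mono order_trans[OF cr(2) eq_refl[OF S0_const]])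
    also have "\<dots> < \<infinity>" using cr(1)[of 0] M.emeasure_finite[of "space ?M"]
      by (simp add: ennreal_mult_eq_top_iff less_top[symmetric])
    finally show "(\<integral>\<^sup>+X. ?R ?G1 X \<partial>?M) \<noteq> \<infinity>" by simp
    show "\<not> (AE X in ?M. ?R ?S0 X \<le> ?R ?G1 X)"
    proof
      assume "AE X in ?M. ?R ?S0 X \<le> ?R ?G1 X"
      then have "AE X in ?M. X = 0" by (rule eventually_mono) (use cr(3) in \<open>force simp: not_le[symmetric]\<close>)
      with matrix_normal_centered(2)[OF \<Sigma>] show False by blast
    qed
  qed
  then have "risk stein_loss n ?G1 0 ?\<Sigma> < risk stein_loss n ?S0 0 ?\<Sigma>"
    unfolding risk_iterated[OF g N mG1] risk_iterated[OF g N mS0] .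
  with \<Sigma> show "\<exists>\<Theta> \<Sigma>. pos_def_matrix \<Sigma> \<and> risk stein_loss n ?G1 \<Theta> \<Sigma> < risk stein_loss n ?S0 \<Theta> \<Sigma>" by blast
qed

end
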